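(* Let $\mathbf f=(f_1,\dots,f_d)$ be a system of formal Taylor expansions about the origin, $f_k(z)=\sum_{n\ge0}\phi_{n,k}z^n$, $\phi_{n,k}\in\mathbb C$, and fix a multi-index $\mathbf m=(m_1,\dots,m_d)\in\mathbb Z_+^d\setminus\{\mathbf 0\}$. Suppose that either of the following assertions takes place: a) $R_0(\mathbf f)>0$ and $\mathbf f$ has exactly $|\mathbf m|$ system poles with respect to $\mathbf m$ counting multiplicities; b) the sequence of denominators $\{Q_{n,\mathbf m}\}_{n\ge|\mathbf m|}$ of the Hermite-Padé approximations of $\mathbf f$ is uniquely determined for all sufficiently large $n$ and there exists a polynomial $Q_{|\mathbf m|}$ of degree $|\mathbf m|$, $Q_{|\mathbf m|}(0)\neq0$, such that $\limsup_{n\to\infty}\|Q_{|\mathbf m|}-Q_{n,\mathbf m}\|^{1/n}=\theta<1$. Then, for each $k=1,\dots,d$, $$\limsup_{n\to\infty}\|f_k-R_{n,\mathbf m,k}\|_K^{1/n}\le\frac{\|z\|_K}{R^*_{|\mathbf m|}(f_k)},\qquad(1)$$ where $K$ is any compact subset of $D^*_{|\mathbf m|}(f_k)\setminus\mathcal P_{|\mathbf m|}(\mathbf f,\mathbf m)$. If, additionally, $K$ is $\sigma$-regular, then equality holds in (1). Moreover, $$R^*_{|\mathbf m|}(f_k)=R^*_{|\mathbf m|,k}(\mathbf f,\mathbf m),\qquad k=1,\dots,d.$$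
   Context: Notation: $|\mathbf m|=m_1+\dots+m_d$; $D_r=\{|z|<r\}$, $\overline D_r=\{|z|\le r\}$; $\|\cdot\|$ is the coefficient norm on polynomials; $\|\cdot\|_K$ is the sup norm on $K$, so $\|z\|_K=\max_{z\in K}|z|$. $f_k$ also denotes its meromorphic extension. $R_0(\mathbf f)$ is the radius of the largest disk centered at the origin in which all the $f_k$ correspond to analytic functions ($0$ if there is none). Hermite-Padé approximants. For each $n\ge\max\{m_1,\dots,m_d\}$ there exist polynomials $Q,P_1,\dots,P_d$ with $\deg P_k\le n-m_k$, $\deg Q\le|\mathbf m|$, $Q\not\equiv0$, and $Q(z)f_k(z)-P_k(z)=A_kz^{n+1}+\cdots$, $k=1,\dots,d$. For each $n$ one solution is chosen and written $(R_{n,\mathbf m,1},\dots,R_{n,\mathbf m,d})=(P_{n,\mathbf m,1},\dots,P_{n,\mathbf m,d})/Q_{n,\mathbf m}$, where $Q_{n,\mathbf m}$ has no common zero simultaneously with all the $P_{n,\mathbf m,k}$ and is monic. For a power series $g$ and $s\in\mathbb Z_+$, $R_s(g)$ is the radius (possibly $+\infty$) of the largest disk centered at the origin to which $g$ extends meromorphically with at most $s$ poles counting multiplicities ($0$ if $g$ has radius of convergence $0$). System poles. $\xi\in\mathbb C\setminus\{0\}$ is a system pole of order $\tau$ of $\mathbf f$ with respect to $\mathbf m$ if for each $s=1,\dots,\tau$ there is at least one polynomial combination $$\sum_{k=1}^dp_kf_k,\qquad\deg p_k<m_k,\ k=1,\dots,d\qquad( * )$$ ($p_k\equiv0$ if $m_k=0$)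 which is analytic on a neighborhood of $\overline D_{|\xi|}$ except for a pole at $z=\xi$ of exact order $s$, and there is no combination of the form $( * )$ with those properties for $s$ greater than $\tau$. System poles are counted according to their order; $\mathcal P_{|\mathbf m|}(\mathbf f,\mathbf m)$ is the set of distinct system poles. For a system pole $\xi$ of order $\tau$ and $s=1,\dots,\tau$, $r_{\xi,s}(\mathbf f,\mathbf m)$ is the largest of all the numbers $R_s(g)$, where $g$ is a combination of type $( * )$ analytic on a neighborhood of $\overline D_{|\xi|}$ except for a pole at $z=\xi$ of order $s$; and $R_{\xi,s}(\mathbf f,\mathbf m)=\min_{j=1,\dots,s}r_{\xi,j}(\mathbf f,\mathbf m)$. Hausdorff content. For $B\subset\mathbb C$, $\sigma(B)=\inf\sum_i|U_i|$, the infimum being over all at most countable coverings $\{U_i\}$ of $B$ by disks, $|U_i|$ being the radius of $U_i$. A sequence $\varphi_n$ converges in $\sigma$-content to $\varphi$ on compact subsets of a domain $D$ if $\lim_{n\to\infty}\sigma\{z\in K:|\varphi_n(z)-\varphi(z)|>\varepsilon\}=0$ for each compact $K\subset D$ and each $\varepsilon>0$. A compact set $K\subset\mathbb C$ is $\sigma$-regular if for each $z_0\in K$ and each $\delta>0$, $\sigma\{z\in K:|z-z_0|<\delta\}>0$. $R^*_{|\mathbf m|}(f_k)$ is the radius of the largest disk centered at the origin on compact subsets of which the sequence $\{R_{n,\mathbf m,k}\}_{n\ge|\mathbf m|}$ converges to $f_k$ in $\sigma$-content, and $D^*_{|\mathbf m|}(f_k)=\{z:|z|<R^*_{|\mathbf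 m|}(f_k)\}$. $D_{|\mathbf m|,k}(\mathbf f,\mathbf m)$ is the largest disk centered at $z=0$ in which all the poles of $f_k$ are system poles of $\mathbf f$ with respect to $\mathbf m$, their order as poles of $f_k$ does not exceed their order as system poles, and $f_k$ has no other singularity; $R_{|\mathbf m|,k}(\mathbf f,\mathbf m)$ is its radius. Let $\xi_1,\dots,\xi_N$ be the poles of $f_k$ in $D_{|\mathbf m|,k}(\mathbf f,\mathbf m)$ and $\widetilde\tau_j$ the order of $\xi_j$ as a pole of $f_k$. Then $$R^*_{|\mathbf m|,k}(\mathbf f,\mathbf m)=\min\Big\{R_{|\mathbf m|,k}(\mathbf f,\mathbf m),\ \min_{j=1,\dots,N}R_{\xi_j,\widetilde\tau_j}(\mathbf f,\mathbf m)\Big\}$$ (the inner minimum being omitted if $N=0$). *)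

theory Defs
  imports "HOL-Complex_Analysis.Complex_Analysis" "HOL-Computational_Algebra.Polynomial_FPS"
begin

text \<open>
  The index \<open>k = 1, ..., d\<close> ranges over an arbitrary finite type \<open>'d\<close>, so that
  \<open>d = CARD('d) \<ge> 1\<close>. Radii live in \<^typ>\<open>ereal\<close>. A ``largest disk with a property''
  is rendered by the supremum of the admissible radii, with \<open>0\<close> inserted so that the
  radius is \<open>0\<close> if there is no such disk; \<^term>\<open>eball 0 r\<close> is the open disk
  \<open>D\<^sub>r\<close>, where \<open>r = \<infinity>\<close> is allowed.
\<close>

definition total_index :: "('d::finite \<Rightarrow> nat) \<Rightarrow> nat" where
  "total_index m = (\<Sum>k\<in>UNIV. m k)"


subsection \<open>Meromorphic extensions of power series\<close>

text \<open>\<^const>\<open>has_fps_expansion\<close> includes that \<open>g\<close> has positive radius of convergence.\<close>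

definition mero_extends :: "complex fps \<Rightarrow> (complex \<Rightarrow> complex) \<Rightarrow> ereal \<Rightarrow> bool" where
  "mero_extends g F r \<longleftrightarrow> F has_fps_expansion g \<and> F meromorphic_on eball 0 r"

definition mero_radius :: "complex fps \<Rightarrow> ereal" where
  "mero_radius g = Sup (insert 0 {r. \<exists>F. mero_extends g F r})"

text \<open>
  ``Nicely'' meromorphic functions have no removable singularities and take the value \<open>0\<close> at
  their poles; this makes the extension unique on the disk of meromorphy. It is meaningful
  only if \<open>g\<close> has positive radius of convergence.
\<close>

definition mero_ext :: "complex fps \<Rightarrow> complex \<Rightarrow> complex" where
  "mero_ext g = (SOME F. F has_fps_expansion g \<and>
                         F nicely_meromorphic_on eball 0 (mero_radius g))"

lemma nicely_meromorphic_extension_unique: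
  assumes "F has_fps_expansion g" "G has_fps_expansion g"
    and "F nicely_meromorphic_on eball 0 r" "G nicely_meromorphic_on eball 0 s"
    and z: "z \<in> eball 0 r" "z \<in> eball 0 s"
  shows "F z = G z"
proof -
  define A where "A = eball (0::complex) (min r s)"
  have A: "open A" "connected A" "z \<in> A" "0 \<in> A"
    using z le_less_trans[of 0 "ereal (norm z)"] by (auto simp: A_def connected_eball simp flip: zero_ereal_def)
  have FA: "F nicely_meromorphic_on A" "G nicely_meromorphic_on A"
    using assms(3,4) by (auto elim!: nicely_meromorphic_on_subset simp: A_def)
  define h where "h = remove_sings (\<lambda>w. F w - G w)"
  have mero: "(\<lambda>w. F w - G w) meromorphic_on A"
    using FA by (auto intro!: meromorphic_intros simp: nicely_meromorphic_on_def)
  have hn: "h nicely_meromorphic_on A"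
    unfolding h_def by (rule remove_sings_nicely_meromorphic[OF mero])
  have ev: "eventually (\<lambda>w. h w = F w - G w) (at w)" if "w \<in> A" for w
    unfolding h_def using mero that
    by (metis eventually_remove_sings_eq_at meromorphic_on_isolated_singularity meromorphic_on_meromorphic_at)
  have "eventually (\<lambda>w. F w = G w) (nhds 0)"
    using assms(1,2) unfolding has_fps_expansion_def by (auto elim: eventually_elim2)
  hence "eventually (\<lambda>w. F w = G w) (at 0)" by (simp add: eventually_nhds_conv_at)
  hence "eventually (\<lambda>w. h w = 0) (at 0)"
    using ev[OF A(4)] by eventually_elim auto
  hence "frequently (\<lambda>w. h w = 0) (at 0)"
    by (simp add: eventually_frequently)
  hence h0: "h w = 0" if "w \<in> A" for w
    using frequently_eq_meromorphic_imp_constant[OF _ hn A(1,2,4)] that by blast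
  have "eventually (\<lambda>w. w \<in> A) (at z)"
    using A by (auto intro!: eventually_at_in_open')
  hence E: "eventually (\<lambda>w. F w = G w) (at z)"
    using ev[OF A(3)] by eventually_elim (use h0 in auto)
  have 1: "(is_pole F z \<and> F z = 0) \<or> F \<midarrow>z\<rightarrow> F z" "(is_pole G z \<and> G z = 0) \<or> G \<midarrow>z\<rightarrow> G z"
    using FA A by (auto simp: nicely_meromorphic_on_def)
  have 2: "is_pole F z \<longleftrightarrow> is_pole G z" using E by (intro is_pole_cong) auto
  have 3: "F \<midarrow>z\<rightarrow> c \<longleftrightarrow> G \<midarrow>z\<rightarrow> c" for c using E by (intro filterlim_cong) auto
  show ?thesis using 1 2 3
    by (metis LIM_unique at_neq_bot is_pole_def not_tendsto_and_filterlim_at_infinity)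
qed

lemma mero_ext_correct:
  assumes "fps_conv_radius g > 0"
  shows "mero_ext g has_fps_expansion g"
    and "mero_ext g nicely_meromorphic_on eball 0 (mero_radius g)"
proof -
  define P where "P = (\<lambda>F r. F has_fps_expansion g \<and> F nicely_meromorphic_on eball 0 r)"
  have ex: "\<exists>F r. ereal (norm z) < r \<and> P F r" if z: "z \<in> eball 0 (mero_radius g)" for z :: complex
  proof -
    have "ereal (norm z) < mero_radius g" using z by simp
    then obtain r F where r: "ereal (norm z) < r" "mero_extends g F r"
      unfolding mero_radius_def less_Sup_iff by auto
    have 0: "0 \<in> eball (0::complex) r"
      using le_less_trans[OF _ r(1), of 0] by (simp flip: zero_ereal_def)
    have F: "F has_fps_expansion g" "F meromorphic_on eball 0 r"
      using r by (auto simp: mero_extends_def)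
    have "eventually (\<lambda>w. remove_sings F w = F w) (nhds 0)"
      using F(1) by (intro eventually_remove_sings_eq_nhds has_fps_expansion_imp_analytic_0)
    hence "remove_sings F has_fps_expansion g"
      using F(1) by (subst has_fps_expansion_cong) auto
    thus ?thesis using remove_sings_nicely_meromorphic[OF F(2)] r(1) unfolding P_def by blast
  qed
  define H where "H = (\<lambda>z :: complex. SOME p. ereal (norm z) < snd p \<and> P (fst p) (snd p))"
  define G where "G = (\<lambda>z. fst (H z) z)"
  have H: "ereal (norm z) < snd (H z)" "P (fst (H z)) (snd (H z))" if z: "z \<in> eball 0 (mero_radius g)" for z :: complex
    using someI_ex[of "\<lambda>p. ereal (norm z) < snd p \<and> P (fst p) (snd p)"] ex[OF z]
    unfolding H_def by auto
  have le: "r \<le> mero_radius g" if "P F r" for F r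
    using that unfolding mero_radius_def P_def
    by (intro Sup_upper) (auto simp: mero_extends_def nicely_meromorphic_on_def)
  have G: "G z = F z" if "P F r" "ereal (norm z) < r" for F :: "complex \<Rightarrow> complex" and r and z :: complex
  proof -
    have z: "z \<in> eball 0 (mero_radius g)" using that le[OF that(1)] by auto
    show ?thesis unfolding G_def
      using nicely_meromorphic_extension_unique[of "fst (H z)" g F "snd (H z)" r z] H[OF z] that by (auto simp: P_def)
  qed
  have evG: "eventually (\<lambda>w. G w = F w) (nhds z)" if "P F r" "ereal (norm z) < r" for F :: "complex \<Rightarrow> complex" and r and z :: complex
  proof -
    have "eventually (\<lambda>w. w \<in> eball 0 r) (nhds z)" using that by (intro eventually_nhds_in_open) auto
    thus ?thesis by eventually_elim (use G that in auto)
  qed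
  have R0: "mero_radius g > 0"
  proof -
    have "mero_extends g (eval_fps g) (fps_conv_radius g)"
      using assms unfolding mero_extends_def
      by (auto simp: has_fps_expansion_def intro!: analytic_on_imp_meromorphic_on analytic_on_eval_fps)
    hence "fps_conv_radius g \<le> mero_radius g" unfolding mero_radius_def by (intro Sup_upper) auto
    thus ?thesis using assms by simp
  qed
  have Gfps: "G has_fps_expansion g"
  proof -
    obtain F r where F: "0 < r" "P F r" using ex[of 0] R0 by (auto simp: zero_ereal_def)
    have "eventually (\<lambda>w. G w = F w) (nhds 0)" using F evG[of F r 0] by (simp add: zero_ereal_def)
    thus ?thesis using F by (subst has_fps_expansion_cong[of G F]) (auto simp: P_def)
  qed
  have Gn: "G nicely_meromorphic_on eball 0 (mero_radius g)"
    unfolding nicely_meromorphic_on_def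
  proof (intro conjI ballI)
    show "G meromorphic_on eball 0 (mero_radius g)"
    proof (subst meromorphic_on_meromorphic_at, intro ballI)
      fix z :: complex assume "z \<in> eball 0 (mero_radius g)"
      from ex[OF this] obtain F r where F: "ereal (norm z) < r" "P F r" by blast
      have "F meromorphic_on {z}" using F by (auto simp: P_def nicely_meromorphic_on_def intro: meromorphic_on_subset)
      moreover have "eventually (\<lambda>w. G w = F w) (at z)" using evG[OF F(2,1)] by (simp add: eventually_nhds_conv_at)
      ultimately show "G meromorphic_on {z}" by (subst meromorphic_on_cong[of _ G F]) auto
    qed
  next
    fix z :: complex assume "z \<in> eball 0 (mero_radius g)"
    from ex[OF this] obtain F r where F: "ereal (norm z) < r" "P F r" by blast
    have E: "eventually (\<lambda>w. G w = F w) (at z)" and e: "G z = F z"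
      using evG[OF F(2,1)] by (auto simp: eventually_nhds_conv_at)
    have "is_pole G z \<longleftrightarrow> is_pole F z" using E by (intro is_pole_cong) auto
    moreover have "G \<midarrow>z\<rightarrow> G z \<longleftrightarrow> F \<midarrow>z\<rightarrow> F z" unfolding e using E by (intro filterlim_cong) auto
    ultimately show "is_pole G z \<and> G z = 0 \<or> G \<midarrow>z\<rightarrow> G z"
      using F e by (auto simp: P_def nicely_meromorphic_on_def)
  qed
  have "\<exists>F. F has_fps_expansion g \<and> F nicely_meromorphic_on eball 0 (mero_radius g)"
    using Gfps Gn by blast
  from someI_ex[OF this] show "mero_ext g has_fps_expansion g"
    "mero_ext g nicely_meromorphic_on eball 0 (mero_radius g)" unfolding mero_ext_def by auto
qed

definition pole_order :: "(complex \<Rightarrow> complex) \<Rightarrow> complex \<Rightarrow> nat" where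
  "pole_order F z = (if is_pole F z then nat (- zorder F z) else 0)"

text \<open>\<open>R\<^sub>s(g)\<close>\<close>

definition radius_poles :: "nat \<Rightarrow> complex fps \<Rightarrow> ereal" where
  "radius_poles s g = Sup (insert 0 {r. \<exists>F. mero_extends g F r \<and>
     finite {z \<in> eball 0 r. is_pole F z} \<and>
     (\<Sum>z | z \<in> eball 0 r \<and> is_pole F z. pole_order F z) \<le> s})"

text \<open>\<open>R\<^sub>0(f)\<close>, for the whole system\<close>

definition radius_analytic :: "('d::finite \<Rightarrow> complex fps) \<Rightarrow> ereal" where
  "radius_analytic f = Sup (insert 0 {r. \<forall>k. \<exists>F. F has_fps_expansion f k \<and>
                                              F holomorphic_on eball 0 r})"


subsection \<open>Hermite-Pade approximants\<close>

definition hp_solution ::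
  "('d::finite \<Rightarrow> complex fps) \<Rightarrow> ('d \<Rightarrow> nat) \<Rightarrow> nat \<Rightarrow> complex poly \<Rightarrow> ('d \<Rightarrow> complex poly) \<Rightarrow> bool" where
  "hp_solution f m n Q P \<longleftrightarrow>
     Q \<noteq> 0 \<and> degree Q \<le> total_index m \<and>
     (\<forall>k. degree (P k) \<le> n - m k \<and>
          (\<forall>i\<le>n. fps_nth (fps_of_poly Q * f k - fps_of_poly (P k)) i = 0))"

text \<open>
  \<open>(Q, P)\<close> is the reduced, monic representation of the vector of rational functions given by
  some solution \<open>(Q', P')\<close>. Note that \<open>(Q, P)\<close> itself need not be a solution, since a power
  of \<open>z\<close> may have been cancelled.
\<close>

definition hp_approximant ::
  "('d::finite \<Rightarrow> complex fps) \<Rightarrow> ('d \<Rightarrow> nat) \<Rightarrow> nat \<Rightarrow> complex poly \<Rightarrow> ('d \<Rightarrow> complex poly) \<Rightarrow> bool" where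
  "hp_approximant f m n Q P \<longleftrightarrow>
     lead_coeff Q = 1 \<and> \<not> (\<exists>z. poly Q z = 0 \<and> (\<forall>k. poly (P k) z = 0)) \<and>
     (\<exists>Q' P'. hp_solution f m n Q' P' \<and> (\<forall>k. P k * Q' = P' k * Q))"

definition coeff_norm :: "complex poly \<Rightarrow> real" where
  "coeff_norm p = (\<Sum>i\<le>degree p. norm (coeff p i))"


subsection \<open>System poles\<close>

definition poly_combinations ::
  "('d::finite \<Rightarrow> complex fps) \<Rightarrow> ('d \<Rightarrow> nat) \<Rightarrow> complex fps set" where
  "poly_combinations f m =
     {(\<Sum>k\<in>UNIV. fps_of_poly (p k) * f k) | p. \<forall>k. p k = 0 \<or> degree (p k) < m k}"

text \<open>
  \<open>g\<close> is analytic on a neighbourhood of the closed disk of radius \<open>\<bar>\<xi>\<bar>\<close> except for a pole at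
  \<open>\<xi>\<close> of exact order \<open>s\<close>.
\<close>

definition single_pole :: "complex fps \<Rightarrow> complex \<Rightarrow> nat \<Rightarrow> bool" where
  "single_pole g \<xi> s \<longleftrightarrow>
     (\<exists>F U. F has_fps_expansion g \<and> open U \<and> cball 0 (norm \<xi>) \<subseteq> U \<and>
            F holomorphic_on U - {\<xi>} \<and> is_pole F \<xi> \<and> pole_order F \<xi> = s)"

definition system_pole ::
  "('d::finite \<Rightarrow> complex fps) \<Rightarrow> ('d \<Rightarrow> nat) \<Rightarrow> complex \<Rightarrow> nat \<Rightarrow> bool" where
  "system_pole f m \<xi> \<tau> \<longleftrightarrow> \<xi> \<noteq> 0 \<and> \<tau> \<ge> 1 \<and>
     (\<forall>s\<in>{1..\<tau>}. \<exists>g\<in>poly_combinations f m. single_pole g \<xi> s) \<and>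
     (\<forall>s>\<tau>. \<not> (\<exists>g\<in>poly_combinations f m. single_pole g \<xi> s))"

definition system_poles :: "('d::finite \<Rightarrow> complex fps) \<Rightarrow> ('d \<Rightarrow> nat) \<Rightarrow> complex set" where
  "system_poles f m = {\<xi>. \<exists>\<tau>. system_pole f m \<xi> \<tau>}"

definition system_pole_order ::
  "('d::finite \<Rightarrow> complex fps) \<Rightarrow> ('d \<Rightarrow> nat) \<Rightarrow> complex \<Rightarrow> nat" where
  "system_pole_order f m \<xi> = (THE \<tau>. system_pole f m \<xi> \<tau>)"

text \<open>\<open>r\<^bsub>\<xi>,s\<^esub>(f,m)\<close> and \<open>R\<^bsub>\<xi>,s\<^esub>(f,m)\<close>, for \<open>1 \<le> s \<le> \<tau>\<close>\<close>

definition sys_radius1 ::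
  "('d::finite \<Rightarrow> complex fps) \<Rightarrow> ('d \<Rightarrow> nat) \<Rightarrow> complex \<Rightarrow> nat \<Rightarrow> ereal" where
  "sys_radius1 f m \<xi> s = Sup {radius_poles s g | g. g \<in> poly_combinations f m \<and> single_pole g \<xi> s}"

definition sys_radius ::
  "('d::finite \<Rightarrow> complex fps) \<Rightarrow> ('d \<Rightarrow> nat) \<Rightarrow> complex \<Rightarrow> nat \<Rightarrow> ereal" where
  "sys_radius f m \<xi> s = Min (sys_radius1 f m \<xi> ` {1..s})"

text \<open>\<open>R\<^bsub>|m|,k\<^esub>(f,m)\<close> and \<open>R\<^sup>*\<^bsub>|m|,k\<^esub>(f,m)\<close>\<close>

definition radius_sys ::
  "('d::finite \<Rightarrow> complex fps) \<Rightarrow> ('d \<Rightarrow> nat) \<Rightarrow> 'd \<Rightarrow> ereal" where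
  "radius_sys f m k = Sup (insert 0 {r. \<exists>F. mero_extends (f k) F r \<and>
     (\<forall>z\<in>eball 0 r. is_pole F z \<longrightarrow>
        z \<in> system_poles f m \<and> pole_order F z \<le> system_pole_order f m z)})"

text \<open>The infimum over the empty set is \<open>\<infinity>\<close>, so it drops out if there are no poles.\<close>

definition radius_sys_star ::
  "('d::finite \<Rightarrow> complex fps) \<Rightarrow> ('d \<Rightarrow> nat) \<Rightarrow> 'd \<Rightarrow> ereal" where
  "radius_sys_star f m k =
     min (radius_sys f m k)
         (INF \<xi>\<in>{\<xi>\<in>eball 0 (radius_sys f m k). is_pole (mero_ext (f k)) \<xi>}.
            sys_radius f m \<xi> (pole_order (mero_ext (f k)) \<xi>))"


subsection \<open>Sup norm and convergence in content\<close>

text \<open>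
  The modulus of a meromorphic function \<open>h\<close> at \<open>z\<close>: \<open>\<infinity>\<close> at poles, and the continuous
  extension at removable singularities. In particular the HOL convention \<open>x / 0 = 0\<close> plays
  no role for a quotient of polynomials.
\<close>

definition ext_modulus :: "(complex \<Rightarrow> complex) \<Rightarrow> complex \<Rightarrow> ereal" where
  "ext_modulus h z = (if is_pole h z then \<infinity> else ereal (norm (remove_sings h z)))"

definition sup_norm_on :: "complex set \<Rightarrow> (complex \<Rightarrow> complex) \<Rightarrow> ereal" where
  "sup_norm_on K h = Sup (insert 0 (ext_modulus h ` K))"

definition ereal_root :: "nat \<Rightarrow> ereal \<Rightarrow> ereal" where
  "ereal_root n x = (if x = \<infinity> then \<infinity> else ereal (root n (real_of_ereal x)))"

text \<open>
  Since \<^term>\<open>ball c 0\<close> is empty, sequences of disks with nonnegative radii also account for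
  the finite coverings.
\<close>

definition content :: "complex set \<Rightarrow> ennreal" where
  "content B = Inf {(\<Sum>i. ennreal (\<rho> i)) | (c :: nat \<Rightarrow> complex) \<rho>.
                      (\<forall>i. \<rho> i \<ge> 0) \<and> B \<subseteq> (\<Union>i. ball (c i) (\<rho> i))}"

definition content_regular :: "complex set \<Rightarrow> bool" where
  "content_regular K \<longleftrightarrow> compact K \<and>
     (\<forall>z0\<in>K. \<forall>\<delta>>0. content {z\<in>K. norm (z - z0) < \<delta>} > 0)"

definition converges_in_content ::
  "(nat \<Rightarrow> complex \<Rightarrow> complex) \<Rightarrow> (complex \<Rightarrow> complex) \<Rightarrow> complex set \<Rightarrow> bool" where
  "converges_in_content \<phi> \<psi> D \<longleftrightarrow>
     (\<forall>K \<epsilon>. compact K \<and> K \<subseteq> D \<and> \<epsilon> > 0 \<longrightarrow>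
        (\<lambda>n. content {z\<in>K. ext_modulus (\<lambda>w. \<phi> n w - \<psi> w) z > ereal \<epsilon>}) \<longlonglongrightarrow> 0)"

text \<open>
  The radius of the largest disk in which a sequence of functions converges in content to
  (the meromorphic extension of) a power series; \<open>R\<^sup>*\<^bsub>|m|\<^esub>(f\<^sub>k)\<close> if the
  sequence is that of the \<open>R\<^bsub>n,m,k\<^esub>\<close>.
\<close>

definition conv_radius_content :: "(nat \<Rightarrow> complex \<Rightarrow> complex) \<Rightarrow> complex fps \<Rightarrow> ereal" where
  "conv_radius_content \<phi> g = Sup (insert 0 {r. \<exists>F. mero_extends g F r \<and>
                                                 converges_in_content \<phi> F (eball 0 r)})"

end

theory Submission
  imports Defs "HOL-Computational_Algebra.Fundamental_Theorem_Algebra"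
begin

text \<open>
  Let \<open>V\<close> be the space of all combinations \<open>\<Sum>\<^sub>k p\<^sub>k f\<^sub>k\<close> with \<open>deg p\<^sub>k < m\<^sub>k\<close>. A nonzero polynomial
  \<open>Q\<close> of degree at most \<open>|m|\<close> is a denominator of index \<open>n \<ge> max m\<^sub>k\<close> if and only if the coefficient
  \<open>[z\<^sup>n](Q g)\<close> vanishes for all \<open>g \<in> V\<close>. Everything below comes from this reformulation
  together with the correspondence between the decay of coefficients and the radius of convergence;
  meromorphic functions are handled as power series that become analytic in a larger disk after
  multiplication by a polynomial.
  
  Both assumptions of the theorem lead to the situation of the locale \<open>realized_poles\<close>: the denominators
  \<open>Q\<^sub>n\<close> converge at a geometric rate \<open>l\<close> to a polynomial \<open>QM\<close> with \<open>QM(0) \<noteq> 0\<close>, whose zeros are the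
  system poles with their orders, and each of these poles is realized, in every admissible order, by an
  element of \<open>V\<close>.
  
  \<^item> If there are \<open>|m|\<close> system poles, write a denominator in Newton form with the system poles as nodes.
    Annihilating the element of \<open>V\<close> whose pole belongs to the \<open>i\<close>-th node forces the \<open>i\<close>-th Newton
    coefficient to be geometrically small (\<open>newton_coefficient_bound\<close>), so only the leading one
    survives.
  \<^item> If the denominators converge geometrically, then for \<open>g \<in> V\<close> the product \<open>QM g\<close> converges in a
    disk that is larger than that of \<open>g\<close> by the factor \<open>1/l\<close>, because
    \<open>[z\<^sup>n](QM g) = [z\<^sup>n]((QM - Q\<^sub>n) g)\<close>. So the first singularities of \<open>g\<close> are poles at zeros of
    \<open>QM\<close>. If one of the \<open>|m|\<close> principal parts that are possible in this way did not occur, \<open>V\<close> would be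
    spanned by fewer than \<open>|m|\<close> elements and by polynomials, and there would be a denominator
    of degree less than \<open>|m|\<close>, in contradiction to uniqueness (\<open>all_stages_realized\<close>).
  
  The comparison of \<open>Q\<^sub>n h\<close> with \<open>QM h\<close> is also the main tool afterwards: if \<open>[z\<^sup>n\<^sup>+\<^sup>c](Q\<^sub>n h)\<close>
  decays like \<open>\<rho>\<^sup>-\<^sup>n\<close>, then the poles of \<open>h\<close> in the disk of radius \<open>\<rho>\<close> can be removed, one circle at a
  time, by subtracting \<open>z\<^sup>c g\<close> with \<open>g \<in> V\<close> (\<open>subtract_V_from_decaying\<close>). For fixed \<open>k\<close>, let
  \<open>tail_decays k \<rho>\<close> mean that \<open>[z\<^sup>n\<^sup>+\<^sup>c](Q\<^sub>n f\<^sub>k)\<close> decays like \<open>\<rho>\<^sup>-\<^sup>n\<close> for every \<open>c \<ge> 1\<close>. When \<open>f\<^sub>k\<close>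
  has a positive radius of convergence, the largest \<open>\<rho>\<close> with this property is equal to both radii of the theorem.
  
  \<^item> If the tails decay, multiply \<open>f\<^sub>k\<close> by a polynomial that leaves a single pole \<open>\<xi>\<close>, of any prescribed
    order up to that of \<open>f\<^sub>k\<close>, and subtract as above. This produces \<open>g \<in> V\<close> whose only singularity in
    the disk of radius \<open>\<rho>\<close> is this pole. Therefore \<open>\<rho>\<close> is at most the radius defined
    by the system poles. Conversely, functions \<open>g\<close> of this kind allow to write \<open>f\<^sub>k = z\<^sup>c g + h\<close>
    with \<open>h\<close> analytic in the disk of radius \<open>\<rho>\<close>, for every \<open>c\<close>, and \<open>[z\<^sup>n\<^sup>+\<^sup>c](Q\<^sub>n z\<^sup>c g) = 0\<close>.
  \<^item> If the tails decay, all coefficients of \<open>QM (Q\<^sub>n f\<^sub>k - P\<^sub>n\<^sub>k)\<close>, which start in degree \<open>n + 1\<close>, are of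
    size \<open>\<rho>\<^sup>-\<^sup>i\<close> in degree \<open>i\<close>, up to an arbitrarily small loss in \<open>\<rho>\<close>. This yields the rate
    \<open>|z| / \<rho>\<close> and the convergence in content. Conversely, the
    difference of consecutive approximants is \<open>z\<^sup>n\<^sup>+\<^sup>1 B\<^sub>n / (Q\<^sub>n Q\<^sub>n\<^sub>+\<^sub>1)\<close> with polynomials \<open>B\<^sub>n\<close>
    of bounded degree. If it is small on a set whose content is bounded below, that set contains
    enough separated points to control the coefficients of \<open>B\<^sub>n\<close>, and these determine the tails
    recursively (\<open>cross_small_imp_tail_decays\<close>). Applied to the sets where the approximants are
    close to \<open>f\<^sub>k\<close>, this shows that convergence in content forces the tails to decay; applied near a point
    of maximal modulus of a regular compact set, it shows that a rate better than (1) would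
    enlarge the disk of convergence.
\<close>

section \<open>Decay of coefficients and radii of convergence\<close>

text \<open>
  The sequence is bounded by \<open>r'\<^sup>-\<^sup>n\<close> for all \<open>r' < r\<close>. For the coefficients of a power series this
  says that the radius of convergence is at least \<open>r\<close>, but the notion also applies to sequences such as
  \<open>[z\<^sup>n\<^sup>+\<^sup>c](Q\<^sub>n h)\<close>, where the series changes with \<open>n\<close>.
\<close>

definition decays :: "(nat \<Rightarrow> complex) \<Rightarrow> ereal \<Rightarrow> bool" where
  "decays a r \<longleftrightarrow> (\<forall>r'. 0 < r' \<and> ereal r' < r \<longrightarrow> (\<exists>C. \<forall>n. norm (a n) * r' ^ n \<le> C))"

lemma decays_mono: "decays a r \<Longrightarrow> s \<le> r \<Longrightarrow> decays a s"
  unfolding decays_def by (auto dest: order_less_le_trans)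

lemma decays_iff_fps_conv_radius: "decays (fps_nth g) r \<longleftrightarrow> r \<le> fps_conv_radius g"
proof
  assume dec: "decays (fps_nth g) r"
  show "r \<le> fps_conv_radius g" unfolding fps_conv_radius_def
  proof (rule conv_radius_geI_ex)
    fix s :: real assume s: "0 < s" "ereal s < r"
    then obtain t where t: "s < t" "ereal t < r" using ereal_dense2 by force
    then obtain C where C: "norm (fps_nth g n) * t ^ n \<le> C" for n
      using dec s unfolding decays_def by (meson order_less_trans)
    have "summable (\<lambda>n. fps_nth g n * of_real s ^ n)"
    proof (rule summable_comparison_test')
      show "summable (\<lambda>n. C * (s / t) ^ n)"
        using s t by (intro summable_mult summable_geometric) auto
      fix n :: nat
      have "norm (fps_nth g n * of_real s ^ n) = norm (fps_nth g n) * t ^ n * (s / t) ^ n"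
        using s t by (simp add: norm_mult norm_power power_divide)
      also have "\<dots> \<le> C * (s / t) ^ n" using C s t by (intro mult_right_mono) auto
      finally show "norm (fps_nth g n * of_real s ^ n) \<le> C * (s / t) ^ n" .
    qed
    thus "\<exists>z. norm z = s \<and> summable (\<lambda>n. fps_nth g n * z ^ n)"
      using s by (intro exI[of _ "of_real s"]) auto
  qed
next
  assume le: "r \<le> fps_conv_radius g"
  show "decays (fps_nth g) r" unfolding decays_def
  proof (intro allI impI)
    fix s :: real assume s: "0 < s \<and> ereal s < r"
    hence "ereal (norm (complex_of_real s)) < fps_conv_radius g" using le by (auto intro: order_less_le_trans)
    hence "summable (\<lambda>n. fps_nth g n * of_real s ^ n)" by (rule summable_fps)
    hence "Bseq (\<lambda>n. fps_nth g n * of_real s ^ n)"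
      by (intro convergent_imp_Bseq) (auto simp: convergent_def dest: summable_LIMSEQ_zero)
    then obtain C where "norm (fps_nth g n * of_real s ^ n) \<le> C" for n by (auto simp: Bseq_def)
    thus "\<exists>C. \<forall>n. norm (fps_nth g n) * s ^ n \<le> C" using s by (auto simp: norm_mult norm_power)
  qed
qed

lemma decays_eventually_le:
  assumes "decays b r" "\<forall>\<^sub>F n in sequentially. norm (a n) \<le> norm (b n)"
  shows "decays a r"
  unfolding decays_def
proof (intro allI impI)
  fix s :: real assume s: "0 < s \<and> ereal s < r"
  obtain C where C: "norm (b n) * s ^ n \<le> C" for n using assms(1) s unfolding decays_def by blast
  obtain N where N: "norm (a n) \<le> norm (b n)" if "n \<ge> N" for n
    using assms(2) unfolding eventually_sequentially by blast
  define C' where "C' = max C (\<Sum>k<N. norm (a k) * s ^ k)"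
  have "norm (a n) * s ^ n \<le> C'" for n
  proof (cases "n \<ge> N")
    case True
    hence "norm (a n) * s ^ n \<le> norm (b n) * s ^ n" using N s by (intro mult_right_mono) auto
    thus ?thesis using C[of n] by (auto simp: C'_def)
  next
    case False
    have "norm (a n) * s ^ n \<le> (\<Sum>k<N. norm (a k) * s ^ k)"
      using s False by (intro member_le_sum) auto
    thus ?thesis by (auto simp: C'_def)
  qed
  thus "\<exists>C. \<forall>n. norm (a n) * s ^ n \<le> C" by blast
qed

lemma decays_cong:
  assumes "\<forall>\<^sub>F n in sequentially. a n = b n"
  shows "decays a r \<longleftrightarrow> decays b r"
proof -
  have "\<forall>\<^sub>F n in sequentially. norm (a n) \<le> norm (b n)" "\<forall>\<^sub>F n in sequentially. norm (b n) \<le> norm (a n)"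
    using assms by (auto elim: eventually_mono)
  thus ?thesis using decays_eventually_le by blast
qed

lemma decays_zero [simp]: "decays (\<lambda>_. 0) r"
  by (auto simp: decays_def)

lemma decays_bound:
  assumes "0 < s" "\<forall>\<^sub>F n in sequentially. norm (a n) * s ^ n \<le> C"
  shows "decays a (ereal s)"
proof (rule decays_eventually_le)
  show "\<forall>\<^sub>F n in sequentially. norm (a n) \<le> norm (of_real (C / s ^ n) :: complex)"
    using assms(2)
  proof eventually_elim
    case (elim n)
    have "0 \<le> norm (a n) * s ^ n" using assms by simp
    hence "0 \<le> C" using elim by linarith
    thus ?case using elim assms by (simp add: field_simps norm_divide norm_power)
  qed
  show "decays (\<lambda>n. of_real (C / s ^ n)) (ereal s)" unfolding decays_def
  proof (intro allI impI)
    fix t assume t: "0 < t \<and> ereal t < ereal s"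
    have "norm (of_real (C / s ^ n) :: complex) * t ^ n \<le> \<bar>C\<bar>" for n
    proof -
      have "(t / s) ^ n \<le> 1" using t assms by (intro power_le_one) auto
      hence "\<bar>C\<bar> * (t / s) ^ n \<le> \<bar>C\<bar> * 1" by (intro mult_left_mono) auto
      thus ?thesis using t assms by (simp add: norm_divide norm_power power_divide)
    qed
    thus "\<exists>C'. \<forall>n. norm (of_real (C / s ^ n) :: complex) * t ^ n \<le> C'" by blast
  qed
qed

lemma decays_add:
  assumes "decays a r" "decays b r"
  shows "decays (\<lambda>n. a n + b n) r"
  unfolding decays_def
proof (intro allI impI)
  fix s assume s: "0 < s \<and> ereal s < r"
  obtain C D where "norm (a n) * s ^ n \<le> C" "norm (b n) * s ^ n \<le> D" for n
    using assms s unfolding decays_def by meson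
  moreover have "norm (a n + b n) * s ^ n \<le> norm (a n) * s ^ n + norm (b n) * s ^ n" for n
    using s norm_triangle_ineq[of "a n" "b n"] by (simp flip: distrib_right add: mult_right_mono)
  ultimately have "norm (a n + b n) * s ^ n \<le> C + D" for n by (smt (verit))
  thus "\<exists>C. \<forall>n. norm (a n + b n) * s ^ n \<le> C" by blast
qed

lemma decays_uminus: "decays a r \<Longrightarrow> decays (\<lambda>n. - a n) r"
  by (simp add: decays_def)

lemma decays_diff: "decays a r \<Longrightarrow> decays b r \<Longrightarrow> decays (\<lambda>n. a n - b n) r"
  using decays_add[OF _ decays_uminus, of a r b] by simp

lemma decays_sum: "(\<And>i. i \<in> I \<Longrightarrow> decays (a i) r) \<Longrightarrow> decays (\<lambda>n. \<Sum>i\<in>I. a i n) r"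
  by (induction I rule: infinite_finite_induct) (auto intro: decays_add)

lemma decays_shift: "decays (\<lambda>n. a (n + c)) r \<longleftrightarrow> decays a r"
proof
  assume dec: "decays (\<lambda>n. a (n + c)) r"
  show "decays a r" unfolding decays_def
  proof (intro allI impI)
    fix s assume s: "0 < s \<and> ereal s < r"
    obtain C where C: "norm (a (n + c)) * s ^ n \<le> C" for n using dec s unfolding decays_def by blast
    have "norm (a n) * s ^ n \<le> max (C * s ^ c) (\<Sum>k<c. norm (a k) * s ^ k)" for n
    proof (cases "n \<ge> c")
      case True
      hence "norm (a n) * s ^ n = norm (a (n - c + c)) * s ^ (n - c) * s ^ c"
        by (simp flip: power_add)
      also have "\<dots> \<le> C * s ^ c" using C s by (intro mult_right_mono) auto
      finally show ?thesis by simp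
    next
      case False
      have "norm (a n) * s ^ n \<le> (\<Sum>k<c. norm (a k) * s ^ k)"
        using s False by (intro member_le_sum) auto
      thus ?thesis by auto
    qed
    thus "\<exists>C. \<forall>n. norm (a n) * s ^ n \<le> C" by blast
  qed
next
  assume dec: "decays a r"
  show "decays (\<lambda>n. a (n + c)) r" unfolding decays_def
  proof (intro allI impI)
    fix s assume s: "0 < s \<and> ereal s < r"
    obtain C where C: "norm (a n) * s ^ n \<le> C" for n using dec s unfolding decays_def by blast
    have "norm (a (n + c)) * s ^ n \<le> C / s ^ c" for n
      using C[of "n + c"] s by (simp add: field_simps power_add)
    thus "\<exists>C. \<forall>n. norm (a (n + c)) * s ^ n \<le> C" by blast
  qed
qed

lemma decays_mult_geometric:
  assumes "decays a r" "0 < l" "\<forall>\<^sub>F n in sequentially. norm (b n) \<le> C * l ^ n"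
  shows "decays (\<lambda>n. b n * a n) (r / ereal l)"
proof (rule decays_eventually_le)
  show "\<forall>\<^sub>F n in sequentially. norm (b n * a n) \<le> norm (of_real (C * l ^ n) * a n)"
    using assms(3) 
  proof eventually_elim
    case (elim n)
    also have "C * l ^ n \<le> norm (of_real (C * l ^ n) :: complex)" by (simp only: norm_of_real)
    finally show ?case unfolding norm_mult by (intro mult_right_mono) auto
  qed
  show "decays (\<lambda>n. of_real (C * l ^ n) * a n) (r / ereal l)" unfolding decays_def
  proof (intro allI impI)
    fix s assume s: "0 < s \<and> ereal s < r / ereal l"
    hence "ereal (s * l) < r" using assms(2) by (cases r) (auto simp: field_simps)
    then obtain D where D: "norm (a n) * (s * l) ^ n \<le> D" for n
      using assms s unfolding decays_def by (metis mult_pos_pos)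
    have "norm (of_real (C * l ^ n) * a n) * s ^ n \<le> \<bar>C\<bar> * D" for n
      using mult_left_mono[OF D[of n], of "\<bar>C\<bar>"] assms(2)
      by (simp add: norm_mult norm_power abs_mult power_mult_distrib mult_ac)
    thus "\<exists>D. \<forall>n. norm (of_real (C * l ^ n) * a n) * s ^ n \<le> D" by blast
  qed
qed

lemma decays_mult_bounded:
  assumes "decays a r" "\<forall>\<^sub>F n in sequentially. norm (b n) \<le> C"
  shows "decays (\<lambda>n. b n * a n) r"
  using decays_mult_geometric[OF assms(1), of 1 b C] assms(2) by (simp flip: one_ereal_def)

text \<open>
  The shifts of \<open>g\<close> are written as products with powers of \<open>X\<close>, so that the number of summands does not
  depend on \<open>n\<close> and no case distinction is needed for \<open>n < M\<close>.
\<close>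

lemma fps_nth_poly_mult:
  fixes p :: "complex poly"
  assumes "degree p \<le> M"
  shows "fps_nth (fps_of_poly p * g) n = (\<Sum>i\<le>M. coeff p i * fps_nth (fps_X ^ i * g) n)"
proof -
  have "fps_nth (fps_of_poly p * g) n = (\<Sum>i\<in>{..n}. coeff p i * fps_nth g (n - i))"
    by (simp add: fps_mult_nth atLeast0AtMost)
  also have "\<dots> = (\<Sum>i\<in>{..max n M}. coeff p i * fps_nth (fps_X ^ i * g) n)"
    by (rule sum.mono_neutral_cong_left) (auto simp: fps_X_power_mult_nth)
  also have "\<dots> = (\<Sum>i\<le>M. coeff p i * fps_nth (fps_X ^ i * g) n)"
  proof (intro sum.mono_neutral_right ballI)
    fix i assume "i \<in> {..max n M} - {..M}"
    hence "degree p < i" using assms by auto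
    thus "coeff p i * fps_nth (fps_X ^ i * g) n = 0" by (simp add: coeff_eq_0)
  qed auto
  finally show ?thesis .
qed

lemma fps_conv_radius_poly_mult:
  fixes g :: "complex fps"
  shows "fps_conv_radius (fps_of_poly p * g) \<ge> fps_conv_radius g"
  using fps_conv_radius_mult[of "fps_of_poly p" g] by simp

lemma fps_conv_radius_X_power_mult:
  fixes g :: "complex fps"
  shows "fps_conv_radius (fps_X ^ c * g) = fps_conv_radius g"
proof (rule antisym)
  show "fps_conv_radius (fps_X ^ c * g) \<le> fps_conv_radius g"
    using fps_conv_radius_shift[of c "fps_X ^ c * g"] by (simp add: fps_shift_times_fps_X_power mult.commute[of "fps_X ^ c"])
qed (use fps_conv_radius_mult[of "fps_X ^ c" g] in simp)

lemma decays_poly_mult: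
  assumes "\<And>i. \<forall>\<^sub>F n in sequentially. norm (coeff (p n) i) \<le> C * l ^ n" "0 < l"
    and "\<forall>\<^sub>F n in sequentially. degree (p n) \<le> M" and "r \<le> fps_conv_radius h"
  shows "decays (\<lambda>n. fps_nth (fps_of_poly (p n) * h) (n + c)) (r / ereal l)"
proof (subst decays_cong)
  show "\<forall>\<^sub>F n in sequentially. fps_nth (fps_of_poly (p n) * h) (n + c) =
          (\<Sum>i\<le>M. coeff (p n) i * fps_nth (fps_X ^ i * h) (n + c))"
    using assms(3) by eventually_elim (rule fps_nth_poly_mult)
  show "decays (\<lambda>n. \<Sum>i\<le>M. coeff (p n) i * fps_nth (fps_X ^ i * h) (n + c)) (r / ereal l)"
    by (intro decays_sum decays_mult_geometric[of _ _ _ _ C] assms)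
       (simp_all add: decays_shift[of "fps_nth _"] decays_iff_fps_conv_radius fps_conv_radius_X_power_mult assms)
qed

lemma decays_bounded_poly_mult:
  assumes "\<And>i. \<forall>\<^sub>F n in sequentially. norm (coeff (p n) i) \<le> C"
    and "\<forall>\<^sub>F n in sequentially. degree (p n) \<le> M" and "r \<le> fps_conv_radius h"
  shows "decays (\<lambda>n. fps_nth (fps_of_poly (p n) * h) (n + c)) r"
  using decays_poly_mult[of p C 1 M r h c] assms by (simp flip: one_ereal_def)

lemma eval_fps_poly_mult:
  fixes g :: "complex fps"
  shows
  "ereal (norm z) < fps_conv_radius g \<Longrightarrow> eval_fps (fps_of_poly p * g) z = poly p z * eval_fps g z"
  by (simp add: eval_fps_mult)

section \<open>Removing zeros of polynomial factors\<close>

text \<open>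
  Dividing by a polynomial without zeros in a disk does not create singularities there.
\<close>

lemma fps_conv_radius_poly_factor_cancel:
  fixes g :: "complex fps"
  assumes "\<And>z. poly D z = 0 \<Longrightarrow> r \<le> norm z" "0 < r"
  shows "fps_conv_radius g \<ge> min (ereal r) (fps_conv_radius (fps_of_poly D * g))"
proof -
  have nz: "eval_fps (fps_of_poly D) z \<noteq> 0" if "ereal (norm z) < ereal r" for z
    using assms(1)[of z] that by auto
  have "poly D 0 \<noteq> 0" using nz[of 0] assms(2) by simp
  hence "inverse (fps_of_poly D) * fps_of_poly D = 1"
    by (intro inverse_mult_eq_1) (simp add: poly_0_coeff_0)
  hence "g = inverse (fps_of_poly D) * (fps_of_poly D * g)"
    by (simp flip: mult.assoc)
  hence "fps_conv_radius g \<ge> min (fps_conv_radius (inverse (fps_of_poly D))) (fps_conv_radius (fps_of_poly D * g))"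
    using fps_conv_radius_mult by metis
  moreover have "fps_conv_radius (inverse (fps_of_poly D)) \<ge> min (ereal r) (fps_conv_radius (fps_of_poly D))"
    by (rule fps_conv_radius_inverse) (use nz in auto)
  ultimately show ?thesis by (auto simp: min_def split: if_splits intro: order_trans)
qed

lemma fps_conv_radius_linear_factor_cancel:
  fixes g :: "complex fps"
  assumes "\<xi> \<noteq> 0"
  shows "fps_conv_radius g \<ge> min (ereal (norm \<xi>)) (fps_conv_radius (fps_of_poly [:-\<xi>, 1:] * g))"
  using assms by (intro fps_conv_radius_poly_factor_cancel) auto

text \<open>
  A zero of \<open>h\<close> inside its disk of convergence makes the singularity of \<open>h(z)/(z - \<xi>)\<close> removable.
\<close>

lemma fps_conv_radius_zero_cancel:
  fixes g :: "complex fps"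
  assumes R: "ereal (norm \<xi>) < fps_conv_radius h" and 0: "eval_fps h \<xi> = 0"
    and h: "h = fps_of_poly [:-\<xi>, 1:] * g"
  shows "fps_conv_radius g \<ge> fps_conv_radius h"
proof (cases "\<xi> = 0")
  case True
  thus ?thesis using h fps_conv_radius_X_power_mult[of 1 g] by simp
next
  case False
  define r where "r = fps_conv_radius h"
  define G where "G = (\<lambda>z. if z = \<xi> then deriv (eval_fps h) \<xi> else (eval_fps h z - eval_fps h \<xi>) / (z - \<xi>))"
  have hol: "G holomorphic_on eball 0 r"
    unfolding G_def
  proof (rule pole_theorem_open_0[where g = "eval_fps h"])
    show "eval_fps h holomorphic_on eball 0 r" by (intro holomorphic_on_eval_fps) (simp add: r_def)
  qed (use R 0 in \<open>auto simp: r_def\<close>)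
  have "fps_conv_radius g > 0"
  proof -
    have "0 < min (ereal (norm \<xi>)) (fps_conv_radius h)"
      using False R by (auto simp: min_def intro: le_less_trans[of _ "ereal (norm \<xi>)"])
    also have "\<dots> \<le> fps_conv_radius g" using fps_conv_radius_linear_factor_cancel[OF False, of g] h by simp
    finally show ?thesis .
  qed
  hence ev: "\<forall>\<^sub>F z in nhds 0. z \<in> eball 0 (fps_conv_radius g) - {\<xi>}"
    using False by (intro eventually_nhds_in_open) (auto simp: zero_ereal_def)
  have "\<forall>\<^sub>F z in nhds 0. eval_fps g z = G z" using ev
  proof eventually_elim
    case (elim z)
    hence "eval_fps h z = (z - \<xi>) * eval_fps g z" by (simp add: h eval_fps_poly_mult)
    thus ?case using elim 0 by (simp add: G_def)
  qed
  moreover have "eval_fps g has_fps_expansion g" using \<open>fps_conv_radius g > 0\<close> by (simp add: has_fps_expansion_def)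
  ultimately have "G has_fps_expansion g" using has_fps_expansion_cong by blast
  thus ?thesis using hol holomorphic_on_imp_fps_conv_radius_ge unfolding r_def by blast
qed

lemma poly_split_root:
  fixes D :: "complex poly"
  assumes "degree D > 0"
  obtains \<xi> E where "D = [:-\<xi>, 1:] * E" "E \<noteq> 0" "degree D = Suc (degree E)"
proof -
  have "\<exists>z. poly D z = 0" by (rule alg_closed_imp_poly_has_root) (use assms in auto)
  then obtain \<xi> E where D: "D = [:-\<xi>, 1:] * E" unfolding poly_eq_0_iff_dvd dvd_def by blast
  moreover from this assms have "E \<noteq> 0" by auto
  moreover from this have "degree ([:-\<xi>, 1:] * E) = Suc (degree E)" by (subst degree_mult_eq) auto
  ultimately show ?thesis using that by blast
qed

text \<open>
  Multiplying by factors \<open>z - \<xi>\<close> with \<open>\<xi>\<close> inside the disk of convergence cannot remove the singularities on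
  its boundary.
\<close>

lemma fps_conv_radius_inner_factor_cancel:
  fixes g :: "complex fps"
  assumes "D \<noteq> 0" "\<And>z. poly D z = 0 \<Longrightarrow> ereal (norm z) < fps_conv_radius g"
  shows "fps_conv_radius (fps_of_poly D * g) = fps_conv_radius g"
  using assms
proof (induction "degree D" arbitrary: D)
  case 0
  then obtain c where "D = [:c:]" "c \<noteq> 0" by (metis degree_0_id pCons_eq_0_iff degree_eq_zeroE)
  thus ?case by (simp add: fps_of_poly_const fps_conv_radius_cmult_left)
next
  case (Suc n)
  then obtain \<xi> E where D: "D = [:-\<xi>, 1:] * E" and E: "E \<noteq> 0" "n = degree E"
    using poly_split_root[of D] by (metis nat.inject zero_less_Suc)
  have IH: "fps_conv_radius (fps_of_poly E * g) = fps_conv_radius g"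
    by (rule Suc.hyps(1)) (use E Suc.prems D in auto)
  have xi: "ereal (norm \<xi>) < fps_conv_radius g" using Suc.prems D by auto
  have eq: "fps_of_poly D * g = fps_of_poly [:-\<xi>,1:] * (fps_of_poly E * g)"
    by (simp add: D fps_of_poly_mult mult.assoc del: mult_pCons_left)
  have ge: "fps_conv_radius (fps_of_poly D * g) \<ge> fps_conv_radius g" by (rule fps_conv_radius_poly_mult)
  have "eval_fps (fps_of_poly D * g) \<xi> = 0" using xi by (simp add: eval_fps_poly_mult D)
  hence "fps_conv_radius (fps_of_poly E * g) \<ge> fps_conv_radius (fps_of_poly D * g)"
    using ge xi by (intro fps_conv_radius_zero_cancel[OF _ _ eq]) auto
  with IH ge show ?case by simp
qed

section \<open>Poles of meromorphic extensions\<close>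

text \<open>
  The power series counterpart of a function that is analytic in the disk of radius \<open>\<rho>\<close> except for a pole of
  exact order \<open>s\<close> at \<open>\<xi>\<close>.
\<close>

definition polar :: "complex fps \<Rightarrow> complex \<Rightarrow> nat \<Rightarrow> ereal \<Rightarrow> bool" where
  "polar g \<xi> s \<rho> \<longleftrightarrow> ereal (norm \<xi>) < \<rho> \<and>
     \<rho> \<le> fps_conv_radius (fps_of_poly ([:-\<xi>, 1:] ^ s) * g) \<and>
     eval_fps (fps_of_poly ([:-\<xi>, 1:] ^ s) * g) \<xi> \<noteq> 0"

lemma zorder_poly_eq_order:
  assumes "A \<noteq> 0"
  shows "zorder (poly A) z = int (Polynomial.order z A)"
proof -
  obtain q where q: "A = [:-z, 1:] ^ Polynomial.order z A * q" "\<not> [:-z, 1:] dvd q"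
    using order_decomp[OF assms] by blast
  show ?thesis
  proof (rule zorder_eqI[where S = UNIV and g = "poly q"])
    show "poly q z \<noteq> 0" using q(2) by (simp add: poly_eq_0_iff_dvd)
    show "poly A w = poly q w * (w - z) powi int (Polynomial.order z A)" for w
      by (subst q(1)) (simp add: poly_power)
  qed (auto intro!: holomorphic_intros)
qed

lemma eventually_poly_nonzero: "A \<noteq> 0 \<Longrightarrow> \<forall>\<^sub>F w in at z. poly A w \<noteq> (0::complex)"
  using islimpt_finite[OF poly_roots_finite[of A], of z] by (simp add: islimpt_iff_eventually)

lemma poly_meromorphic [meromorphic_intros]: "poly A meromorphic_on S"
proof (rule analytic_on_imp_meromorphic_on)
  have "poly A analytic_on UNIV" by (subst analytic_on_open) (auto intro!: holomorphic_intros)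
  thus "poly A analytic_on S" by (rule analytic_on_subset) auto
qed

lemma poly_has_fps_expansion: "poly A has_fps_expansion fps_of_poly (A :: complex poly)"
proof -
  have "eval_fps (fps_of_poly A) = poly A" by (rule ext) simp
  thus ?thesis using eval_fps_has_fps_expansion[of "fps_of_poly A"] by simp
qed

text \<open>
  The identity theorem makes any two descriptions of a meromorphic extension agree. It is stated with the
  denominator on the left because the values at the poles are irrelevant.
\<close>

lemma meromorphic_expansion_times_poly:
  assumes F: "F has_fps_expansion g" "F meromorphic_on eball 0 r"
    and r: "r \<le> fps_conv_radius (fps_of_poly A * g)" and z: "z \<in> eball 0 r"
  shows "\<forall>\<^sub>F w in at z. poly A w * F w = eval_fps (fps_of_poly A * g) w"
proof -
  define h where "h = (\<lambda>w. poly A w * F w - eval_fps (fps_of_poly A * g) w)"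
  have r0: "0 < r" using z by (auto intro: le_less_trans[of _ "ereal (norm z)"])
  have mero: "h meromorphic_on eball 0 r"
    unfolding h_def by (intro meromorphic_intros F order.trans[OF _ eball_mono]) (use r in \<open>auto intro: less_le_trans\<close>)
  have "(\<lambda>w. poly A w * F w) has_fps_expansion (fps_of_poly A * g)"
    using F(1) poly_has_fps_expansion by (intro has_fps_expansion_mult)
  moreover have "0 < fps_conv_radius (fps_of_poly A * g)" using r r0 by (rule less_le_trans[rotated])
  ultimately have "\<forall>\<^sub>F w in nhds 0. h w = 0"
    unfolding h_def has_fps_expansion_def by (auto elim: eventually_mono)
  hence "\<forall>\<^sub>F w in at 0. h w = 0" by (simp add: eventually_nhds_conv_at)
  hence "\<not> (\<forall>\<^sub>F w in at 0. h w \<noteq> 0)"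
    using eventually_frequently[of "at (0::complex)"] by (auto simp: frequently_def)
  moreover have "(0::complex) \<in> eball 0 r" using r0 by (simp add: zero_ereal_def)
  ultimately have "\<not> (\<forall>\<^sub>F w in cosparse (eball 0 r). h w \<noteq> 0)"
    by (subst eventually_cosparse_open_eq) auto
  hence "\<forall>\<^sub>F w in cosparse (eball 0 r). h w = 0"
    using meromorphic_imp_constant_or_avoid[OF mero _ connected_eball, of 0] by auto
  hence "\<forall>\<^sub>F w in at z. h w = 0" using z by (subst (asm) eventually_cosparse_open_eq) auto
  thus ?thesis by (simp add: h_def)
qed

lemma pole_order_pos: "isolated_singularity_at F z \<Longrightarrow> is_pole F z \<Longrightarrow> pole_order F z \<ge> 1"
  using isolated_pole_imp_neg_zorder[of F z] by (auto simp: pole_order_def)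

lemma pole_order_cong:
  assumes "\<forall>\<^sub>F w in at z. F w = G w"
  shows "is_pole F z \<longleftrightarrow> is_pole G z" "pole_order F z = pole_order G z"
proof -
  show "is_pole F z \<longleftrightarrow> is_pole G z" using assms by (intro is_pole_cong) auto
  moreover have "zorder F z = zorder G z" using assms by (intro zorder_cong) auto
  ultimately show "pole_order F z = pole_order G z" by (simp add: pole_order_def)
qed

lemma zorder_quotient_by_poly:
  assumes A: "A \<noteq> 0" and \<phi>: "\<phi> analytic_on {z}" "\<exists>\<^sub>F w in at z. \<phi> w \<noteq> 0"
    and eq: "\<forall>\<^sub>F w in at z. poly A w * F w = \<phi> w"
  shows "zorder F z = zorder \<phi> z - int (Polynomial.order z A)"
proof -
  have "\<forall>\<^sub>F w in at z. F w = \<phi> w / poly A w"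
    using eq eventually_poly_nonzero[OF A] by eventually_elim (auto simp: field_simps)
  hence "zorder F z = zorder (\<lambda>w. \<phi> w / poly A w) z" by (intro zorder_cong) auto
  also have "\<dots> = zorder \<phi> z - zorder (poly A) z"
    using \<phi> eventually_poly_nonzero[OF A]
    by (intro zorder_divide) (auto intro: analytic_on_imp_meromorphic_on poly_meromorphic eventually_frequently)
  finally show ?thesis by (simp add: zorder_poly_eq_order[OF A])
qed

text \<open>
  A quotient with an analytic numerator can only have poles at zeros of the denominator, and of at most the
  same order; the order is attained where the numerator does not vanish.
\<close>

lemma pole_order_quotient_le:
  assumes A: "A \<noteq> 0" and \<phi>: "\<phi> analytic_on {z}"
    and eq: "\<forall>\<^sub>F w in at z. poly A w * F w = \<phi> w" and pole: "is_pole F z"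
  shows "poly A z = 0" "pole_order F z \<le> Polynomial.order z A"
proof -
  have nz: "\<exists>\<^sub>F w in at z. \<phi> w \<noteq> 0"
  proof -
    have "\<forall>\<^sub>F w in at z. F w \<noteq> 0" using pole by (rule non_zero_neighbour_pole)
    hence "\<forall>\<^sub>F w in at z. \<phi> w \<noteq> 0" using eq eventually_poly_nonzero[OF A, of z] by eventually_elim auto
    thus ?thesis by (simp add: eventually_frequently)
  qed
  have "zorder \<phi> z \<ge> 0" using nz \<phi> zorder_ge_0 by blast
  hence le: "- zorder F z \<le> int (Polynomial.order z A)"
    using zorder_quotient_by_poly[OF A \<phi> nz eq] by linarith
  thus "pole_order F z \<le> Polynomial.order z A" by (auto simp: pole_order_def)
  have iso: "isolated_singularity_at F z"
  proof -
    have "\<forall>\<^sub>F w in at z. F w = \<phi> w / poly A w"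
      using eq eventually_poly_nonzero[OF A] by eventually_elim (auto simp: field_simps)
    moreover have "(\<lambda>w. \<phi> w / poly A w) meromorphic_on {z}"
      by (intro meromorphic_intros analytic_on_imp_meromorphic_on \<phi>)
    ultimately have "F meromorphic_on {z}" by (subst meromorphic_on_cong[of _ F "\<lambda>w. \<phi> w / poly A w" "{z}"]) auto
    thus ?thesis by (simp add: meromorphic_at_iff)
  qed
  have "zorder F z < 0" using isolated_pole_imp_neg_zorder[OF iso pole] .
  thus "poly A z = 0" using le order_root[of A z] by (cases "Polynomial.order z A") auto
qed

lemma pole_order_quotient_eq:
  assumes A: "A \<noteq> 0" "poly A z = 0" and \<phi>: "\<phi> analytic_on {z}" "\<phi> z \<noteq> 0"
    and eq: "\<forall>\<^sub>F w in at z. poly A w * F w = \<phi> w"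
  shows "is_pole F z" "pole_order F z = Polynomial.order z A"
proof -
  have F: "\<forall>\<^sub>F w in at z. F w = \<phi> w / poly A w"
    using eq eventually_poly_nonzero[OF A(1)] by eventually_elim (auto simp: field_simps)
  have lim: "\<phi> \<midarrow>z\<rightarrow> \<phi> z" using \<phi>(1) by (simp add: analytic_at_imp_isCont isContD)
  have "is_pole (\<lambda>w. \<phi> w / poly A w) z"
    unfolding is_pole_def
  proof (rule filterlim_divide_at_infinity[OF lim _ \<phi>(2)])
    show "filterlim (poly A) (at 0) (at z)"
      using A eventually_poly_nonzero[OF A(1), of z] isContD[OF poly_isCont, of A z]
      by (auto simp: filterlim_at)
  qed
  thus P: "is_pole F z" using pole_order_cong(1)[OF F] by simp
  have "\<exists>\<^sub>F w in at z. \<phi> w \<noteq> 0"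
    using tendsto_imp_eventually_ne[OF lim \<phi>(2)] by (simp add: eventually_frequently)
  from zorder_quotient_by_poly[OF A(1) \<phi>(1) this eq] have "zorder F z = zorder \<phi> z - int (Polynomial.order z A)" .
  moreover have "zorder \<phi> z = 0" using \<phi> zorder_eq_0I by blast
  ultimately show "pole_order F z = Polynomial.order z A" using P by (simp add: pole_order_def)
qed

text \<open>
  If the zeros of \<open>A\<close> compensate all poles, the product has only removable singularities in the disk.
\<close>

lemma fps_conv_radius_of_bounded_poles:
  assumes F: "F has_fps_expansion g" "F meromorphic_on eball 0 r" and A: "A \<noteq> 0"
    and poles: "\<And>z. z \<in> eball 0 r \<Longrightarrow> is_pole F z \<Longrightarrow> pole_order F z \<le> Polynomial.order z A"
  shows "r \<le> fps_conv_radius (fps_of_poly A * g)"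
proof -
  define h where "h = (\<lambda>w. poly A w * F w)"
  have mero: "h meromorphic_on eball 0 r" unfolding h_def by (intro meromorphic_intros F)
  have np: "\<not> is_pole h z" if z: "z \<in> eball 0 r" for z
  proof
    assume pole: "is_pole h z"
    have Fz: "F meromorphic_on {z}" and hz: "h meromorphic_on {z}"
      using F(2) mero z by (auto intro: meromorphic_on_subset)
    have nz: "\<forall>\<^sub>F w in at z. h w \<noteq> 0" using pole by (rule non_zero_neighbour_pole)
    hence nzF: "\<forall>\<^sub>F w in at z. F w \<noteq> 0" by eventually_elim (auto simp: h_def)
    have "zorder h z = zorder (poly A) z + zorder F z"
      unfolding h_def using Fz nzF eventually_poly_nonzero[OF A]
      by (intro zorder_mult) (auto intro: poly_meromorphic eventually_frequently)
    moreover have "zorder h z < 0"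
      using hz pole isolated_pole_imp_neg_zorder by (auto simp: meromorphic_at_iff)
    moreover have "zorder (poly A) z = int (Polynomial.order z A)" by (rule zorder_poly_eq_order[OF A])
    ultimately have lt: "zorder F z < - int (Polynomial.order z A)" by linarith
    hence "is_pole F z" using zorder_neg_imp_is_pole[OF Fz nzF] by linarith
    with poles[OF z this] lt show False by (simp add: pole_order_def)
  qed
  define H where "H = remove_sings h"
  have "H nicely_meromorphic_on eball 0 r" unfolding H_def by (rule remove_sings_nicely_meromorphic[OF mero])
  moreover have "\<not> is_pole H z" if "z \<in> eball 0 r" for z
    using np[OF that] mero that unfolding H_def
    by (metis is_pole_remove_sings_iff meromorphic_at_iff meromorphic_on_meromorphic_at)
  ultimately have an: "H analytic_on eball 0 r" by (intro nicely_meromorphic_without_singularities) auto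
  have hexp: "h has_fps_expansion fps_of_poly A * g" unfolding h_def
    using F(1) poly_has_fps_expansion by (intro has_fps_expansion_mult)
  have "\<forall>\<^sub>F w in nhds 0. H w = h w"
    unfolding H_def by (intro eventually_remove_sings_eq_nhds has_fps_expansion_imp_analytic_0[OF hexp])
  hence "H has_fps_expansion fps_of_poly A * g" using hexp by (subst has_fps_expansion_cong) auto
  thus ?thesis using an analytic_imp_holomorphic holomorphic_on_imp_fps_conv_radius_ge by blast
qed

lemma quotient_has_fps_expansion:
  fixes A :: "complex poly"
  assumes "poly A 0 \<noteq> 0" "fps_conv_radius g > 0"
  shows "(\<lambda>z. eval_fps (fps_of_poly A * g) z / poly A z) has_fps_expansion g"
proof -
  have "\<forall>\<^sub>F z in nhds 0. z \<in> eball 0 (fps_conv_radius g)"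
    using assms(2) by (intro eventually_nhds_in_open) (auto simp: zero_ereal_def)
  moreover have "\<forall>\<^sub>F z in nhds 0. z \<in> - {z. poly A z = 0}"
  proof (intro eventually_nhds_in_open)
    have "A \<noteq> 0" using assms(1) by auto
    thus "open (- {z. poly A z = 0})" using poly_roots_finite by (intro open_Compl finite_imp_closed) auto
  qed (use assms in auto)
  ultimately have ev: "\<forall>\<^sub>F z in nhds 0. eval_fps g z = eval_fps (fps_of_poly A * g) z / poly A z"
    by eventually_elim (auto simp: eval_fps_poly_mult)
  have "eval_fps g has_fps_expansion g" using assms(2) by (intro eval_fps_has_fps_expansion)
  thus ?thesis using has_fps_expansion_cong[OF ev refl] by blast
qed

lemma quotient_meromorphic:
  assumes "\<rho> \<le> fps_conv_radius (fps_of_poly A * g)"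
  shows "(\<lambda>z. eval_fps (fps_of_poly A * g) z / poly A z) meromorphic_on eball 0 \<rho>"
  using assms by (intro meromorphic_intros) (auto intro: less_le_trans)

lemma quotient_holomorphic:
  assumes "\<rho> \<le> fps_conv_radius (fps_of_poly A * g)" "S \<subseteq> eball 0 \<rho>" "\<And>z. z \<in> S \<Longrightarrow> poly A z \<noteq> 0"
  shows "(\<lambda>z. eval_fps (fps_of_poly A * g) z / poly A z) holomorphic_on S"
  using assms by (intro holomorphic_intros) (auto intro: less_le_trans)

lemma fps_conv_radius_pos_of_polar:
  assumes "polar g \<xi> s \<rho>" "\<xi> \<noteq> 0"
  shows "fps_conv_radius g \<ge> ereal (norm \<xi>)" "fps_conv_radius g > 0"
proof -
  have "fps_conv_radius g \<ge> min (ereal (norm \<xi>)) (fps_conv_radius (fps_of_poly ([:-\<xi>, 1:] ^ s) * g))"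
    using assms(2) by (intro fps_conv_radius_poly_factor_cancel) (auto simp: poly_power split: if_splits)
  thus *: "fps_conv_radius g \<ge> ereal (norm \<xi>)"
    using assms(1) by (auto simp: polar_def min_def split: if_splits)
  show "fps_conv_radius g > 0" using assms(2) by (intro less_le_trans[OF _ *]) auto
qed

lemma polar_quotient_pole:
  assumes "polar g \<xi> s \<rho>" "s \<ge> 1" "\<forall>\<^sub>F w in at \<xi>. poly ([:-\<xi>, 1:] ^ s) w * F w = eval_fps (fps_of_poly ([:-\<xi>, 1:] ^ s) * g) w"
  shows "is_pole F \<xi>" "pole_order F \<xi> = s"
proof -
  have "ereal (norm \<xi>) < fps_conv_radius (fps_of_poly ([:-\<xi>, 1:] ^ s) * g)"
    using assms(1) by (auto simp: polar_def)
  hence an: "eval_fps (fps_of_poly ([:-\<xi>, 1:] ^ s) * g) analytic_on {\<xi>}"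
    by (intro analytic_on_eval_fps) auto
  have *: "[:-\<xi>, 1:] ^ s \<noteq> 0" "poly ([:-\<xi>, 1:] ^ s) \<xi> = 0" using assms(2) by (auto simp: poly_power)
  show "is_pole F \<xi>" using pole_order_quotient_eq(1)[OF * an _ assms(3)] assms(1) by (auto simp: polar_def)
  show "pole_order F \<xi> = s"
    using pole_order_quotient_eq(2)[OF * an _ assms(3)] assms(1) by (auto simp: polar_def order_power_n_n)
qed

text \<open>
  The quotient by \<open>(z - \<xi>)\<^sup>s\<close> is the function to which the definitions of single poles and of
  the radii with a bounded number of poles refer.
\<close>

lemma polar_imp_pole_function:
  assumes "polar g \<xi> s \<rho>" "s \<ge> 1" "\<xi> \<noteq> 0"
  defines "F \<equiv> \<lambda>z. eval_fps (fps_of_poly ([:-\<xi>, 1:] ^ s) * g) z / poly ([:-\<xi>, 1:] ^ s) z"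
  shows "F has_fps_expansion g" "F meromorphic_on eball 0 \<rho>" "F holomorphic_on eball 0 \<rho> - {\<xi>}"
    "is_pole F \<xi>" "pole_order F \<xi> = s" "\<And>z. z \<in> eball 0 \<rho> \<Longrightarrow> is_pole F z \<Longrightarrow> z = \<xi>"
proof -
  have \<rho>: "\<rho> \<le> fps_conv_radius (fps_of_poly ([:-\<xi>, 1:] ^ s) * g)" "ereal (norm \<xi>) < \<rho>"
    using assms(1) by (auto simp: polar_def)
  show "F has_fps_expansion g" unfolding F_def
    using fps_conv_radius_pos_of_polar[OF assms(1,3)] assms(3) by (intro quotient_has_fps_expansion) (auto simp: poly_power)
  show "F meromorphic_on eball 0 \<rho>" unfolding F_def by (rule quotient_meromorphic[OF \<rho>(1)])
  show hol: "F holomorphic_on eball 0 \<rho> - {\<xi>}" unfolding F_def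
    by (rule quotient_holomorphic[OF \<rho>(1)]) (auto simp: poly_power)
  have "\<forall>\<^sub>F w in at \<xi>. w \<noteq> \<xi>" by (simp add: eventually_at_filter)
  hence "\<forall>\<^sub>F w in at \<xi>. poly ([:-\<xi>, 1:] ^ s) w * F w = eval_fps (fps_of_poly ([:-\<xi>, 1:] ^ s) * g) w"
    by eventually_elim (simp add: F_def poly_power)
  thus "is_pole F \<xi>" "pole_order F \<xi> = s" using polar_quotient_pole[OF assms(1,2)] by auto
  show "z = \<xi>" if "z \<in> eball 0 \<rho>" "is_pole F z" for z
  proof (rule ccontr)
    assume "z \<noteq> \<xi>"
    hence "F analytic_on {z}" using hol that(1)
      by (intro holomorphic_on_imp_analytic_at[OF hol]) auto
    thus False using that(2) analytic_at_imp_no_pole by blast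
  qed
qed

lemma polar_imp_single_pole:
  assumes "polar g \<xi> s \<rho>" "s \<ge> 1" "\<xi> \<noteq> 0"
  shows "single_pole g \<xi> s"
proof -
  have "cball 0 (norm \<xi>) \<subseteq> eball 0 \<rho>"
    using assms(1) by (auto simp: polar_def intro: le_less_trans[OF ereal_less_eq(3)[THEN iffD2]])
  thus ?thesis
  unfolding single_pole_def
  using polar_imp_pole_function[OF assms]
  by (intro exI[of _ "\<lambda>z. eval_fps (fps_of_poly ([:-\<xi>, 1:] ^ s) * g) z / poly ([:-\<xi>, 1:] ^ s) z"] exI[of _ "eball 0 \<rho>"]) auto
qed

lemma polar_imp_radius_poles:
  assumes "polar g \<xi> s \<rho>" "s \<ge> 1" "\<xi> \<noteq> 0"
  shows "radius_poles s g \<ge> \<rho>"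
  unfolding radius_poles_def
proof (rule Sup_upper, rule insertI2, rule CollectI)
  define F where "F = (\<lambda>z. eval_fps (fps_of_poly ([:-\<xi>, 1:] ^ s) * g) z / poly ([:-\<xi>, 1:] ^ s) z)"
  note F = polar_imp_pole_function[OF assms, folded F_def]
  have "{z \<in> eball 0 \<rho>. is_pole F z} = {\<xi>}" using F assms(1) by (auto simp: polar_def)
  thus "\<exists>F. mero_extends g F \<rho> \<and> finite {z \<in> eball 0 \<rho>. is_pole F z} \<and>
            (\<Sum>z | z \<in> eball 0 \<rho> \<and> is_pole F z. pole_order F z) \<le> s"
    using F by (intro exI[of _ F]) (auto simp: mero_extends_def)
qed

text \<open>
  The closed disk of radius \<open>|\<xi>|\<close> has a positive distance from the complement of \<open>U\<close>, so the neighbourhood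
  may be taken to be a larger disk. The value at \<open>\<xi>\<close> is not zero because otherwise a denominator of
  degree \<open>s - 1\<close> would suffice, and the order of the pole would be smaller than \<open>s\<close>.
\<close>

lemma single_pole_imp_polar:
  fixes \<xi> :: complex
  assumes "single_pole g \<xi> s" "\<xi> \<noteq> 0"
  obtains \<rho> where "polar g \<xi> s \<rho>" "s \<ge> 1"
proof -
  obtain F U where F: "F has_fps_expansion g" "open U" "cball 0 (norm \<xi>) \<subseteq> U"
    "F holomorphic_on U - {\<xi>}" "is_pole F \<xi>" "pole_order F \<xi> = s"
    using assms(1) unfolding single_pole_def by blast
  have "cball 0 (norm \<xi>) \<inter> - U = {}" using F(3) by auto
  from separate_compact_closed[OF compact_cball _ this]
  obtain d where d: "d > 0" "\<And>x y. x \<in> cball 0 (norm \<xi>) \<Longrightarrow> y \<in> - U \<Longrightarrow> d \<le> dist x y"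
    using F(2) by (auto simp: closed_Compl)
  define r where "r = norm \<xi> + d"
  have sub: "ball 0 r \<subseteq> U"
  proof
    fix y :: complex assume y: "y \<in> ball 0 r"
    show "y \<in> U"
    proof (cases "norm y \<le> norm \<xi>")
      case False
      define x where "x = of_real (norm \<xi> / norm y) * y"
      have y0: "y \<noteq> 0" using False by auto
      have "norm x = norm \<xi>" using y0 by (simp add: x_def norm_mult norm_divide)
      moreover have "dist x y < d"
      proof -
        have "x - y = of_real (norm \<xi> / norm y - 1) * y" by (simp add: x_def algebra_simps)
        hence "dist x y = \<bar>norm \<xi> / norm y - 1\<bar> * norm y" by (simp only: dist_norm norm_mult norm_of_real)
        also have "\<dots> = norm y - norm \<xi>" using y0 False by (simp add: abs_if field_simps)
        finally show ?thesis using y by (simp add: r_def)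
      qed
      ultimately show ?thesis using d(2)[of x y] by force
    qed (use F(3) in auto)
  qed
  have iso: "isolated_singularity_at F \<xi>"
    using F sub by (intro isolated_singularity_at_holomorphic[of _ U]) auto
  have hol: "F holomorphic_on eball 0 (ereal r) - {\<xi>}"
    using F(4) sub by (auto intro: holomorphic_on_subset)
  have mero: "F meromorphic_on eball 0 (ereal r)"
  proof (subst meromorphic_on_meromorphic_at, rule ballI)
    fix z :: complex assume z: "z \<in> eball 0 (ereal r)"
    show "F meromorphic_on {z}"
    proof (cases "z = \<xi>")
      case True
      thus ?thesis using iso F(5) by (auto simp: meromorphic_at_iff)
    next
      case False
      hence "F analytic_on {z}" using z by (intro holomorphic_on_imp_analytic_at[OF hol]) auto
      thus ?thesis by (rule analytic_on_imp_meromorphic_on)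
    qed
  qed
  define A where "A = [:-\<xi>, 1:] ^ s"
  have s: "s \<ge> 1" using pole_order_pos[OF iso F(5)] F(6) by simp
  have A: "A \<noteq> 0" "poly A \<xi> = 0" "Polynomial.order \<xi> A = s"
    using s by (auto simp: A_def poly_power order_power_n_n)
  have R: "ereal r \<le> fps_conv_radius (fps_of_poly A * g)"
  proof (rule fps_conv_radius_of_bounded_poles[OF F(1) mero A(1)])
    fix z assume z: "z \<in> eball 0 (ereal r)" "is_pole F z"
    have "z = \<xi>"
    proof (rule ccontr)
      assume "z \<noteq> \<xi>"
      hence "F analytic_on {z}" using z by (intro holomorphic_on_imp_analytic_at[OF hol]) auto
      thus False using z analytic_at_imp_no_pole by blast
    qed
    thus "pole_order F z \<le> Polynomial.order z A" using F(6) A by simp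
  qed
  have xi: "\<xi> \<in> eball 0 (ereal r)" using d(1) by (simp add: r_def)
  have "eval_fps (fps_of_poly A * g) \<xi> \<noteq> 0"
  proof
    assume 0: "eval_fps (fps_of_poly A * g) \<xi> = 0"
    define B where "B = [:-\<xi>, 1:] ^ (s - 1)"
    have AB: "A = [:-\<xi>, 1:] * B" using s unfolding A_def B_def by (metis power_Suc Suc_pred' less_eq_Suc_le One_nat_def)
    hence eqAB: "fps_of_poly A * g = fps_of_poly [:-\<xi>, 1:] * (fps_of_poly B * g)"
      by (simp add: fps_of_poly_mult mult.assoc del: mult_pCons_left)
    have "fps_conv_radius (fps_of_poly A * g) \<le> fps_conv_radius (fps_of_poly B * g)"
      using R xi by (intro fps_conv_radius_zero_cancel[OF _ 0 eqAB]) (auto intro: less_le_trans[of _ "ereal r"])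
    hence RB: "ereal r \<le> fps_conv_radius (fps_of_poly B * g)" using R by order
    have B: "B \<noteq> 0" "Polynomial.order \<xi> B = s - 1" by (auto simp: B_def order_power_n_n)
    have "pole_order F \<xi> \<le> Polynomial.order \<xi> B"
      using xi RB by (intro pole_order_quotient_le(2)[OF B(1) _ meromorphic_expansion_times_poly[OF F(1) mero RB xi] F(5)] analytic_on_eval_fps)
        (auto intro: less_le_trans[of _ "ereal r"])
    thus False using F(6) B s by simp
  qed
  hence "polar g \<xi> s (ereal r)" using R d(1) unfolding polar_def A_def by (simp add: r_def)
  thus ?thesis using s that by blast
qed

text \<open>
  The pole at \<open>\<xi>\<close> already uses up all \<open>s\<close> poles that are permitted in the disk.
\<close>

lemma single_pole_radius_poles_imp_polar:
  assumes "single_pole g \<xi> s" "\<xi> \<noteq> 0" "ereal (norm \<xi>) < \<rho>" "\<rho> < radius_poles s g"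
  shows "polar g \<xi> s \<rho>"
proof -
  obtain \<rho>0 where p0: "polar g \<xi> s \<rho>0" and s: "s \<ge> 1" using single_pole_imp_polar[OF assms(1,2)] .
  define A where "A = [:-\<xi>, 1:] ^ s"
  have A: "A \<noteq> 0" "Polynomial.order \<xi> A = s" by (auto simp: A_def order_power_n_n)
  have "0 < \<rho>" using assms(3) by (auto intro: le_less_trans[of _ "ereal (norm \<xi>)"])
  then obtain r F where r: "\<rho> < r" "mero_extends g F r" "finite {z \<in> eball 0 r. is_pole F z}"
      "(\<Sum>z | z \<in> eball 0 r \<and> is_pole F z. pole_order F z) \<le> s"
    using assms(4) unfolding radius_poles_def less_Sup_iff by force
  have F: "F has_fps_expansion g" "F meromorphic_on eball 0 r" using r(2) by (auto simp: mero_extends_def)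
  have xi: "\<xi> \<in> eball 0 r" "\<xi> \<in> eball 0 (min \<rho>0 r)" using assms(3) r(1) p0 by (auto simp: polar_def)
  have "\<forall>\<^sub>F w in at \<xi>. poly A w * F w = eval_fps (fps_of_poly A * g) w"
  proof (rule meromorphic_expansion_times_poly[OF F(1) _ _ xi(2)])
    show "F meromorphic_on eball 0 (min \<rho>0 r)" using F(2) by (rule meromorphic_on_subset) auto
    show "min \<rho>0 r \<le> fps_conv_radius (fps_of_poly A * g)" using p0 by (auto simp: polar_def A_def min_def)
  qed
  hence pole: "is_pole F \<xi>" "pole_order F \<xi> = s" using polar_quotient_pole[OF p0 s] unfolding A_def by auto
  have "r \<le> fps_conv_radius (fps_of_poly A * g)"
  proof (rule fps_conv_radius_of_bounded_poles[OF F A(1)])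
    fix z assume z: "z \<in> eball 0 r" "is_pole F z"
    have "z = \<xi>"
    proof (rule ccontr)
      assume ne: "z \<noteq> \<xi>"
      have "(\<Sum>z\<in>{\<xi>, z}. pole_order F z) \<le> (\<Sum>z | z \<in> eball 0 r \<and> is_pole F z. pole_order F z)"
        using r(3) z xi pole by (intro sum_mono2) auto
      hence "pole_order F \<xi> + pole_order F z \<le> s" using ne r(4) by simp
      moreover have "pole_order F z \<ge> 1"
        using z F(2) by (intro pole_order_pos) (auto simp: meromorphic_on_isolated_singularity meromorphic_on_subset)
      ultimately show False using pole(2) by simp
    qed
    thus "pole_order F z \<le> Polynomial.order z A" using pole A by simp
  qed
  thus ?thesis using p0 assms(3) r(1) unfolding polar_def A_def by auto
qed

text \<open>
  A denominator of least degree has exactly the poles of \<open>g\<close> in the disk as zeros: a zero outside the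
  disk, or a zero at which \<open>A g\<close> vanishes, could be cancelled.
\<close>

lemma minimal_denominator:
  fixes A0 :: "complex poly"
  assumes "A0 \<noteq> 0" "\<rho> \<le> fps_conv_radius (fps_of_poly A0 * g)" "fps_conv_radius g > 0" "\<rho> > 0"
  obtains A where "A \<noteq> 0" "\<rho> \<le> fps_conv_radius (fps_of_poly A * g)"
    "\<And>\<xi>. poly A \<xi> = 0 \<Longrightarrow> \<xi> \<noteq> 0 \<and> ereal (norm \<xi>) < \<rho> \<and> eval_fps (fps_of_poly A * g) \<xi> \<noteq> 0"
proof -
  define P where "P = (\<lambda>A. A \<noteq> 0 \<and> \<rho> \<le> fps_conv_radius (fps_of_poly A * g))"
  have "P A0" using assms by (simp add: P_def)
  from arg_min_natI[of P, OF this, of degree] arg_min_nat_le[of P _ degree]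
  obtain A where A: "P A" and min: "\<And>B. P B \<Longrightarrow> degree A \<le> degree B" by blast
  have "\<xi> \<noteq> 0 \<and> ereal (norm \<xi>) < \<rho> \<and> eval_fps (fps_of_poly A * g) \<xi> \<noteq> 0" if root: "poly A \<xi> = 0" for \<xi>
  proof (rule ccontr)
    assume neg: "\<not> ?thesis"
    obtain B where AB: "A = [:-\<xi>, 1:] * B" using root by (metis poly_eq_0_iff_dvd dvdE)
    have B: "B \<noteq> 0" using A AB by (auto simp: P_def)
    hence deg: "degree A = Suc (degree B)" unfolding AB by (subst degree_mult_eq) auto
    have eqAB: "fps_of_poly A * g = fps_of_poly [:-\<xi>, 1:] * (fps_of_poly B * g)"
      by (simp add: AB fps_of_poly_mult mult.assoc del: mult_pCons_left)
    have R: "\<rho> \<le> fps_conv_radius (fps_of_poly A * g)" using A by (simp add: P_def)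
    have "\<rho> \<le> fps_conv_radius (fps_of_poly B * g)"
    proof (cases "ereal (norm \<xi>) < \<rho>")
      case True
      have "eval_fps (fps_of_poly A * g) \<xi> = 0"
      proof (cases "\<xi> = 0")
        case t: True
        have "eval_fps (fps_of_poly A * g) 0 = poly A 0 * eval_fps g 0"
          using assms(3) by (intro eval_fps_poly_mult) (simp add: zero_ereal_def)
        thus ?thesis using t root by simp
      qed (use neg True in auto)
      thus ?thesis using True R fps_conv_radius_zero_cancel[OF _ _ eqAB] by (meson order_less_le_trans order_trans)
    next
      case False
      hence "\<xi> \<noteq> 0" using assms(4) by (auto simp: zero_ereal_def)
      from fps_conv_radius_linear_factor_cancel[OF this, of "fps_of_poly B * g"] False R
      show ?thesis unfolding eqAB by (auto simp: min_def not_less split: if_splits intro: order_trans)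
    qed
    hence "P B" using B by (simp add: P_def)
    from min[OF this] deg show False by simp
  qed
  thus ?thesis using that A unfolding P_def by blast
qed

lemma mero_extends_le_mero_radius: "mero_extends g F r \<Longrightarrow> r \<le> mero_radius g"
  unfolding mero_radius_def by (intro Sup_upper) auto

lemma fps_conv_radius_pos_of_expansion: "F has_fps_expansion g \<Longrightarrow> fps_conv_radius g > 0"
  by (simp add: has_fps_expansion_def)

section \<open>Subtracting principal parts\<close>

definition fps_subspace :: "complex fps set \<Rightarrow> bool" where
  "fps_subspace V \<longleftrightarrow> 0 \<in> V \<and> (\<forall>g\<in>V. \<forall>h\<in>V. \<forall>a. g + fps_const a * h \<in> V)"

lemma fps_subspaceD: "fps_subspace V \<Longrightarrow> g \<in> V \<Longrightarrow> h \<in> V \<Longrightarrow> g + fps_const a * h \<in> V"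
  by (auto simp: fps_subspace_def)

lemma fps_subspace_0: "fps_subspace V \<Longrightarrow> 0 \<in> V"
  by (simp add: fps_subspace_def)

lemma polar_mono: "polar g \<xi> s \<rho> \<Longrightarrow> ereal (norm \<xi>) < \<rho>' \<Longrightarrow> \<rho>' \<le> \<rho> \<Longrightarrow> polar g \<xi> s \<rho>'"
  by (auto simp: polar_def)

text \<open>
  If \<open>V\<close> realizes all the poles that the denominator \<open>D\<close> allows, then the principal parts of \<open>h\<close> can be
  removed one order at a time: the element of \<open>V\<close> with a pole at \<open>\<xi>\<close> of the order of \<open>D\<close> is
  scaled such that subtracting it makes \<open>D h\<close> vanish at \<open>\<xi>\<close>, and a factor \<open>z - \<xi>\<close> of \<open>D\<close> is cancelled.
  Zeros of \<open>D\<close> in the disk of radius \<open>r\<close>, where \<open>h\<close> is analytic, and zeros outside the disk of radius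
  \<open>\<rho>\<close> are cancelled without changing \<open>h\<close>. The power \<open>z\<^sup>c\<close> is harmless because it is
  analytic and does not vanish at \<open>\<xi>\<close>.
\<close>

lemma subtract_principal_parts:
  assumes V: "fps_subspace V"
    and D: "poly D 0 \<noteq> 0" and "\<rho> \<le> fps_conv_radius (fps_of_poly D * h)" "r \<le> fps_conv_radius h"
    and "0 < \<rho>"
    and polar: "\<And>\<xi> s. poly D \<xi> = 0 \<Longrightarrow> r \<le> ereal (norm \<xi>) \<Longrightarrow> ereal (norm \<xi>) < \<rho> \<Longrightarrow>
                 1 \<le> s \<Longrightarrow> s \<le> Polynomial.order \<xi> D \<Longrightarrow> \<exists>g\<in>V. polar g \<xi> s \<rho>"
  shows "\<exists>g\<in>V. \<rho> \<le> fps_conv_radius (h - fps_X ^ c * g)"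
  using D assms(3,4) polar
proof (induction "degree D" arbitrary: D h)
  case 0
  then obtain a where "D = [:a:]" "a \<noteq> 0" by (metis degree_eq_zeroE poly_pCons mult_zero_left add.right_neutral)
  hence "\<rho> \<le> fps_conv_radius h" using "0.prems"(2) by (simp add: fps_of_poly_const fps_conv_radius_cmult_left)
  thus ?case using fps_subspace_0[OF V] by (intro bexI[of _ 0]) auto
next
  case (Suc n)
  obtain \<xi> E where DE: "D = [:-\<xi>, 1:] * E" and E: "E \<noteq> 0" "degree D = Suc (degree E)"
    using poly_split_root[of D] Suc.hyps(2) by (metis zero_less_Suc)
  have D0: "D \<noteq> 0" using Suc.prems(1) by auto
  have root: "poly D \<xi> = 0" and xi0: "\<xi> \<noteq> 0" and E0: "poly E 0 \<noteq> 0"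
    using Suc.prems(1) by (auto simp: DE)
  have eqDE: "fps_of_poly D * k = fps_of_poly [:-\<xi>, 1:] * (fps_of_poly E * k)" for k
    by (simp add: DE fps_of_poly_mult mult.assoc del: mult_pCons_left)
  have ordE: "poly E z = 0 \<Longrightarrow> poly D z = 0 \<and> Polynomial.order z E \<le> Polynomial.order z D" for z
    using D0 DE by (auto intro!: dvd_imp_order_le simp del: mult_pCons_left)
  have IH: "\<exists>g\<in>V. \<rho> \<le> fps_conv_radius (h' - fps_X ^ c * g)"
    if "\<rho> \<le> fps_conv_radius (fps_of_poly E * h')" "r \<le> fps_conv_radius h'" for h'
  proof (rule Suc.hyps(1))
    show "n = degree E" using E(2) Suc.hyps(2) by simp
    show "\<exists>g\<in>V. polar g z s \<rho>"
      if "poly E z = 0" "r \<le> ereal (norm z)" "ereal (norm z) < \<rho>" "1 \<le> s" "s \<le> Polynomial.order z E" for z s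
      using Suc.prems(4)[of z s] ordE[OF that(1)] that by linarith
  qed (use that E0 in auto)
  consider "ereal (norm \<xi>) < r" | "\<rho> \<le> ereal (norm \<xi>)" | "r \<le> ereal (norm \<xi>)" "ereal (norm \<xi>) < \<rho>" by force
  thus ?case
  proof cases
    case 1
    hence lt: "ereal (norm \<xi>) < fps_conv_radius h" using Suc.prems(3) by order
    hence "eval_fps (fps_of_poly D * h) \<xi> = 0" using root by (simp add: eval_fps_poly_mult)
    moreover have "ereal (norm \<xi>) < fps_conv_radius (fps_of_poly D * h)"
      using lt fps_conv_radius_poly_mult[of h D] by order
    ultimately have "fps_conv_radius (fps_of_poly D * h) \<le> fps_conv_radius (fps_of_poly E * h)"
      using fps_conv_radius_zero_cancel[OF _ _ eqDE] by blast
    hence "\<rho> \<le> fps_conv_radius (fps_of_poly E * h)" using Suc.prems(2) by order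
    thus ?thesis using IH Suc.prems(3) by blast
  next
    case 2
    have "min (ereal (norm \<xi>)) (fps_conv_radius (fps_of_poly D * h)) \<le> fps_conv_radius (fps_of_poly E * h)"
      unfolding eqDE by (rule fps_conv_radius_linear_factor_cancel[OF xi0])
    hence "\<rho> \<le> fps_conv_radius (fps_of_poly E * h)" using 2 Suc.prems(2) by (auto simp: min_def split: if_splits)
    thus ?thesis using IH Suc.prems(3) by blast
  next
    case 3
    define s where "s = Polynomial.order \<xi> D"
    have s: "1 \<le> s" using root D0 order_root[of D \<xi>] by (auto simp: s_def)
    obtain g where g: "g \<in> V" "polar g \<xi> s \<rho>" using Suc.prems(4)[OF root 3 s] by (auto simp: s_def)
    define u where "u = fps_of_poly ([:-\<xi>, 1:] ^ s) * g"
    have u: "\<rho> \<le> fps_conv_radius u" "eval_fps u \<xi> \<noteq> 0" using g(2) by (auto simp: u_def polar_def)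
    obtain W where W: "D = [:-\<xi>, 1:] ^ s * W" "\<not> [:-\<xi>, 1:] dvd W"
      using order_decomp[OF D0, of \<xi>] unfolding s_def by blast
    have W\<xi>: "poly W \<xi> \<noteq> 0" using W(2) by (simp add: poly_eq_0_iff_dvd)
    have eqg: "fps_of_poly D * (fps_X ^ c * g) = fps_of_poly (W * monom 1 c) * u"
      by (simp add: W(1) u_def fps_of_poly_mult fps_of_poly_monom mult_ac)
    have Rg: "\<rho> \<le> fps_conv_radius (fps_of_poly D * (fps_X ^ c * g))"
      unfolding eqg using u(1) fps_conv_radius_poly_mult by (rule order_trans)
    have xu: "ereal (norm \<xi>) < fps_conv_radius u" using 3(2) u(1) by order
    have ev: "eval_fps (fps_of_poly D * (fps_X ^ c * g)) \<xi> \<noteq> 0"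
      unfolding eqg using xu u(2) W\<xi> xi0 by (simp add: eval_fps_poly_mult poly_monom)
    define a where "a = eval_fps (fps_of_poly D * h) \<xi> / eval_fps (fps_of_poly D * (fps_X ^ c * g)) \<xi>"
    define h' where "h' = h - fps_const a * (fps_X ^ c * g)"
    have eqh': "fps_of_poly D * h' = fps_of_poly D * h - fps_const a * (fps_of_poly D * (fps_X ^ c * g))"
      by (simp add: h'_def algebra_simps)
    have Rag: "\<rho> \<le> fps_conv_radius (fps_const a * (fps_of_poly D * (fps_X ^ c * g)))"
      using Rg fps_conv_radius_poly_mult[of _ "[:a:]"] by (simp add: fps_of_poly_const) (meson order_trans)
    have Rh': "\<rho> \<le> fps_conv_radius (fps_of_poly D * h')"
      unfolding eqh' using Suc.prems(2) Rag by (rule fps_conv_radius_diff_ge)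
    have "eval_fps (fps_of_poly D * h') \<xi> = 0"
      unfolding eqh' using 3(2) Suc.prems(2) Rag Rg ev
      by (subst eval_fps_diff) (auto simp: eval_fps_mult a_def intro: less_le_trans)
    moreover have "ereal (norm \<xi>) < fps_conv_radius (fps_of_poly D * h')" using 3(2) Rh' by order
    ultimately have "fps_conv_radius (fps_of_poly D * h') \<le> fps_conv_radius (fps_of_poly E * h')"
      using fps_conv_radius_zero_cancel[OF _ _ eqDE] by blast
    hence "\<rho> \<le> fps_conv_radius (fps_of_poly E * h')" using Rh' by order
    moreover have "r \<le> fps_conv_radius h'"
    proof -
      have "r \<le> fps_conv_radius (fps_X ^ c * g)"
        using fps_conv_radius_pos_of_polar(1)[OF g(2) xi0] 3(1) by (simp add: fps_conv_radius_X_power_mult)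
      hence "r \<le> fps_conv_radius (fps_const a * (fps_X ^ c * g))"
        using fps_conv_radius_poly_mult[of _ "[:a:]"] by (simp add: fps_of_poly_const) (meson order_trans)
      thus ?thesis unfolding h'_def using Suc.prems(3) by (intro fps_conv_radius_diff_ge)
    qed
    ultimately obtain g' where g': "g' \<in> V" "\<rho> \<le> fps_conv_radius (h' - fps_X ^ c * g')" using IH by blast
    have "h' - fps_X ^ c * g' = h - fps_X ^ c * (g' + fps_const a * g)"
      by (simp add: h'_def algebra_simps)
    thus ?thesis using g' fps_subspaceD[OF V g'(1) g(1), of a] by (intro bexI[of _ "g' + fps_const a * g"]) auto
  qed
qed

text \<open>
  The polynomials \<open>Q\<^sub>n\<close> annihilate \<open>V\<close> for large \<open>n\<close> and converge to \<open>QM\<close> at the geometric rate \<open>l\<close>.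
\<close>

locale converging_denominators =
  fixes V :: "complex fps set" and Q :: "nat \<Rightarrow> complex poly" and QM :: "complex poly"
    and l C :: real and M :: nat
  assumes subspace: "fps_subspace V"
    and l: "0 < l" "l < 1"
    and convergence: "\<And>i. \<forall>\<^sub>F n in sequentially. norm (coeff (Q n - QM) i) \<le> C * l ^ n"
    and degree_Q: "\<forall>\<^sub>F n in sequentially. degree (Q n) \<le> M"
    and QM_0: "poly QM 0 \<noteq> 0"
    and annihilated: "\<forall>\<^sub>F n in sequentially. \<forall>g\<in>V. fps_nth (fps_of_poly (Q n) * g) n = 0"
begin

lemma QM_nonzero: "QM \<noteq> 0"
  using QM_0 by auto

lemma coeff_Q_tendsto: "(\<lambda>n. coeff (Q n) i) \<longlonglongrightarrow> coeff QM i"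
proof -
  have "(\<lambda>n. coeff (Q n - QM) i) \<longlonglongrightarrow> 0"
  proof (rule Lim_null_comparison[OF convergence])
    show "(\<lambda>n. C * l ^ n) \<longlonglongrightarrow> 0"
      using tendsto_mult_right_zero[OF LIMSEQ_power_zero[of l]] l by auto
  qed
  thus ?thesis by (simp add: LIM_zero_iff)
qed

lemma coeff_Q_bounded: "\<exists>B. \<forall>i. \<forall>\<^sub>F n in sequentially. norm (coeff (Q n) i) \<le> B"
proof -
  define B where "B = (\<Sum>i\<le>degree QM. norm (coeff QM i)) + 1"
  have lt: "norm (coeff QM i) < B" for i
  proof (cases "i \<le> degree QM")
    case True
    hence "norm (coeff QM i) \<le> (\<Sum>i\<le>degree QM. norm (coeff QM i))" by (intro member_le_sum) auto
    thus ?thesis by (simp add: B_def)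
  next
    case False
    have "(\<Sum>i\<le>degree QM. norm (coeff QM i)) \<ge> 0" by (intro sum_nonneg) auto
    thus ?thesis using False by (simp add: B_def coeff_eq_0)
  qed
  have "\<forall>\<^sub>F n in sequentially. norm (coeff (Q n) i) < B" for i
    using order_tendstoD(2)[OF tendsto_norm[OF coeff_Q_tendsto] lt] .
  hence "\<forall>\<^sub>F n in sequentially. norm (coeff (Q n) i) \<le> B" for i
    by (rule eventually_mono[of "\<lambda>n. norm (coeff (Q n) i) < B"]) auto
  thus ?thesis by blast
qed

lemma degree_diff_bounded: "\<forall>\<^sub>F n in sequentially. degree (Q n - QM) \<le> max M (degree QM)"
  using degree_Q by eventually_elim (auto intro: degree_diff_le)

lemma inverse_Q0_bounded: "\<exists>B>0. \<forall>\<^sub>F n in sequentially. coeff (Q n) 0 \<noteq> 0 \<and> norm (inverse (coeff (Q n) 0)) \<le> B"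
proof -
  have nz: "coeff QM 0 \<noteq> 0" using QM_0 by (simp add: poly_0_coeff_0)
  have "(\<lambda>n. norm (inverse (coeff (Q n) 0))) \<longlonglongrightarrow> norm (inverse (coeff QM 0))"
    by (intro tendsto_intros coeff_Q_tendsto nz)
  hence "\<forall>\<^sub>F n in sequentially. norm (inverse (coeff (Q n) 0)) < norm (inverse (coeff QM 0)) + 1"
    by (rule order_tendstoD) simp
  moreover have "\<forall>\<^sub>F n in sequentially. coeff (Q n) 0 \<noteq> 0"
    using tendsto_imp_eventually_ne[OF coeff_Q_tendsto nz] .
  ultimately have "\<forall>\<^sub>F n in sequentially. coeff (Q n) 0 \<noteq> 0 \<and> norm (inverse (coeff (Q n) 0)) \<le> norm (inverse (coeff QM 0)) + 1"
    by eventually_elim auto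
  thus ?thesis by (intro exI[of _ "norm (inverse (coeff QM 0)) + 1"]) (auto intro: add_nonneg_pos)
qed

text \<open>
  This is where the geometric rate enters: the coefficients of \<open>(Q\<^sub>n - QM) h\<close> of index \<open>n + c\<close> are smaller than
  those of \<open>h\<close> by the factor \<open>l\<^sup>n\<close>.
\<close>

lemma radius_QM_mult_ge:
  assumes "decays (\<lambda>n. fps_nth (fps_of_poly (Q n) * h) (n + c)) \<rho>"
  shows "min \<rho> (fps_conv_radius h / ereal l) \<le> fps_conv_radius (fps_of_poly QM * h)"
proof -
  have d: "decays (\<lambda>n. fps_nth (fps_of_poly (Q n - QM) * h) (n + c)) (fps_conv_radius h / ereal l)"
    by (rule decays_poly_mult[OF convergence l(1) degree_diff_bounded order_refl])
  have "decays (\<lambda>n. fps_nth (fps_of_poly (Q n) * h) (n + c) - fps_nth (fps_of_poly (Q n - QM) * h) (n + c))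
           (min \<rho> (fps_conv_radius h / ereal l))"
    by (rule decays_diff[OF decays_mono[OF assms] decays_mono[OF d]]) auto
  also have "(\<lambda>n. fps_nth (fps_of_poly (Q n) * h) (n + c) - fps_nth (fps_of_poly (Q n - QM) * h) (n + c)) =
             (\<lambda>n. fps_nth (fps_of_poly QM * h) (n + c))"
    by (auto simp: fps_of_poly_diff algebra_simps)
  finally show ?thesis by (simp add: decays_shift[of "fps_nth _"] decays_iff_fps_conv_radius)
qed

lemma radius_QM_mult_ge_V:
  assumes "g \<in> V"
  shows "fps_conv_radius g / ereal l \<le> fps_conv_radius (fps_of_poly QM * g)"
proof -
  have "\<forall>\<^sub>F n in sequentially. fps_nth (fps_of_poly (Q n) * g) (n + 0) = 0"
    using annihilated assms by (auto elim: eventually_mono)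
  hence "decays (\<lambda>n. fps_nth (fps_of_poly (Q n) * g) (n + 0)) \<infinity>" by (subst decays_cong) auto
  from radius_QM_mult_ge[OF this] show ?thesis by simp
qed

lemma divide_l_gt:
  assumes "0 < r" "r \<noteq> \<infinity>"
  shows "r < r / ereal l"
  using assms l by (cases r) (auto simp: field_simps)

end

text \<open>
  In addition, \<open>V\<close> contains functions with a single pole at every zero of \<open>QM\<close>, of every order up to the
  multiplicity. By \<open>system_pole_iff_root\<close> below, this means that the zeros of \<open>QM\<close> are the system poles.
\<close>

locale realized_poles = converging_denominators +
  assumes realized: "\<And>\<xi> s. poly QM \<xi> = 0 \<Longrightarrow> 1 \<le> s \<Longrightarrow> s \<le> Polynomial.order \<xi> QM \<Longrightarrow> \<exists>g\<in>V. \<exists>\<rho>. polar g \<xi> s \<rho>"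
begin

text \<open>
  By \<open>radius_QM_mult_ge\<close>, the singularities of \<open>h\<close> on its circle of convergence are poles at
  zeros of \<open>QM\<close> as long as the radius is less than \<open>\<rho>\<close>, and \<open>subtract_principal_parts\<close> removes them. The
  decay is preserved since \<open>[z\<^sup>n\<^sup>+\<^sup>c](Q\<^sub>n z\<^sup>c g) = [z\<^sup>n](Q\<^sub>n g) = 0\<close>, so that the next circle can be
  treated in the same way. The induction is on the number of zeros of \<open>QM\<close> that are not yet inside
  the disk of convergence.
\<close>

lemma subtract_V_from_decaying:
  assumes "decays (\<lambda>n. fps_nth (fps_of_poly (Q n) * h) (n + c)) \<rho>" "fps_conv_radius h > 0"
  shows "\<exists>g\<in>V. \<rho> \<le> fps_conv_radius (h - fps_X ^ c * g)"
  using assms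
proof (induction "card {\<xi>. poly QM \<xi> = 0 \<and> fps_conv_radius h \<le> ereal (norm \<xi>)}" arbitrary: h rule: less_induct)
  case less
  define r where "r = fps_conv_radius h"
  show ?case
  proof (cases "\<rho> \<le> r")
    case True
    thus ?thesis using fps_subspace_0[OF subspace] by (intro bexI[of _ 0]) (auto simp: r_def)
  next
    case False
    have r: "0 < r" "r < \<rho>" "r \<noteq> \<infinity>" using False less.prems(2) by (auto simp: r_def)
    define Z where "Z = {\<xi>. poly QM \<xi> = 0}"
    have finZ: "finite Z" unfolding Z_def by (rule poly_roots_finite[OF QM_nonzero])
    define S where "S = (SIGMA \<xi>:{\<xi>\<in>Z. ereal (norm \<xi>) = r}. {1..Polynomial.order \<xi> QM})"
    have finS: "finite S" unfolding S_def using finZ by auto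
    have "\<exists>g \<rho>. g \<in> V \<and> polar g (fst p) (snd p) \<rho>" if "p \<in> S" for p
      using realized[of "fst p" "snd p"] that unfolding S_def Z_def by fastforce
    then obtain G R where GR: "\<And>p. p \<in> S \<Longrightarrow> G p \<in> V \<and> polar (G p) (fst p) (snd p) (R p)" by metis
    define A where "A = insert (min \<rho> (r / ereal l)) ((\<lambda>\<xi>. ereal (norm \<xi>)) ` {\<xi>\<in>Z. r < ereal (norm \<xi>)} \<union> R ` S)"
    define \<rho>1 where "\<rho>1 = Min A"
    have finA: "finite A" "A \<noteq> {}" unfolding A_def using finZ finS by auto
    have "r < a" if "a \<in> A" for a
    proof -
      have "r < R p" if "p \<in> S" for p
        using GR[OF that] that by (auto simp: polar_def S_def)
      thus ?thesis using \<open>a \<in> A\<close> r divide_l_gt[of r] by (auto simp: A_def)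
    qed
    hence lt: "r < \<rho>1" unfolding \<rho>1_def using finA by (simp add: Min_gr_iff)
    have le: "\<rho>1 \<le> a" if "a \<in> A" for a unfolding \<rho>1_def using finA that by simp
    have "\<rho>1 \<le> min \<rho> (r / ereal l)" by (rule le) (simp add: A_def)
    also have "\<dots> \<le> fps_conv_radius (fps_of_poly QM * h)"
      unfolding r_def by (rule radius_QM_mult_ge[OF less.prems(1)])
    finally have R1: "\<rho>1 \<le> fps_conv_radius (fps_of_poly QM * h)" .
    have on_circle: "ereal (norm \<xi>) = r" if "poly QM \<xi> = 0" "r \<le> ereal (norm \<xi>)" "ereal (norm \<xi>) < \<rho>1" for \<xi>
      using le[of "ereal (norm \<xi>)"] that by (force simp: A_def Z_def)
    have "\<exists>g\<in>V. \<rho>1 \<le> fps_conv_radius (h - fps_X ^ c * g)"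
    proof (rule subtract_principal_parts[OF subspace QM_0 R1, of r])
      fix \<xi> s assume *: "poly QM \<xi> = 0" "r \<le> ereal (norm \<xi>)" "ereal (norm \<xi>) < \<rho>1" "1 \<le> s" "s \<le> Polynomial.order \<xi> QM"
      have p: "(\<xi>, s) \<in> S" using on_circle[OF *(1-3)] * by (auto simp: S_def Z_def)
      hence "\<rho>1 \<le> R (\<xi>, s)" by (intro le) (auto simp: A_def)
      thus "\<exists>g\<in>V. polar g \<xi> s \<rho>1" using GR[OF p] *(3) by (auto intro: polar_mono)
    qed (use lt r in \<open>auto simp: r_def\<close>)
    then obtain g1 where g1: "g1 \<in> V" "\<rho>1 \<le> fps_conv_radius (h - fps_X ^ c * g1)" by blast
    define h1 where "h1 = h - fps_X ^ c * g1"
    have rh1: "r < fps_conv_radius h1" using lt g1(2) unfolding h1_def by order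
    \<comment> \<open>Without a zero of the limit denominator on the circle of radius \<open>r\<close>, nothing would have to be
      subtracted, so \<open>h\<close> would already be analytic beyond that circle.\<close>
    have "\<exists>\<xi>. poly QM \<xi> = 0 \<and> ereal (norm \<xi>) = r"
    proof (rule ccontr)
      assume neg: "\<not> ?thesis"
      have "\<exists>g\<in>{0}. \<rho>1 \<le> fps_conv_radius (h - fps_X ^ c * g)"
        by (rule subtract_principal_parts[OF _ QM_0 R1, of "{0}" r])
           (use on_circle neg lt r in \<open>auto simp: r_def fps_subspace_def\<close>)
      thus False using lt by (simp add: r_def)
    qed
    then obtain \<xi> where xi: "poly QM \<xi> = 0" "ereal (norm \<xi>) = r" by blast
    have "card {\<xi>. poly QM \<xi> = 0 \<and> fps_conv_radius h1 \<le> ereal (norm \<xi>)} < card {\<xi>. poly QM \<xi> = 0 \<and> r \<le> ereal (norm \<xi>)}"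
    proof (rule psubset_card_mono)
      show "finite {\<xi>. poly QM \<xi> = 0 \<and> r \<le> ereal (norm \<xi>)}" using finZ by (simp add: Z_def)
      have "r \<le> x" if "fps_conv_radius h1 \<le> x" for x using rh1 that by order
      moreover have "\<not> fps_conv_radius h1 \<le> ereal (norm \<xi>)" using xi(2) rh1 by order
      ultimately show "{\<xi>. poly QM \<xi> = 0 \<and> fps_conv_radius h1 \<le> ereal (norm \<xi>)} \<subset> {\<xi>. poly QM \<xi> = 0 \<and> r \<le> ereal (norm \<xi>)}"
        using xi by blast
    qed
    moreover have "decays (\<lambda>n. fps_nth (fps_of_poly (Q n) * h1) (n + c)) \<rho>"
    proof (subst decays_cong)
      show "\<forall>\<^sub>F n in sequentially. fps_nth (fps_of_poly (Q n) * h1) (n + c) = fps_nth (fps_of_poly (Q n) * h) (n + c)"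
        using annihilated
      proof eventually_elim
        case (elim n)
        have "fps_of_poly (Q n) * h1 = fps_of_poly (Q n) * h - fps_X ^ c * (fps_of_poly (Q n) * g1)"
          by (simp add: h1_def algebra_simps)
        thus ?case using elim g1(1) by (simp add: fps_X_power_mult_nth)
      qed
    qed (rule less.prems(1))
    moreover have "0 < fps_conv_radius h1" using r(1) rh1 by order
    ultimately obtain g2 where g2: "g2 \<in> V" "\<rho> \<le> fps_conv_radius (h1 - fps_X ^ c * g2)"
      using less.hyps[of h1] unfolding r_def by blast
    have "h1 - fps_X ^ c * g2 = h - fps_X ^ c * (g1 + fps_const 1 * g2)" by (simp add: h1_def algebra_simps)
    thus ?thesis using g2 fps_subspaceD[OF subspace g1(1) g2(1)] by metis
  qed
qed

end

section \<open>Annihilated power series\<close>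

context converging_denominators
begin

text \<open>
  As \<open>Q\<^sub>n(0)\<close> stays away from zero, the relation \<open>[z\<^sup>n](Q\<^sub>n h) = 0\<close> bounds each coefficient of \<open>h\<close>
  by a constant times the sum of the \<open>M\<close> preceding ones, so the growth is at most geometric.
\<close>

lemma fps_conv_radius_pos_of_annihilated:
  assumes "\<forall>\<^sub>F n in sequentially. fps_nth (fps_of_poly (Q n) * h) n = 0"
  shows "fps_conv_radius h > 0"
proof -
  obtain B where B: "\<And>i. \<forall>\<^sub>F n in sequentially. norm (coeff (Q n) i) \<le> B" using coeff_Q_bounded by blast
  obtain B0 where B0: "B0 > 0" "\<forall>\<^sub>F n in sequentially. coeff (Q n) 0 \<noteq> 0 \<and> norm (inverse (coeff (Q n) 0)) \<le> B0"
    using inverse_Q0_bounded by blast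
  have "\<forall>\<^sub>F n in sequentially. \<forall>i\<in>{..M}. norm (coeff (Q n) i) \<le> B"
    by (intro eventually_ball_finite) (use B in auto)
  hence "\<forall>\<^sub>F n in sequentially. norm (fps_nth h n) \<le> (B0 * B) * (\<Sum>i\<in>{1..M}. if i \<le> n then norm (fps_nth h (n - i)) else 0)"
    using B0(2) assms degree_Q
  proof eventually_elim
    case (elim n)
    have "fps_nth (fps_of_poly (Q n) * h) n = (\<Sum>i\<le>M. coeff (Q n) i * fps_nth (fps_X ^ i * h) n)"
      by (rule fps_nth_poly_mult) (use elim in auto)
    also have "{..M} = insert 0 {1..M}" by auto
    also have "(\<Sum>i\<in>insert 0 {1..M}. coeff (Q n) i * fps_nth (fps_X ^ i * h) n) =
        coeff (Q n) 0 * fps_nth h n + (\<Sum>i\<in>{1..M}. coeff (Q n) i * fps_nth (fps_X ^ i * h) n)"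
      by (subst sum.insert) auto
    finally have "coeff (Q n) 0 * fps_nth h n = - (\<Sum>i\<in>{1..M}. coeff (Q n) i * fps_nth (fps_X ^ i * h) n)"
      using elim by (simp add: eq_neg_iff_add_eq_0)
    hence "fps_nth h n = inverse (coeff (Q n) 0) * - (\<Sum>i\<in>{1..M}. coeff (Q n) i * fps_nth (fps_X ^ i * h) n)"
      using elim by (simp add: field_simps)
    hence "norm (fps_nth h n) = norm (inverse (coeff (Q n) 0)) * norm (\<Sum>i\<in>{1..M}. coeff (Q n) i * fps_nth (fps_X ^ i * h) n)"
      by (simp only: norm_mult norm_minus_cancel)
    also have "\<dots> \<le> B0 * (\<Sum>i\<in>{1..M}. norm (coeff (Q n) i * fps_nth (fps_X ^ i * h) n))"
      using elim B0 by (intro mult_mono norm_sum) auto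
    also have "\<dots> \<le> B0 * (\<Sum>i\<in>{1..M}. B * (if i \<le> n then norm (fps_nth h (n - i)) else 0))"
      using elim B0 by (intro mult_left_mono sum_mono) (auto simp: norm_mult fps_X_power_mult_nth intro!: mult_right_mono)
    finally show ?case by (simp add: sum_distrib_left mult_ac)
  qed
  then obtain N where N: "norm (fps_nth h n) \<le> (B0 * B) * (\<Sum>i\<in>{1..M}. if i \<le> n then norm (fps_nth h (n - i)) else 0)"
    if "n \<ge> N" for n unfolding eventually_sequentially by blast
  define K where "K = \<bar>B0 * B\<bar>"
  define T where "T = max 1 (K * M)"
  define A where "A = (\<Sum>k<N. norm (fps_nth h k))"
  have T: "T \<ge> 1" "K * M \<le> T" and A: "A \<ge> 0" and K: "K \<ge> 0" by (auto simp: T_def A_def K_def intro: sum_nonneg)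
  have bound: "norm (fps_nth h n) \<le> A * T ^ n" for n
  proof (induction n rule: less_induct)
    case (less n)
    show ?case
    proof (cases "n \<ge> N")
      case False
      have "norm (fps_nth h n) \<le> A" unfolding A_def using False by (intro member_le_sum) auto
      also have "\<dots> \<le> A * T ^ n" using A one_le_power[OF T(1), of n] mult_left_mono[of 1 "T ^ n" A] by simp
      finally show ?thesis .
    next
      case True
      have "norm (fps_nth h n) \<le> (B0 * B) * (\<Sum>i\<in>{1..M}. if i \<le> n then norm (fps_nth h (n - i)) else 0)"
        by (rule N[OF True])
      also have "\<dots> \<le> K * (\<Sum>i\<in>{1..M}. if i \<le> n then norm (fps_nth h (n - i)) else 0)"
        unfolding K_def by (intro mult_right_mono sum_nonneg) auto
      also have "\<dots> \<le> K * (\<Sum>i\<in>{1..M}. A * T ^ (n - 1))"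
      proof (intro mult_left_mono sum_mono K)
        fix i assume i: "i \<in> {1..M}"
        show "(if i \<le> n then norm (fps_nth h (n - i)) else 0) \<le> A * T ^ (n - 1)"
        proof (cases "i \<le> n")
          case True
          have "norm (fps_nth h (n - i)) \<le> A * T ^ (n - i)" using True i by (intro less) auto
          also have "\<dots> \<le> A * T ^ (n - 1)" using T A i by (intro mult_left_mono power_increasing) auto
          finally show ?thesis using True by simp
        qed (use A T in auto)
      qed
      also have "\<dots> = (K * M) * (A * T ^ (n - 1))" by simp
      also have "\<dots> \<le> A * T ^ n"
      proof (cases "n = 0")
        case True
        hence "norm (fps_nth h n) \<le> 0" using N[OF \<open>n \<ge> N\<close>] by (auto simp: sum.neutral)
        show ?thesis
        proof (cases "N = 0")
          case t: True
          hence "A = 0" by (simp add: A_def)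
          thus ?thesis by simp
        next
          case False
          thus ?thesis using \<open>n \<ge> N\<close> True by simp
        qed
      next
        case False
        hence "T ^ n = T * T ^ (n - 1)" by (cases n) auto
        moreover have "(K * M) * (A * T ^ (n - 1)) \<le> T * (A * T ^ (n - 1))"
          using T A by (intro mult_right_mono) auto
        ultimately show ?thesis by (simp add: mult_ac)
      qed
      finally show ?thesis .
    qed
  qed
  have "decays (fps_nth h) (ereal (1 / T))"
  proof (rule decays_bound)
    have "norm (fps_nth h n) * (1 / T) ^ n \<le> A" for n
      using bound[of n] T by (simp add: power_divide field_simps)
    thus "\<forall>\<^sub>F n in sequentially. norm (fps_nth h n) * (1 / T) ^ n \<le> A" by simp
  qed (use T in auto)
  hence "ereal (1 / T) \<le> fps_conv_radius h" by (simp add: decays_iff_fps_conv_radius)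
  moreover have "0 < ereal (1 / T)" using T by simp
  ultimately show ?thesis by order
qed

lemma fps_conv_radius_pos_of_V: "g \<in> V \<Longrightarrow> fps_conv_radius g > 0"
  using annihilated by (intro fps_conv_radius_pos_of_annihilated) (auto elim: eventually_mono)

text \<open>
  Read backwards, with the leading coefficient of \<open>Q\<^sub>n\<close> staying away from zero, the same relation bounds each
  coefficient of \<open>g\<close> by the \<open>M\<close> following ones. If \<open>g\<close> is entire, the coefficients may be weighted with \<open>T\<^sup>n\<close>
  for a large constant \<open>T\<close>; the relation then halves any bound for them, so they all vanish.
\<close>

lemma entire_annihilated_imp_polynomial:
  assumes M: "degree QM = M" and ann: "\<forall>\<^sub>F n in sequentially. fps_nth (fps_of_poly (Q n) * g) n = 0"
    and R: "fps_conv_radius g = \<infinity>"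
  shows "\<forall>\<^sub>F n in sequentially. fps_nth g n = 0"
proof -
  obtain B where B: "\<And>i. \<forall>\<^sub>F n in sequentially. norm (coeff (Q n) i) \<le> B" using coeff_Q_bounded by blast
  have nz: "coeff QM M \<noteq> 0" using QM_nonzero M by auto
  define B0 where "B0 = norm (inverse (coeff QM M)) + 1"
  have B0: "B0 > 0" by (simp add: B0_def add_nonneg_pos)
  have "(\<lambda>n. norm (inverse (coeff (Q n) M))) \<longlonglongrightarrow> norm (inverse (coeff QM M))"
    by (intro tendsto_intros coeff_Q_tendsto nz)
  hence ev1: "\<forall>\<^sub>F n in sequentially. norm (inverse (coeff (Q n) M)) < B0"
    by (rule order_tendstoD) (simp add: B0_def)
  have ev2: "\<forall>\<^sub>F n in sequentially. coeff (Q n) M \<noteq> 0"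
    using tendsto_imp_eventually_ne[OF coeff_Q_tendsto nz] .
  have "\<forall>\<^sub>F n in sequentially. \<forall>i\<in>{..M}. norm (coeff (Q n) i) \<le> B"
    by (intro eventually_ball_finite) (use B in auto)
  hence "\<forall>\<^sub>F n in sequentially. M \<le> n \<longrightarrow> norm (fps_nth g (n - M)) \<le> (B0 * B) * (\<Sum>i<M. norm (fps_nth g (n - i)))"
    using ev1 ev2 ann degree_Q
  proof eventually_elim
    case (elim n)
    show ?case
    proof
      assume n: "M \<le> n"
      have "fps_nth (fps_of_poly (Q n) * g) n = (\<Sum>i\<le>M. coeff (Q n) i * fps_nth (fps_X ^ i * g) n)"
        by (rule fps_nth_poly_mult) (use elim in auto)
      also have "{..M} = insert M {..<M}" by auto
      also have "(\<Sum>i\<in>insert M {..<M}. coeff (Q n) i * fps_nth (fps_X ^ i * g) n) =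
          coeff (Q n) M * fps_nth g (n - M) + (\<Sum>i<M. coeff (Q n) i * fps_nth (fps_X ^ i * g) n)"
        using n by (subst sum.insert) (auto simp: fps_X_power_mult_nth)
      finally have "coeff (Q n) M * fps_nth g (n - M) = - (\<Sum>i<M. coeff (Q n) i * fps_nth (fps_X ^ i * g) n)"
        using elim by (simp add: eq_neg_iff_add_eq_0)
      hence "fps_nth g (n - M) = inverse (coeff (Q n) M) * - (\<Sum>i<M. coeff (Q n) i * fps_nth (fps_X ^ i * g) n)"
        using elim by (simp add: field_simps)
      hence "norm (fps_nth g (n - M)) = norm (inverse (coeff (Q n) M)) * norm (\<Sum>i<M. coeff (Q n) i * fps_nth (fps_X ^ i * g) n)"
        by (simp only: norm_mult norm_minus_cancel)
      also have "\<dots> \<le> B0 * (\<Sum>i<M. norm (coeff (Q n) i * fps_nth (fps_X ^ i * g) n))"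
        using elim B0 by (intro mult_mono norm_sum) auto
      also have "\<dots> \<le> B0 * (\<Sum>i<M. B * norm (fps_nth g (n - i)))"
        using elim B0 n by (intro mult_left_mono sum_mono) (auto simp: norm_mult fps_X_power_mult_nth intro!: mult_right_mono)
      finally show "norm (fps_nth g (n - M)) \<le> (B0 * B) * (\<Sum>i<M. norm (fps_nth g (n - i)))"
        by (simp add: sum_distrib_left mult_ac)
    qed
  qed
  then obtain N where N: "norm (fps_nth g (n - M)) \<le> (B0 * B) * (\<Sum>i<M. norm (fps_nth g (n - i)))"
    if "n \<ge> N" "n \<ge> M" for n unfolding eventually_sequentially by blast
  define K where "K = \<bar>B0 * B\<bar>"
  define T where "T = 2 * K * M + 1"
  have K: "K \<ge> 0" and T: "T \<ge> 1" by (auto simp: K_def T_def)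
  obtain D where D: "norm (fps_nth g n) * T ^ n \<le> D" for n
    using R T decays_iff_fps_conv_radius[of g \<infinity>] unfolding decays_def by fastforce
  have bound: "norm (fps_nth g n) * T ^ n \<le> D / 2 ^ k" if "n \<ge> N" for n k
    using that
  proof (induction k arbitrary: n)
    case 0
    thus ?case using D by simp
  next
    case (Suc k)
    have D0: "0 \<le> D / 2 ^ k" using Suc.IH[OF Suc.prems] T by (meson norm_ge_zero mult_nonneg_nonneg zero_le_power order_trans zero_le_one)
    have "norm (fps_nth g n) \<le> (B0 * B) * (\<Sum>i<M. norm (fps_nth g (n + M - i)))"
      using N[of "n + M"] Suc.prems by simp
    also have "\<dots> \<le> K * (\<Sum>i<M. norm (fps_nth g (n + M - i)))"
      unfolding K_def by (intro mult_right_mono sum_nonneg) auto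
    finally have "norm (fps_nth g n) * T ^ n * T \<le> K * (\<Sum>i<M. norm (fps_nth g (n + M - i))) * T ^ n * T"
      using T by (intro mult_right_mono) auto
    also have "\<dots> = K * (\<Sum>i<M. norm (fps_nth g (n + M - i)) * T ^ Suc n)"
      by (simp add: sum_distrib_left sum_distrib_right mult_ac)
    also have "\<dots> \<le> K * (\<Sum>i<M. D / 2 ^ k)"
    proof (intro mult_left_mono sum_mono K)
      fix i assume i: "i \<in> {..<M}"
      have "norm (fps_nth g (n + M - i)) * T ^ Suc n \<le> norm (fps_nth g (n + M - i)) * T ^ (n + M - i)"
        using i T by (intro mult_left_mono power_increasing) auto
      also have "\<dots> \<le> D / 2 ^ k" by (rule Suc.IH) (use Suc.prems i in auto)
      finally show "norm (fps_nth g (n + M - i)) * T ^ Suc n \<le> D / 2 ^ k" .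
    qed
    also have "\<dots> = (K * M) * (D / 2 ^ k)" by simp
    also have "\<dots> \<le> (T / 2) * (D / 2 ^ k)" using D0 by (intro mult_right_mono) (auto simp: T_def)
    finally have "norm (fps_nth g n) * T ^ n * T \<le> (D / 2 ^ Suc k) * T" by (simp add: field_simps)
    thus ?case by (rule mult_right_le_imp_le) (use T in linarith)
  qed
  have "fps_nth g n = 0" if n: "n \<ge> N" for n
  proof -
    have "(\<lambda>k. D * (1 / 2) ^ k) \<longlonglongrightarrow> 0" by (intro tendsto_mult_right_zero LIMSEQ_power_zero) auto
    hence "norm (fps_nth g n) * T ^ n \<le> 0"
      by (rule LIMSEQ_le_const) (use bound[OF n] in \<open>auto simp: power_divide\<close>)
    hence "norm (fps_nth g n) * T ^ n = 0" using T by (intro antisym) auto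
    thus ?thesis using T by simp
  qed
  thus ?thesis unfolding eventually_sequentially by blast
qed

text \<open>
  \<open>QM g\<close> is analytic in a disk that is larger than the disk of convergence of \<open>g\<close>, hence at \<open>\<xi>\<close>.
\<close>

lemma polar_order_le:
  assumes "g \<in> V" "polar g \<xi> s \<rho>" "\<xi> \<noteq> 0"
  shows "s \<le> Polynomial.order \<xi> QM"
proof (rule ccontr)
  define o' where "o' = Polynomial.order \<xi> QM"
  define u where "u = fps_of_poly ([:-\<xi>, 1:] ^ s) * g"
  assume "\<not> s \<le> Polynomial.order \<xi> QM"
  hence lt: "o' < s" by (simp add: o'_def)
  obtain W where W: "QM = [:-\<xi>, 1:] ^ o' * W" "\<not> [:-\<xi>, 1:] dvd W"
    using order_decomp[OF QM_nonzero, of \<xi>] unfolding o'_def by blast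
  have W\<xi>: "poly W \<xi> \<noteq> 0" using W(2) by (simp add: poly_eq_0_iff_dvd)
  have Rg: "ereal (norm \<xi>) < fps_conv_radius (fps_of_poly QM * g)"
  proof (cases "fps_conv_radius g = \<infinity>")
    case True
    thus ?thesis using fps_conv_radius_poly_mult[of g QM] by simp
  next
    case False
    have "fps_conv_radius g < fps_conv_radius g / ereal l"
      using fps_conv_radius_pos_of_polar(2)[OF assms(2,3)] False by (rule divide_l_gt)
    thus ?thesis using radius_QM_mult_ge_V[OF assms(1)] fps_conv_radius_pos_of_polar(1)[OF assms(2,3)] by order
  qed
  have u: "ereal (norm \<xi>) < fps_conv_radius u" "eval_fps u \<xi> \<noteq> 0"
    using assms(2) by (auto simp: polar_def u_def)
  have "[:-\<xi>, 1:] ^ (s - o') * QM = W * [:-\<xi>, 1:] ^ s"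
  proof -
    have "[:-\<xi>, 1:] ^ (s - o') * QM = W * ([:-\<xi>, 1:] ^ (s - o') * [:-\<xi>, 1:] ^ o')" by (simp add: W(1) mult_ac)
    thus ?thesis using lt by (simp flip: power_add)
  qed
  hence "fps_of_poly ([:-\<xi>, 1:] ^ (s - o')) * (fps_of_poly QM * g) = fps_of_poly W * u"
    unfolding u_def by (simp flip: fps_of_poly_mult mult.assoc)
  hence "poly ([:-\<xi>, 1:] ^ (s - o')) \<xi> * eval_fps (fps_of_poly QM * g) \<xi> = poly W \<xi> * eval_fps u \<xi>"
    using Rg u(1) by (metis eval_fps_poly_mult)
  thus False using lt u(2) W\<xi> by (simp add: poly_power power_0_left)
qed

end

section \<open>Hermite-Pade denominators as annihilators\<close>

lemma poly_combinations_subspace: "fps_subspace (poly_combinations f m)"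
  unfolding fps_subspace_def
proof (intro conjI ballI allI)
  show "0 \<in> poly_combinations f m"
    unfolding poly_combinations_def by (intro CollectI exI[of _ "\<lambda>_. 0"]) auto
  fix g h a assume g: "g \<in> poly_combinations f m" and h: "h \<in> poly_combinations f m"
  obtain p where p: "g = (\<Sum>k\<in>UNIV. fps_of_poly (p k) * f k)" "\<And>k. p k = 0 \<or> degree (p k) < m k"
    using g unfolding poly_combinations_def by blast
  obtain q where q: "h = (\<Sum>k\<in>UNIV. fps_of_poly (q k) * f k)" "\<And>k. q k = 0 \<or> degree (q k) < m k"
    using h unfolding poly_combinations_def by blast
  have "g + fps_const a * h = (\<Sum>k\<in>UNIV. fps_of_poly (p k + smult a (q k)) * f k)"
    by (simp add: p q fps_of_poly_add fps_of_poly_smult sum.distrib sum_distrib_left distrib_right mult.assoc)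
  moreover have "p k + smult a (q k) = 0 \<or> degree (p k + smult a (q k)) < m k" for k
  proof (cases "p k + smult a (q k) = 0")
    case False
    hence "m k > 0" using p(2)[of k] q(2)[of k] by auto
    hence "degree (p k) < m k" "degree (smult a (q k)) < m k"
      using p(2)[of k] q(2)[of k] degree_smult_le[of a "q k"] by auto
    thus ?thesis by (auto intro: degree_add_less)
  qed simp
  ultimately show "g + fps_const a * h \<in> poly_combinations f m"
    unfolding poly_combinations_def by (intro CollectI exI[of _ "\<lambda>k. p k + smult a (q k)"]) auto
qed

lemma X_power_mult_in_poly_combinations:
  assumes "i < m k"
  shows "fps_X ^ i * f k \<in> poly_combinations f m"
proof -
  define p where "p = (\<lambda>j. if j = k then monom (1::complex) i else 0)"
  have "(\<Sum>j\<in>UNIV. fps_of_poly (p j) * f j) = fps_of_poly (p k) * f k"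
    by (rule sum.mono_neutral_cong_right[where S = "{k}", simplified]) (auto simp: p_def)
  hence "(\<Sum>j\<in>UNIV. fps_of_poly (p j) * f j) = fps_X ^ i * f k" by (simp add: p_def fps_of_poly_monom)
  moreover have "p j = 0 \<or> degree (p j) < m j" for j using assms by (auto simp: p_def degree_monom_eq)
  ultimately show ?thesis unfolding poly_combinations_def by (intro CollectI exI[of _ p]) auto
qed

lemma annihilates_poly_combinations:
  assumes "\<And>k i. i < m k \<Longrightarrow> fps_nth (q * (fps_X ^ i * f k)) n = 0" "g \<in> poly_combinations f m"
  shows "fps_nth (q * g) n = 0"
proof -
  obtain p where p: "g = (\<Sum>k\<in>UNIV. fps_of_poly (p k) * f k)" "\<And>k. p k = 0 \<or> degree (p k) < m k"
    using assms(2) unfolding poly_combinations_def by blast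
  have "fps_nth (fps_of_poly (p k) * (q * f k)) n = 0" for k
  proof -
    have "fps_nth (fps_of_poly (p k) * (q * f k)) n = (\<Sum>i\<le>degree (p k). coeff (p k) i * fps_nth (fps_X ^ i * (q * f k)) n)"
      by (rule fps_nth_poly_mult) simp
    also have "\<dots> = 0"
    proof (intro sum.neutral ballI)
      fix i assume "i \<in> {..degree (p k)}"
      hence "p k = 0 \<or> i < m k" using p(2)[of k] by auto
      thus "coeff (p k) i * fps_nth (fps_X ^ i * (q * f k)) n = 0"
        using assms(1)[of i k] by (auto simp: mult.left_commute)
    qed
    finally show ?thesis .
  qed
  thus ?thesis by (simp add: p(1) sum_distrib_left fps_sum_nth mult.left_commute)
qed

lemma hp_solution_nth:
  assumes "hp_solution f m n Q P" "i \<le> n"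
  shows "fps_nth (fps_of_poly Q * f k) i = coeff (P k) i"
  using assms unfolding hp_solution_def by (metis eq_iff_diff_eq_0 fps_of_poly_nth fps_sub_nth)

text \<open>
  The coefficients of \<open>Q f\<^sub>k\<close> with index in \<open>(n - m\<^sub>k, n]\<close> vanish, since they lie above the degree of the
  numerator but below the order of contact. They are the coefficients \<open>[z\<^sup>n](Q z\<^sup>i f\<^sub>k)\<close> for \<open>i < m\<^sub>k\<close>.
\<close>

lemma hp_solution_annihilates:
  assumes sol: "hp_solution f m n Q P" and n: "\<And>k. m k \<le> n" and g: "g \<in> poly_combinations f m"
  shows "fps_nth (fps_of_poly Q * g) n = 0"
proof (rule annihilates_poly_combinations[OF _ g])
  fix k i assume i: "i < m k"
  have "fps_nth (fps_of_poly Q * (fps_X ^ i * f k)) n = fps_nth (fps_X ^ i * (fps_of_poly Q * f k)) n"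
    by (simp add: mult.left_commute)
  also have "\<dots> = coeff (P k) (n - i)"
    using i n[of k] hp_solution_nth[OF sol, of "n - i" k] by (simp add: fps_X_power_mult_nth)
  also have "degree (P k) < n - i" using sol i n[of k] unfolding hp_solution_def
    by (metis diff_less_mono2 le_neq_implies_less le_trans less_le_trans linorder_not_le nat_less_le order_le_less_trans)
  hence "coeff (P k) (n - i) = 0" by (rule coeff_eq_0)
  finally show "fps_nth (fps_of_poly Q * (fps_X ^ i * f k)) n = 0" .
qed

lemma annihilates_imp_hp_solution:
  assumes "Q \<noteq> 0" "degree Q \<le> total_index m" "\<And>k. m k \<le> n"
    and ann: "\<And>g. g \<in> poly_combinations f m \<Longrightarrow> fps_nth (fps_of_poly Q * g) n = 0"
  shows "hp_solution f m n Q (\<lambda>k. truncate_fps (Suc (n - m k)) (fps_of_poly Q * f k))"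
  unfolding hp_solution_def
proof (intro conjI allI impI)
  fix k
  show "degree (truncate_fps (Suc (n - m k)) (fps_of_poly Q * f k)) \<le> n - m k"
    using degree_truncate_fps[of "Suc (n - m k)"] by (simp add: less_Suc_eq_le)
  fix i assume i: "i \<le> n"
  show "fps_nth (fps_of_poly Q * f k - fps_of_poly (truncate_fps (Suc (n - m k)) (fps_of_poly Q * f k))) i = 0"
  proof (cases "i < Suc (n - m k)")
    case False
    hence "n - i < m k" using assms(3)[of k] i by auto
    hence "fps_X ^ (n - i) * f k \<in> poly_combinations f m" by (rule X_power_mult_in_poly_combinations)
    from ann[OF this] have "fps_nth (fps_X ^ (n - i) * (fps_of_poly Q * f k)) n = 0" by (simp add: mult.left_commute)
    moreover have "fps_nth (fps_X ^ (n - i) * (fps_of_poly Q * f k)) n = fps_nth (fps_of_poly Q * f k) i"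
    proof -
      have "n - (n - i) = i" "\<not> n < n - i" using i by simp_all
      thus ?thesis by (simp only: fps_X_power_mult_nth if_False)
    qed
    ultimately have "fps_nth (fps_of_poly Q * f k) i = 0" by simp
    thus ?thesis using False by simp
  qed simp
qed (use assms in auto)

lemma fps_low_coeffs_cancel:
  fixes a b :: "complex fps"
  assumes "\<And>i. i \<le> n \<Longrightarrow> fps_nth (a * b) i = 0" "fps_nth a 0 \<noteq> 0" "i \<le> n"
  shows "fps_nth b i = 0"
proof -
  have "inverse a * a = 1" using assms(2) by (rule inverse_mult_eq_1)
  hence "b = inverse a * (a * b)" by (simp flip: mult.assoc)
  hence "fps_nth b i = (\<Sum>j=0..i. fps_nth (inverse a) j * fps_nth (a * b) (i - j))"
    by (metis fps_mult_nth)
  also have "\<dots> = 0" using assms by (intro sum.neutral) auto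
  finally show ?thesis .
qed

text \<open>
  Linear factors of \<open>Q\<close> can be cancelled one by one, since for each zero of \<open>Q\<close> some numerator does not vanish.
\<close>

lemma reduced_denominator_dvd:
  assumes "Q \<noteq> 0" "\<not> (\<exists>z. poly Q z = 0 \<and> (\<forall>k. poly (P k) z = 0))" "\<And>k. Q dvd P k * Q'"
  shows "Q dvd (Q' :: complex poly)"
  using assms
proof (induction "degree Q" arbitrary: Q Q')
  case 0
  then obtain a where "Q = [:a:]" "a \<noteq> 0" by (metis degree_eq_zeroE pCons_eq_0_iff)
  thus ?case by (simp add: const_poly_dvd_iff dvd_field_iff)
next
  case (Suc n)
  obtain a E where QE: "Q = [:-a, 1:] * E" and E: "E \<noteq> 0" "degree Q = Suc (degree E)"
    using poly_split_root[of Q] Suc.hyps(2) by (metis zero_less_Suc)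
  have root: "poly Q a = 0" using QE by simp
  then obtain k where k: "poly (P k) a \<noteq> 0" using Suc.prems(2) by blast
  have "poly (P k * Q') a = 0" using Suc.prems(3)[of k] root by (metis dvdE mult_zero_left poly_mult)
  hence "poly Q' a = 0" using k by simp
  then obtain Q'' where Q'': "Q' = [:-a, 1:] * Q''" by (metis poly_eq_0_iff_dvd dvdE)
  have "E dvd Q''"
  proof (rule Suc.hyps(1))
    show "E dvd P k * Q''" for k
    proof -
      have "[:-a, 1:] * E dvd [:-a, 1:] * (P k * Q'')"
        using Suc.prems(3)[of k] unfolding QE Q'' by (simp only: mult.left_commute)
      thus ?thesis by (subst (asm) dvd_mult_cancel_left) auto
    qed
    show "\<not> (\<exists>z. poly E z = 0 \<and> (\<forall>k. poly (P k) z = 0))" using Suc.prems(2) QE by auto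
  qed (use E Suc.hyps(2) in auto)
  thus ?case unfolding QE Q'' by (rule mult_dvd_mono[OF dvd_refl])
qed

lemma reduced_form_exists:
  fixes Q' :: "complex poly"
  assumes "Q' \<noteq> 0"
  shows "\<exists>D Q P. Q' = D * Q \<and> (\<forall>k. P' k = D * P k) \<and> lead_coeff Q = 1 \<and> \<not> (\<exists>z. poly Q z = 0 \<and> (\<forall>k. poly (P k) z = 0))"
  using assms
proof (induction "degree Q'" arbitrary: Q' P' rule: less_induct)
  case less
  show ?case
  proof (cases "\<exists>z. poly Q' z = 0 \<and> (\<forall>k. poly (P' k) z = 0)")
    case True
    then obtain z where z: "poly Q' z = 0" "\<And>k. poly (P' k) z = 0" by blast
    obtain E where E: "Q' = [:-z, 1:] * E" using z(1) by (metis poly_eq_0_iff_dvd dvdE)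
    have "\<forall>k. \<exists>p. P' k = [:-z, 1:] * p" using z(2) by (metis poly_eq_0_iff_dvd dvdE)
    then obtain p where p: "\<And>k. P' k = [:-z, 1:] * p k" by metis
    have E0: "E \<noteq> 0" using less.prems E by auto
    hence "degree Q' = Suc (degree E)" unfolding E by (subst degree_mult_eq) auto
    hence "degree E < degree Q'" by simp
    from less.hyps[OF this E0, of p] obtain D Q P where
      *: "E = D * Q" "\<And>k. p k = D * P k" "lead_coeff Q = 1" "\<not> (\<exists>z. poly Q z = 0 \<and> (\<forall>k. poly (P k) z = 0))" by blast
    show ?thesis
      by (rule exI[of _ "[:-z, 1:] * D"], rule exI[of _ Q], rule exI[of _ P])
         (use * E p in \<open>simp only: mult.assoc, blast\<close>)
  next
    case False
    define c where "c = lead_coeff Q'"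
    have c: "c \<noteq> 0" using less.prems by (simp add: c_def)
    show ?thesis
      by (rule exI[of _ "[:c:]"], rule exI[of _ "smult (1 / c) Q'"], rule exI[of _ "\<lambda>k. smult (1 / c) (P' k)"])
         (use c False in \<open>auto simp: c_def\<close>)
  qed
qed

lemma hp_approximant_cofactor:
  assumes "hp_approximant f m n Q P"
  shows "\<exists>D Q' P'. hp_solution f m n Q' P' \<and> Q' = D * Q \<and> (\<forall>k. P' k = D * P k)"
proof -
  obtain Q' P' where *: "lead_coeff Q = 1" "\<not> (\<exists>z. poly Q z = 0 \<and> (\<forall>k. poly (P k) z = 0))"
    "hp_solution f m n Q' P'" "\<And>k. P k * Q' = P' k * Q"
    using assms unfolding hp_approximant_def by blast
  have Q0: "Q \<noteq> 0" using *(1) by auto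
  have "Q dvd Q'" by (rule reduced_denominator_dvd[OF Q0 *(2)]) (simp add: *(4))
  then obtain D where D: "Q' = D * Q" by (metis dvdE mult.commute)
  have "P' k = D * P k" for k
  proof -
    have "(D * P k) * Q = P' k * Q" using *(4)[of k] by (simp add: D mult_ac)
    thus ?thesis using Q0 by simp
  qed
  thus ?thesis using *(3) D by blast
qed

text \<open>
  The reduced representation of a solution is a solution itself unless a power of \<open>z\<close> has been cancelled.
\<close>

lemma hp_solution_divide_cofactor:
  assumes "hp_solution f m n Q' P'" "Q' = D * Q" "\<And>k. P' k = D * P k" "poly D 0 \<noteq> 0"
  shows "hp_solution f m n Q P"
  unfolding hp_solution_def
proof (intro conjI allI impI)
  have Q': "Q' \<noteq> 0" "degree Q' \<le> total_index m" using assms(1) by (auto simp: hp_solution_def)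
  thus Q0: "Q \<noteq> 0" using assms(2) by auto
  have D0: "D \<noteq> 0" using Q' assms(2) by auto
  show "degree Q \<le> total_index m" using Q' Q0 D0 assms(2) by (simp add: degree_mult_eq)
  fix k
  show "degree (P k) \<le> n - m k"
  proof (cases "P k = 0")
    case False
    hence "degree (P' k) = degree D + degree (P k)" using assms(3) D0 by (simp add: degree_mult_eq)
    moreover have "degree (P' k) \<le> n - m k" using assms(1) by (simp add: hp_solution_def)
    ultimately show ?thesis by simp
  qed simp
  fix i assume "i \<le> n"
  show "fps_nth (fps_of_poly Q * f k - fps_of_poly (P k)) i = 0"
  proof (rule fps_low_coeffs_cancel[OF _ _ \<open>i \<le> n\<close>])
    show "fps_nth (fps_of_poly D) 0 \<noteq> 0" using assms(4) by (simp add: poly_0_coeff_0)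
    fix j assume "j \<le> n"
    thus "fps_nth (fps_of_poly D * (fps_of_poly Q * f k - fps_of_poly (P k))) j = 0"
      using assms(1) unfolding hp_solution_def assms(2,3) by (simp add: fps_of_poly_mult algebra_simps)
  qed
qed

lemma hp_approximant_of_solution:
  assumes "hp_solution f m n Q' P'"
  obtains Q P where "hp_approximant f m n Q P" "degree Q \<le> degree Q'"
proof -
  have Q': "Q' \<noteq> 0" using assms by (simp add: hp_solution_def)
  from reduced_form_exists[OF this, of P'] obtain D Q P where
    *: "Q' = D * Q" "\<forall>k. P' k = D * P k" "lead_coeff Q = 1" "\<not> (\<exists>z. poly Q z = 0 \<and> (\<forall>k. poly (P k) z = 0))"
    by blast
  have "degree Q \<le> degree Q'" using Q' *(1) by (auto simp: degree_mult_eq)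
  moreover have "hp_approximant f m n Q P" unfolding hp_approximant_def
    using * assms by (auto simp: mult_ac intro!: exI[of _ Q'] exI[of _ P'])
  ultimately show ?thesis using that by blast
qed

text \<open>
  Poles of higher order than the multiplicity are excluded by \<open>polar_order_le\<close>, the others are realized by
  assumption.
\<close>

lemma system_pole_iff_root:
  assumes "realized_poles (poly_combinations f m) Q QM l C M"
  shows "system_pole f m \<xi> \<tau> \<longleftrightarrow> poly QM \<xi> = 0 \<and> \<tau> = Polynomial.order \<xi> QM"
proof -
  interpret realized_poles "poly_combinations f m" Q QM l C M by fact
  have le: "s \<le> Polynomial.order \<xi> QM" if "g \<in> poly_combinations f m" "single_pole g \<xi> s" "\<xi> \<noteq> 0" for g s
    using single_pole_imp_polar[OF that(2,3)] polar_order_le[OF that(1) _ that(3)] by metis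
  have ex: "\<exists>g\<in>poly_combinations f m. single_pole g \<xi> s" if "poly QM \<xi> = 0" "1 \<le> s" "s \<le> Polynomial.order \<xi> QM" for s
  proof -
    have "\<xi> \<noteq> 0" using that(1) QM_0 by auto
    thus ?thesis using realized[OF that] polar_imp_single_pole that(2) by blast
  qed
  show ?thesis
  proof
    assume sp: "system_pole f m \<xi> \<tau>"
    hence \<xi>: "\<xi> \<noteq> 0" "\<tau> \<ge> 1" by (auto simp: system_pole_def)
    obtain g where "g \<in> poly_combinations f m" "single_pole g \<xi> \<tau>"
      using sp \<xi>(2) unfolding system_pole_def by (meson atLeastAtMost_iff order_refl)
    hence \<tau>: "\<tau> \<le> Polynomial.order \<xi> QM" using le \<xi> by blast
    hence root: "poly QM \<xi> = 0" using \<xi>(2) order_root[of QM \<xi>] by auto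
    moreover have "\<not> \<tau> < Polynomial.order \<xi> QM"
      using sp ex[OF root, of "Polynomial.order \<xi> QM"] \<tau> \<xi>(2) unfolding system_pole_def by force
    ultimately show "poly QM \<xi> = 0 \<and> \<tau> = Polynomial.order \<xi> QM" using \<tau> by simp
  next
    assume *: "poly QM \<xi> = 0 \<and> \<tau> = Polynomial.order \<xi> QM"
    hence "\<xi> \<noteq> 0" using QM_0 by auto
    moreover have "\<tau> \<ge> 1" using * order_root[of QM \<xi>] QM_nonzero by auto
    ultimately show "system_pole f m \<xi> \<tau>"
      unfolding system_pole_def using * ex le by (auto simp: not_le[symmetric])
  qed
qed

lemma system_pole_order_eqI:
  assumes "system_pole f m \<xi> \<tau>"
  shows "system_pole_order f m \<xi> = \<tau>"
  unfolding system_pole_order_def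
proof (rule the_equality)
  show "system_pole f m \<xi> \<tau>" by fact
  fix \<tau>' assume "system_pole f m \<xi> \<tau>'"
  thus "\<tau>' = \<tau>" using assms unfolding system_pole_def by (metis atLeastAtMost_iff le_refl linorder_neqE_nat)
qed

section \<open>Newton expansions at the system poles\<close>

definition node_poly :: "complex list \<Rightarrow> complex poly" where
  "node_poly xs = (\<Prod>x\<leftarrow>xs. [:-x, 1:])"

lemma node_poly_Nil [simp]: "node_poly [] = 1"
  and node_poly_Cons: "node_poly (x # xs) = [:-x, 1:] * node_poly xs"
  and node_poly_append: "node_poly (xs @ ys) = node_poly xs * node_poly ys"
  by (simp_all add: node_poly_def)

lemma node_poly_replicate: "node_poly (replicate s x) = [:-x, 1:] ^ s"
  by (induction s) (simp_all add: node_poly_Cons del: mult_pCons_left)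

lemma poly_node_poly_eq_0_iff: "poly (node_poly xs) z = 0 \<longleftrightarrow> z \<in> set xs"
  by (induction xs) (auto simp: node_poly_Cons)

lemma node_poly_nonzero [simp]: "node_poly xs \<noteq> 0"
  by (induction xs) (auto simp: node_poly_Cons simp del: mult_pCons_left)

lemma degree_node_poly: "degree (node_poly xs) = length xs"
  by (induction xs) (auto simp: node_poly_Cons degree_mult_eq simp del: mult_pCons_left)

lemma order_node_poly: "Polynomial.order z (node_poly xs) = count_list xs z"
proof (induction xs)
  case (Cons x xs)
  have "Polynomial.order z (node_poly (x # xs)) = Polynomial.order z [:-x, 1:] + count_list xs z"
    unfolding node_poly_Cons using Cons by (subst order_mult) (auto simp del: mult_pCons_left)
  moreover have "Polynomial.order z [:-x, 1:] = (if x = z then 1 else 0)"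
    using order_power_n_n[of z 1] by (auto intro: order_0I)
  ultimately show ?case by simp
qed (auto simp: order_0I)

lemma node_poly_mset: "mset xs = mset ys \<Longrightarrow> node_poly xs = node_poly ys"
  unfolding node_poly_def by (metis mset_map prod_mset_prod_list)

lemma splits_into_node_poly:
  fixes p :: "complex poly"
  assumes "p \<noteq> 0"
  shows "\<exists>xs. p = smult (lead_coeff p) (node_poly xs)"
  using assms
proof (induction "degree p" arbitrary: p)
  case 0
  then obtain a where "p = [:a:]" by (metis degree_eq_zeroE)
  thus ?case by (intro exI[of _ "[]"]) simp
next
  case (Suc n)
  obtain \<xi> E where pE: "p = [:-\<xi>, 1:] * E" and E: "E \<noteq> 0" "degree p = Suc (degree E)"
    using poly_split_root[of p] Suc.hyps(2) by (metis zero_less_Suc)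
  obtain xs where xs: "E = smult (lead_coeff E) (node_poly xs)" using Suc.hyps(1)[of E] Suc.hyps(2) E by auto
  have lc: "lead_coeff p = lead_coeff E" unfolding pE by (subst lead_coeff_mult) simp
  have "p = [:-\<xi>, 1:] * smult (lead_coeff E) (node_poly xs)" using pE xs by simp
  also have "\<dots> = smult (lead_coeff p) (node_poly (\<xi> # xs))" by (simp only: lc node_poly_Cons mult_smult_right)
  finally show ?case by blast
qed

text \<open>
  Newton's interpolation formula, with nodes that may be repeated; synthetic division by \<open>z - x\<close> gives the induction
  step.
\<close>

lemma newton_expansion:
  assumes "degree p \<le> length xs"
  shows "\<exists>a. p = (\<Sum>j\<le>length xs. smult (a j) (node_poly (take j xs))) \<and> a (length xs) = coeff p (length xs)"
  using assms
proof (induction xs arbitrary: p)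
  case Nil
  then obtain b where "p = [:b:]" by (metis degree_eq_zeroE le_zero_eq list.size(3))
  thus ?case by (intro exI[of _ "\<lambda>_. b"]) simp
next
  case (Cons x xs)
  have "poly (p - [:poly p x:]) x = 0" by simp
  then obtain q where q: "p - [:poly p x:] = [:-x, 1:] * q" by (metis poly_eq_0_iff_dvd dvdE)
  have degq: "degree q \<le> length xs"
  proof (cases "q = 0")
    case False
    have "degree (p - [:poly p x:]) \<le> length (x # xs)" using Cons.prems by (intro degree_diff_le) auto
    moreover have "degree ([:-x, 1:] * q) = Suc (degree q)" using False by (subst degree_mult_eq) auto
    ultimately show ?thesis using q by simp
  qed simp
  obtain a where a: "q = (\<Sum>j\<le>length xs. smult (a j) (node_poly (take j xs)))" "a (length xs) = coeff q (length xs)"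
    using Cons.IH[OF degq] by blast
  define b where "b = case_nat (poly p x) a"
  have "p = [:poly p x:] + [:-x, 1:] * q" using q by (simp only: algebra_simps) 
  also have "[:-x, 1:] * q = (\<Sum>j\<le>length xs. smult (a j) (node_poly (x # take j xs)))"
    by (subst a(1)) (simp only: sum_distrib_left node_poly_Cons mult_smult_right)
  also have "[:poly p x:] + \<dots> = (\<Sum>j\<le>Suc (length xs). smult (b j) (node_poly (take j (x # xs))))"
    by (subst sum.atMost_Suc_shift) (simp add: b_def)
  finally have *: "p = (\<Sum>j\<le>Suc (length xs). smult (b j) (node_poly (take j (x # xs))))" .
  have "coeff p (Suc (length xs)) = coeff (p - [:poly p x:]) (Suc (length xs))" by simp
  also have "\<dots> = coeff q (length xs) - x * coeff q (Suc (length xs))" unfolding q by simp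
  also have "coeff q (Suc (length xs)) = 0" using degq by (intro coeff_eq_0) simp
  finally have "coeff p (Suc (length xs)) = coeff q (length xs)" by simp
  hence "b (length (x # xs)) = coeff p (length (x # xs))" using a(2) by (simp add: b_def)
  thus ?case using * by (intro exI[of _ b]) simp
qed

text \<open>
  Up to a term of a smaller exponential order, the coefficients of a function with a simple pole at \<open>\<xi>\<close> are those of
  a geometric series.
\<close>

lemma simple_pole_coeff_lower_bound:
  fixes \<xi> :: complex
  assumes h: "h = fps_of_poly [:-\<xi>, 1:] * g" and R: "ereal (norm \<xi>) < fps_conv_radius h"
    and nz: "eval_fps h \<xi> \<noteq> 0" and \<xi>: "\<xi> \<noteq> 0"
  shows "\<exists>c>0. \<forall>\<^sub>F n in sequentially. c \<le> norm (fps_nth g n) * norm \<xi> ^ n"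
proof -
  \<comment> \<open>\<open>w\<close> is the principal part of \<open>g\<close> at \<open>\<xi>\<close>, a multiple of the geometric series.\<close>
  define v where "v = eval_fps h \<xi>"
  define w where "w = Abs_fps (\<lambda>n. - v / \<xi> ^ Suc n)"
  have w: "fps_of_poly [:-\<xi>, 1:] * w = fps_const v"
  proof (rule fps_ext)
    fix n show "fps_nth (fps_of_poly [:-\<xi>, 1:] * w) n = fps_nth (fps_const v) n"
    proof (cases n)
      case (Suc k)
      have "fps_nth (fps_of_poly [:-\<xi>, 1:] * w) n = (\<Sum>i\<le>1. coeff [:-\<xi>, 1:] i * fps_nth (fps_X ^ i * w) n)"
        by (rule fps_nth_poly_mult) simp
      also have "\<dots> = fps_nth w k - \<xi> * fps_nth w n" by (simp add: Suc)
      also have "\<dots> = 0" using \<xi> by (simp add: w_def Suc field_simps)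
      finally show ?thesis by (simp add: Suc)
    qed (use \<xi> in \<open>simp add: w_def\<close>)
  qed
  have eq: "h - fps_const v = fps_of_poly [:-\<xi>, 1:] * (g - w)" by (simp add: h w right_diff_distrib)
  have Rv: "fps_conv_radius h \<le> fps_conv_radius (h - fps_const v)" by (intro fps_conv_radius_diff_ge) auto
  have "fps_conv_radius (h - fps_const v) \<le> fps_conv_radius (g - w)"
    using R Rv by (intro fps_conv_radius_zero_cancel[OF _ _ eq]) (auto simp: eval_fps_diff v_def)
  hence "ereal (norm \<xi>) < fps_conv_radius (g - w)" using R Rv by order
  then obtain t where t: "norm \<xi> < t" "ereal t < fps_conv_radius (g - w)" using ereal_dense2 by force
  have t0: "t > 0" using t(1) \<xi> by (meson order_less_trans zero_less_norm_iff)
  have "decays (fps_nth (g - w)) (fps_conv_radius (g - w))" by (simp add: decays_iff_fps_conv_radius)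
  then obtain D where D: "norm (fps_nth (g - w) n) * t ^ n \<le> D" for n
    using t t0 unfolding decays_def by blast
  define c where "c = norm v / norm \<xi>"
  have c: "c > 0" using nz \<xi> by (simp add: c_def v_def)
  have "(\<lambda>n. D * (norm \<xi> / t) ^ n) \<longlonglongrightarrow> 0"
    using t t0 by (intro tendsto_mult_right_zero LIMSEQ_power_zero) auto
  hence "\<forall>\<^sub>F n in sequentially. D * (norm \<xi> / t) ^ n < c / 2" using c by (intro order_tendstoD) auto
  hence "\<forall>\<^sub>F n in sequentially. c / 2 \<le> norm (fps_nth g n) * norm \<xi> ^ n"
  proof eventually_elim
    case (elim n)
    have "norm (fps_nth w n) * norm \<xi> ^ n = c"
      using \<xi> by (simp add: w_def c_def norm_divide norm_mult norm_power)
    moreover have "norm (fps_nth (g - w) n) * norm \<xi> ^ n \<le> D * (norm \<xi> / t) ^ n"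
      using mult_right_mono[OF D[of n], of "(norm \<xi> / t) ^ n"] t0 by (simp add: power_divide)
    moreover have "norm (fps_nth w n) \<le> norm (fps_nth g n) + norm (fps_nth (g - w) n)"
      using norm_triangle_ineq4[of "fps_nth g n" "fps_nth (g - w) n"] by simp
    hence "norm (fps_nth w n) * norm \<xi> ^ n \<le> (norm (fps_nth g n) + norm (fps_nth (g - w) n)) * norm \<xi> ^ n"
      by (intro mult_right_mono) auto
    ultimately show ?case using elim by (simp add: distrib_right)
  qed
  thus ?thesis using c by (intro exI[of _ "c / 2"]) auto
qed

text \<open>
  Let \<open>N\<^sub>j\<close> be the Newton basis polynomials and let \<open>g\<close> have a pole at the \<open>i\<close>-th node \<open>z\<close> whose order
  counts the occurrences of \<open>z\<close> among the nodes up to the \<open>i\<close>-th. Then \<open>N\<^sub>i g\<close> has a simple pole at \<open>z\<close>,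
  so its coefficients are at least of size \<open>|z|\<^sup>-\<^sup>n\<close>. The products \<open>N\<^sub>j g\<close> with \<open>j > i\<close> are analytic at \<open>z\<close>
  and have smaller coefficients, while those with \<open>j < i\<close> have coefficients of almost the same size
  but come with small factors \<open>a\<^sub>j\<close> by the induction hypothesis. Solving \<open>[z\<^sup>n](\<Sum>\<^sub>j a\<^sub>j N\<^sub>j g) = 0\<close> for \<open>a\<^sub>i\<close>
  shows that \<open>a\<^sub>i\<close> is small.
\<close>

lemma newton_coefficient_bound:
  assumes i: "i < length xs" and \<xi>: "xs ! i \<noteq> 0"
    and g: "g \<in> V" "polar g (xs ! i) (Suc (count_list (take i xs) (xs ! i))) \<rho>"
    and l: "0 < l" "l < 1"
    and IH: "\<forall>\<^sub>F n in sequentially. \<forall>a B. (\<forall>j\<le>length xs. norm (a j) \<le> B) \<and>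
       (\<forall>g\<in>V. fps_nth (fps_of_poly (\<Sum>j\<le>length xs. smult (a j) (node_poly (take j xs))) * g) n = 0) \<longrightarrow>
       (\<forall>j<i. norm (a j) \<le> C * l ^ n * B)"
  shows "\<exists>C l. 0 < l \<and> l < 1 \<and> (\<forall>\<^sub>F n in sequentially. \<forall>a B. (\<forall>j\<le>length xs. norm (a j) \<le> B) \<and>
       (\<forall>g\<in>V. fps_nth (fps_of_poly (\<Sum>j\<le>length xs. smult (a j) (node_poly (take j xs))) * g) n = 0) \<longrightarrow>
       norm (a i) \<le> C * l ^ n * B)"
proof -
  define z where "z = xs ! i"
  define M where "M = length xs"
  define s where "s = Suc (count_list (take i xs) z)"
  define N where "N = (\<lambda>j. node_poly (take j xs))"
  define y where "y = (\<lambda>j. fps_of_poly (N j) * g)"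
  define u where "u = fps_of_poly ([:-z, 1:] ^ s) * g"
  have z: "z \<noteq> 0" and nz: "norm z > 0" using \<xi> by (auto simp: z_def)
  have u: "ereal (norm z) < \<rho>" "\<rho> \<le> fps_conv_radius u" "eval_fps u z \<noteq> 0"
    using g(2) by (auto simp: polar_def z_def s_def u_def)
  have Rg: "ereal (norm z) \<le> fps_conv_radius g" using fps_conv_radius_pos_of_polar(1)[OF g(2) \<xi>] by (simp add: z_def)
  have NSuc: "N (Suc i) = [:-z, 1:] * N i"
    using i unfolding N_def by (simp add: take_Suc_conv_app_nth node_poly_append node_poly_Cons z_def del: mult_pCons_left) (simp add: mult.commute)
  have ordN: "Polynomial.order z (N (Suc i)) = s"
    using i unfolding N_def order_node_poly by (simp add: take_Suc_conv_app_nth z_def s_def)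
  have Nnz: "N j \<noteq> 0" for j by (simp add: N_def)
  obtain W where W: "N (Suc i) = [:-z, 1:] ^ s * W" "\<not> [:-z, 1:] dvd W"
    using order_decomp[OF Nnz[of "Suc i"], of z] unfolding ordN by blast
  have Wz: "poly W z \<noteq> 0" using W(2) by (simp add: poly_eq_0_iff_dvd)
  have yS: "y (Suc i) = fps_of_poly W * u" by (simp add: y_def u_def W(1) fps_of_poly_mult mult_ac)
  have RyS: "\<rho> \<le> fps_conv_radius (y (Suc i))"
    unfolding yS using u(2) fps_conv_radius_poly_mult by (rule order_trans)
  have Ry_gt: "\<rho> \<le> fps_conv_radius (y j)" if "i < j" for j
  proof -
    have "take j xs = take (Suc i) xs @ take (j - Suc i) (drop (Suc i) xs)"
      using that by (metis Suc_leI le_add_diff_inverse take_add)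
    hence "y j = fps_of_poly (node_poly (take (j - Suc i) (drop (Suc i) xs))) * y (Suc i)"
      by (simp add: y_def N_def node_poly_append fps_of_poly_mult mult_ac)
    thus ?thesis using RyS fps_conv_radius_poly_mult by (metis order_trans)
  qed
  have Ry_le: "ereal (norm z) \<le> fps_conv_radius (y j)" for j
    unfolding y_def using Rg fps_conv_radius_poly_mult by (rule order_trans)
  \<comment> \<open>the coefficients of \<open>N i * g\<close> are bounded below, those of all other products are smaller or multiplied by small numbers\<close>
  have "y (Suc i) = fps_of_poly [:-z, 1:] * y i"
    by (simp add: y_def NSuc fps_of_poly_mult mult.assoc del: mult_pCons_left)
  moreover have "ereal (norm z) < fps_conv_radius (y (Suc i))" using u(1) RyS by order
  moreover have "eval_fps (y (Suc i)) z \<noteq> 0"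
    unfolding yS using u Wz by (subst eval_fps_poly_mult) (auto intro: less_le_trans)
  ultimately obtain c where c: "c > 0" "\<forall>\<^sub>F n in sequentially. c \<le> norm (fps_nth (y i) n) * norm z ^ n"
    using simple_pole_coeff_lower_bound[OF _ _ _ z] by blast
  obtain t where t: "norm z < t" "ereal t < \<rho>" using u(1) ereal_dense2 by force
  have t0: "0 < t" using t(1) norm_ge_zero[of z] by linarith
  define \<mu> where "\<mu> = (l + 1) / 2"
  have \<mu>: "l < \<mu>" "0 < \<mu>" "\<mu> < 1" using l by (auto simp: \<mu>_def)
  have "\<exists>D. \<forall>n. norm (fps_nth (y j) n) * (norm z * \<mu>) ^ n \<le> D" for j
  proof -
    have "decays (fps_nth (y j)) (ereal (norm z))" using Ry_le by (simp add: decays_iff_fps_conv_radius)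
    moreover have "0 < norm z * \<mu>" "norm z * \<mu> < norm z" using nz \<mu> by auto
    ultimately show ?thesis unfolding decays_def by (metis less_ereal.simps(1))
  qed
  then obtain D1 where D1: "\<And>j n. norm (fps_nth (y j) n) * (norm z * \<mu>) ^ n \<le> D1 j" by metis
  have "\<exists>D. \<forall>n. norm (fps_nth (y j) n) * t ^ n \<le> D" if "i < j" for j
  proof -
    have "decays (fps_nth (y j)) \<rho>" using Ry_gt[OF that] by (simp add: decays_iff_fps_conv_radius)
    thus ?thesis using t nz unfolding decays_def by (meson order_less_trans)
  qed
  then obtain D2 where D2: "\<And>j n. i < j \<Longrightarrow> norm (fps_nth (y j) n) * t ^ n \<le> D2 j" by metis
  define l' where "l' = max (l / \<mu>) (norm z / t)"
  have l': "0 < l'" "l' < 1" "l / \<mu> \<le> l'" "norm z / t \<le> l'"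
  proof -
    have "norm z / t < 1" using t(1) nz by (subst divide_less_eq_1_pos) linarith+
    thus "l' < 1" using \<mu> unfolding l'_def by simp
    show "0 < l'" using \<mu> l unfolding l'_def by (simp add: less_max_iff_disj)
  qed (auto simp: l'_def)
  have D1pos: "D1 j \<ge> 0" for j
    using order_trans[OF mult_nonneg_nonneg[OF norm_ge_zero zero_le_power] D1[of j 0]] nz \<mu> by auto
  have D2pos: "D2 j \<ge> 0" if "i < j" for j
    using order_trans[OF mult_nonneg_nonneg[OF norm_ge_zero zero_le_power] D2[OF that, of 0]] nz t by auto
  define S1 where "S1 = (\<Sum>j<i. D1 j)"
  define S2 where "S2 = (\<Sum>j\<in>{Suc i..M}. D2 j)"
  define C' where "C' = (\<bar>C\<bar> * S1 + S2) / c"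
  have "\<forall>\<^sub>F n in sequentially. \<forall>a B. (\<forall>j\<le>M. norm (a j) \<le> B) \<and>
       (\<forall>g\<in>V. fps_nth (fps_of_poly (\<Sum>j\<le>M. smult (a j) (N j)) * g) n = 0) \<longrightarrow>
       norm (a i) \<le> C' * l' ^ n * B"
    using IH[folded M_def N_def] c(2)
  proof eventually_elim
    case (elim n)
    show ?case
    proof (intro allI impI)
      fix a :: "nat \<Rightarrow> complex" and B :: real
      assume *: "(\<forall>j\<le>M. norm (a j) \<le> B) \<and> (\<forall>g\<in>V. fps_nth (fps_of_poly (\<Sum>j\<le>M. smult (a j) (N j)) * g) n = 0)"
      have IHn: "\<forall>j<i. norm (a j) \<le> C * l ^ n * B"
        by (rule mp[OF elim(1)[THEN spec, THEN spec, of a B]]) (use * in \<open>simp add: N_def\<close>)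
      have B: "B \<ge> 0" using * by (auto intro: order_trans[OF norm_ge_zero, of "a 0"])
      have "fps_of_poly (\<Sum>j\<le>M. smult (a j) (N j)) * g = (\<Sum>j\<le>M. fps_const (a j) * y j)"
        by (simp add: fps_of_poly_sum fps_of_poly_smult sum_distrib_right y_def mult.assoc)
      hence "fps_nth (fps_of_poly (\<Sum>j\<le>M. smult (a j) (N j)) * g) n = (\<Sum>j\<le>M. a j * fps_nth (y j) n)"
        by (simp only: fps_sum_nth fps_mult_left_const_nth)
      hence "0 = (\<Sum>j\<le>M. a j * fps_nth (y j) n)" using * g(1) by simp
      also have "{..M} = insert i ({..<i} \<union> {Suc i..M})" using i by (auto simp: M_def)
      also have "(\<Sum>j\<in>insert i ({..<i} \<union> {Suc i..M}). a j * fps_nth (y j) n) =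
          a i * fps_nth (y i) n + ((\<Sum>j<i. a j * fps_nth (y j) n) + (\<Sum>j\<in>{Suc i..M}. a j * fps_nth (y j) n))"
        by (subst sum.insert) (auto intro!: sum.union_disjoint)
      finally have "a i * fps_nth (y i) n = - ((\<Sum>j<i. a j * fps_nth (y j) n) + (\<Sum>j\<in>{Suc i..M}. a j * fps_nth (y j) n))"
        by (metis eq_neg_iff_add_eq_0)
      hence "norm (a i) * norm (fps_nth (y i) n) = norm ((\<Sum>j<i. a j * fps_nth (y j) n) + (\<Sum>j\<in>{Suc i..M}. a j * fps_nth (y j) n))"
        by (metis norm_minus_cancel norm_mult)
      also have "\<dots> \<le> (\<Sum>j<i. norm (a j) * norm (fps_nth (y j) n)) + (\<Sum>j\<in>{Suc i..M}. norm (a j) * norm (fps_nth (y j) n))"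
        by (intro order_trans[OF norm_triangle_ineq] add_mono order_trans[OF norm_sum]) (auto simp: norm_mult)
      finally have "norm (a i) * norm (fps_nth (y i) n) * norm z ^ n \<le>
         ((\<Sum>j<i. norm (a j) * norm (fps_nth (y j) n)) + (\<Sum>j\<in>{Suc i..M}. norm (a j) * norm (fps_nth (y j) n))) * norm z ^ n"
        by (intro mult_right_mono) auto
      also have "\<dots> = (\<Sum>j<i. norm (a j) * (norm (fps_nth (y j) n) * norm z ^ n)) + (\<Sum>j\<in>{Suc i..M}. norm (a j) * (norm (fps_nth (y j) n) * norm z ^ n))"
        by (simp add: distrib_right sum_distrib_right mult.assoc)
      also have "\<dots> \<le> (\<Sum>j<i. (\<bar>C\<bar> * l ^ n * B) * (D1 j * (1 / \<mu>) ^ n)) + (\<Sum>j\<in>{Suc i..M}. B * (D2 j * (norm z / t) ^ n))"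
      proof (rule add_mono; rule sum_mono; rule mult_mono)
        fix j assume j: "j \<in> {..<i}"
        have "C * l ^ n * B \<le> \<bar>C\<bar> * l ^ n * B" using l B by (intro mult_right_mono) auto
        thus "norm (a j) \<le> \<bar>C\<bar> * l ^ n * B" using IHn j by force
        show "norm (fps_nth (y j) n) * norm z ^ n \<le> D1 j * (1 / \<mu>) ^ n"
          using mult_right_mono[OF D1[of j n], of "(1 / \<mu>) ^ n"] \<mu> by (simp add: power_divide power_mult_distrib)
      next
        fix j assume j: "j \<in> {Suc i..M}"
        show "norm (a j) \<le> B" using * j by auto
        show "norm (fps_nth (y j) n) * norm z ^ n \<le> D2 j * (norm z / t) ^ n"
          using mult_right_mono[OF D2[of j n], of "(norm z / t) ^ n"] j t nz by (simp add: power_divide)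
      qed (use B l in auto)
      also have "\<dots> = \<bar>C\<bar> * S1 * (l / \<mu>) ^ n * B + S2 * (norm z / t) ^ n * B"
        by (simp add: S1_def S2_def sum_distrib_left sum_distrib_right sum_divide_distrib power_divide mult_ac)
      also have "\<dots> \<le> \<bar>C\<bar> * S1 * l' ^ n * B + S2 * l' ^ n * B"
        using l' l \<mu> t0 B D1pos D2pos
        by (intro add_mono mult_right_mono mult_left_mono power_mono) (auto simp: S1_def S2_def intro!: sum_nonneg mult_nonneg_nonneg)
      also have "\<dots> = (C' * l' ^ n * B) * c" using c(1) by (simp add: C'_def field_simps)
      finally have "norm (a i) * (norm (fps_nth (y i) n) * norm z ^ n) \<le> (C' * l' ^ n * B) * c" by (simp add: mult.assoc)
      moreover have "norm (a i) * c \<le> norm (a i) * (norm (fps_nth (y i) n) * norm z ^ n)"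
        using elim(2) by (intro mult_left_mono) auto
      ultimately have "norm (a i) * c \<le> (C' * l' ^ n * B) * c" by linarith
      thus "norm (a i) \<le> C' * l' ^ n * B" using c(1) by simp
    qed
  qed
  thus ?thesis unfolding M_def N_def using l' by blast
qed

lemma newton_coefficients_bound:
  assumes nodes: "\<And>i. i < length xs \<Longrightarrow> xs ! i \<noteq> 0 \<and> (\<exists>g\<in>V. \<exists>\<rho>. polar g (xs ! i) (Suc (count_list (take i xs) (xs ! i))) \<rho>)"
    and k: "k \<le> length xs"
  shows "\<exists>C l. 0 < l \<and> l < 1 \<and> (\<forall>\<^sub>F n in sequentially. \<forall>a B. (\<forall>j\<le>length xs. norm (a j) \<le> B) \<and>
       (\<forall>g\<in>V. fps_nth (fps_of_poly (\<Sum>j\<le>length xs. smult (a j) (node_poly (take j xs))) * g) n = 0) \<longrightarrow>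
       (\<forall>j<k. norm (a j) \<le> C * l ^ n * B))"
  using k
proof (induction k)
  case 0
  show ?case by (intro exI[of _ 1] exI[of _ "1/2"]) auto
next
  case (Suc i)
  hence i: "i < length xs" by simp
  obtain C l where IH: "0 < l" "l < 1" "\<forall>\<^sub>F n in sequentially. \<forall>a B. (\<forall>j\<le>length xs. norm (a j) \<le> B) \<and>
       (\<forall>g\<in>V. fps_nth (fps_of_poly (\<Sum>j\<le>length xs. smult (a j) (node_poly (take j xs))) * g) n = 0) \<longrightarrow>
       (\<forall>j<i. norm (a j) \<le> C * l ^ n * B)" using Suc by auto
  obtain g \<rho> where g: "xs ! i \<noteq> 0" "g \<in> V" "polar g (xs ! i) (Suc (count_list (take i xs) (xs ! i))) \<rho>"
    using nodes[OF i] by blast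
  obtain C' l' where st: "0 < l'" "l' < 1" "\<forall>\<^sub>F n in sequentially. \<forall>a B. (\<forall>j\<le>length xs. norm (a j) \<le> B) \<and>
       (\<forall>g\<in>V. fps_nth (fps_of_poly (\<Sum>j\<le>length xs. smult (a j) (node_poly (take j xs))) * g) n = 0) \<longrightarrow>
       norm (a i) \<le> C' * l' ^ n * B"
    using newton_coefficient_bound[OF i g IH] by blast
  define C2 l2 where "C2 = max \<bar>C\<bar> \<bar>C'\<bar>" and "l2 = max l l'"
  have mono: "C * l ^ n * B \<le> C2 * l2 ^ n * B" "C' * l' ^ n * B \<le> C2 * l2 ^ n * B" if "B \<ge> 0" for n B
  proof -
    have "l ^ n \<le> l2 ^ n" "l' ^ n \<le> l2 ^ n" using IH(1) st(1) by (auto simp: l2_def intro!: power_mono)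
    moreover have "C \<le> C2" "C' \<le> C2" "0 \<le> C2" by (auto simp: C2_def)
    ultimately show "C * l ^ n * B \<le> C2 * l2 ^ n * B" "C' * l' ^ n * B \<le> C2 * l2 ^ n * B"
      using IH(1) st(1) that
      by (intro mult_right_mono[OF _ that] order_trans[OF mult_right_mono mult_left_mono], simp_all)+
  qed
  have "\<forall>\<^sub>F n in sequentially. \<forall>a B. (\<forall>j\<le>length xs. norm (a j) \<le> B) \<and>
       (\<forall>g\<in>V. fps_nth (fps_of_poly (\<Sum>j\<le>length xs. smult (a j) (node_poly (take j xs))) * g) n = 0) \<longrightarrow>
       (\<forall>j<Suc i. norm (a j) \<le> C2 * l2 ^ n * B)"
    using IH(3) st(3)
  proof eventually_elim
    case (elim n)
    show ?case
    proof (intro allI impI)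
      fix a :: "nat \<Rightarrow> complex" and B :: real and j :: nat
      assume *: "(\<forall>j\<le>length xs. norm (a j) \<le> B) \<and>
       (\<forall>g\<in>V. fps_nth (fps_of_poly (\<Sum>j\<le>length xs. smult (a j) (node_poly (take j xs))) * g) n = 0)" and j: "j < Suc i"
      have "B \<ge> 0" using * by (auto intro: order_trans[OF norm_ge_zero, of "a 0"])
      thus "norm (a j) \<le> C2 * l2 ^ n * B"
        using elim(1)[rule_format, OF *] elim(2)[rule_format, OF *] j mono[of B n]
        by (cases "j = i") (auto simp: less_Suc_eq intro: order_trans)
    qed
  qed
  thus ?case using IH st by (intro exI[of _ C2] exI[of _ l2]) (auto simp: l2_def)
qed

text \<open>
  All Newton coefficients but the leading one are negligible with respect to the largest one, so the largest one is the
  leading one.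
\<close>

lemma annihilating_polynomial_close_to_node_poly:
  assumes nodes: "\<And>i. i < length xs \<Longrightarrow> xs ! i \<noteq> 0 \<and> (\<exists>g\<in>V. \<exists>\<rho>. polar g (xs ! i) (Suc (count_list (take i xs) (xs ! i))) \<rho>)"
  shows "\<exists>C l. 0 < l \<and> l < 1 \<and> (\<forall>\<^sub>F n in sequentially. \<forall>q. q \<noteq> 0 \<and> degree q \<le> length xs \<and>
      (\<forall>g\<in>V. fps_nth (fps_of_poly q * g) n = 0) \<longrightarrow> coeff q (length xs) \<noteq> 0 \<and>
      (\<forall>i. norm (coeff (q - smult (coeff q (length xs)) (node_poly xs)) i) \<le> C * l ^ n * norm (coeff q (length xs))))"
proof -
  define M where "M = length xs"
  define N where "N = (\<lambda>j. node_poly (take j xs))"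
  obtain C l where l: "0 < l" "l < 1" and C: "\<forall>\<^sub>F n in sequentially. \<forall>a B. (\<forall>j\<le>M. norm (a j) \<le> B) \<and>
       (\<forall>g\<in>V. fps_nth (fps_of_poly (\<Sum>j\<le>M. smult (a j) (N j)) * g) n = 0) \<longrightarrow>
       (\<forall>j<M. norm (a j) \<le> C * l ^ n * B)"
    using newton_coefficients_bound[OF nodes order_refl] unfolding M_def N_def by blast
  define K where "K = (\<Sum>j<M. \<Sum>i\<le>M. norm (coeff (N j) i))"
  have K: "norm (coeff (N j) i) \<le> (\<Sum>i\<le>M. norm (coeff (N j) i))" if "j < M" for j i
  proof (cases "i \<le> M")
    case False
    hence "coeff (N j) i = 0" using that by (intro coeff_eq_0) (auto simp: N_def degree_node_poly M_def)
    thus ?thesis by (simp add: sum_nonneg)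
  qed (auto intro!: member_le_sum)
  have "(\<lambda>n. C * l ^ n) \<longlonglongrightarrow> 0" using l by (intro tendsto_mult_right_zero LIMSEQ_power_zero) auto
  hence "\<forall>\<^sub>F n in sequentially. C * l ^ n < 1" by (rule order_tendstoD) simp
  hence "\<forall>\<^sub>F n in sequentially. \<forall>q. q \<noteq> 0 \<and> degree q \<le> M \<and> (\<forall>g\<in>V. fps_nth (fps_of_poly q * g) n = 0) \<longrightarrow>
     coeff q M \<noteq> 0 \<and> (\<forall>i. norm (coeff (q - smult (coeff q M) (node_poly xs)) i) \<le> (C * K) * l ^ n * norm (coeff q M))"
    using C
  proof eventually_elim
    case (elim n)
    show ?case
    proof (rule allI, rule impI)
      fix q assume q: "q \<noteq> 0 \<and> degree q \<le> M \<and> (\<forall>g\<in>V. fps_nth (fps_of_poly q * g) n = 0)"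
      obtain a where a: "q = (\<Sum>j\<le>M. smult (a j) (N j))" "a M = coeff q M"
        using newton_expansion[of q xs] q unfolding M_def N_def by blast
      define B where "B = Max ((\<lambda>j. norm (a j)) ` {..M})"
      have le: "norm (a j) \<le> B" if "j \<le> M" for j unfolding B_def using that by (intro Max_ge) auto
      have bd: "\<forall>j<M. norm (a j) \<le> C * l ^ n * B"
        by (rule mp[OF elim(2)[THEN spec, THEN spec, of a B]]) (use le q in \<open>simp flip: a(1)\<close>)
      have "B \<in> (\<lambda>j. norm (a j)) ` {..M}" unfolding B_def by (rule Max_in) auto
      then obtain j where j: "j \<le> M" "B = norm (a j)" by auto
      have "B \<noteq> 0"
      proof
        assume "B = 0"
        hence "a j = 0" if "j \<le> M" for j using le[OF that] by simp
        hence "q = 0" unfolding a(1) by (intro sum.neutral) auto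
        thus False using q by simp
      qed
      hence B: "B > 0" using j by simp
      \<comment> \<open>the largest Newton coefficient can only be the leading one\<close>
      have "j = M"
      proof (rule ccontr)
        assume "j \<noteq> M"
        hence "B \<le> C * l ^ n * B" using bd j by simp
        thus False using elim(1) B by simp
      qed
      hence BM: "B = norm (coeff q M)" using j a(2) by simp
      have "node_poly xs = N M" by (simp add: N_def M_def)
      moreover have "q = (\<Sum>j<M. smult (a j) (N j)) + smult (a M) (N M)"
        by (subst a(1)) (simp add: lessThan_Suc_atMost[symmetric])
      ultimately have "q = (\<Sum>j<M. smult (a j) (N j)) + smult (coeff q M) (node_poly xs)"
        using a(2) by metis
      hence diff: "q - smult (coeff q M) (node_poly xs) = (\<Sum>j<M. smult (a j) (N j))"
        by (metis add_diff_cancel_right')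
      have "norm (coeff (q - smult (coeff q M) (node_poly xs)) i) \<le> (C * K) * l ^ n * norm (coeff q M)" for i
      proof -
        have "norm (coeff (q - smult (coeff q M) (node_poly xs)) i) \<le> (\<Sum>j<M. norm (a j) * norm (coeff (N j) i))"
          unfolding diff coeff_sum coeff_smult by (intro order_trans[OF norm_sum]) (simp add: norm_mult)
        also have "\<dots> \<le> (\<Sum>j<M. (C * l ^ n * B) * (\<Sum>i\<le>M. norm (coeff (N j) i)))"
        proof (intro sum_mono mult_mono)
          fix j assume "j \<in> {..<M}"
          thus "norm (a j) \<le> C * l ^ n * B" "norm (coeff (N j) i) \<le> (\<Sum>i\<le>M. norm (coeff (N j) i))"
            using bd K by auto
          thus "0 \<le> C * l ^ n * B" by (meson norm_ge_zero order_trans)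
        qed auto
        also have "\<dots> = (C * K) * l ^ n * norm (coeff q M)"
          by (simp add: K_def BM sum_distrib_left sum_distrib_right mult_ac)
        finally show ?thesis .
      qed
      thus "coeff q M \<noteq> 0 \<and> (\<forall>i. norm (coeff (q - smult (coeff q M) (node_poly xs)) i) \<le> (C * K) * l ^ n * norm (coeff q M))"
        using BM B by auto
    qed
  qed
  thus ?thesis using l unfolding M_def by blast
qed

lemma count_list_replicate: "count_list (replicate n x) y = (if x = y then n else 0)"
  by (induction n) auto

lemma count_list_concat_replicate:
  assumes "distinct ys"
  shows "count_list (concat (map (\<lambda>x. replicate (t x) x) ys)) z = (if z \<in> set ys then t z else 0)"
  using assms by (induction ys) (auto simp: count_list_0_iff count_list_replicate)

lemma length_concat_replicate:
  assumes "distinct ys"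
  shows "length (concat (map (\<lambda>x. replicate (t x) x) ys)) = sum t (set ys)"
  using assms by (induction ys) auto

text \<open>
  Listing every system pole according to its order gives \<open>|m|\<close> nodes. For large \<open>n\<close>, every solution has
  a denominator of degree exactly \<open>|m|\<close> that does not vanish at \<open>0\<close>. In particular no power of \<open>z\<close> is cancelled in
  passing to the reduced representation, and \<open>Q\<^sub>n\<close> is the denominator of a solution.
\<close>

lemma system_poles_imp_realized_poles:
  assumes approximants: "\<And>n. n \<ge> Max (range m) \<Longrightarrow> hp_approximant f m n (Q n) (P n)"
    and fin: "finite (system_poles f m)"
    and total: "(\<Sum>\<xi>\<in>system_poles f m. system_pole_order f m \<xi>) = total_index m"
  shows "\<exists>QM l C. realized_poles (poly_combinations f m) Q QM l C (total_index m) \<and>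
           (\<forall>\<^sub>F n in sequentially. hp_solution f m n (Q n) (P n))"
proof -
  define V where "V = poly_combinations f m"
  define M where "M = total_index m"
  define t where "t = system_pole_order f m"
  have t: "system_pole f m z (t z)" if "z \<in> system_poles f m" for z
    using that system_pole_order_eqI unfolding system_poles_def t_def by blast
  obtain ys where ys: "distinct ys" "set ys = system_poles f m" using finite_distinct_list[OF fin] by blast
  define xs where "xs = concat (map (\<lambda>x. replicate (t x) x) ys)"
  have len: "length xs = M" using length_concat_replicate[OF ys(1), of t] ys(2) total by (simp add: xs_def t_def M_def)
  have count: "count_list xs z = (if z \<in> system_poles f m then t z else 0)" for z
    unfolding xs_def using count_list_concat_replicate[OF ys(1)] ys(2) by simp
  have ex_polar: "z \<noteq> 0 \<and> (\<exists>g\<in>V. \<exists>\<rho>. polar g z s \<rho>)" if "1 \<le> s" "s \<le> count_list xs z" for z s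
  proof -
    have z: "z \<in> system_poles f m" "s \<le> t z" using that by (auto simp: count split: if_splits)
    hence "z \<noteq> 0" and "\<exists>g\<in>V. single_pole g z s" using t[OF z(1)] that(1) by (auto simp: system_pole_def V_def)
    thus ?thesis using single_pole_imp_polar by metis
  qed
  have nodes: "xs ! i \<noteq> 0 \<and> (\<exists>g\<in>V. \<exists>\<rho>. polar g (xs ! i) (Suc (count_list (take i xs) (xs ! i))) \<rho>)"
    if "i < length xs" for i
  proof (rule ex_polar)
    have "count_list xs (xs ! i) = count_list (take i xs @ xs ! i # drop (Suc i) xs) (xs ! i)"
      using that by (simp flip: id_take_nth_drop)
    thus "Suc (count_list (take i xs) (xs ! i)) \<le> count_list xs (xs ! i)" by simp
  qed simp
  define QM where "QM = node_poly xs"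
  have QM0: "poly QM 0 \<noteq> 0" unfolding QM_def poly_node_poly_eq_0_iff using nodes by (auto simp: in_set_conv_nth)
  obtain C l where l: "0 < l" "l < 1" and close: "\<forall>\<^sub>F n in sequentially. \<forall>q. q \<noteq> 0 \<and> degree q \<le> M \<and>
      (\<forall>g\<in>V. fps_nth (fps_of_poly q * g) n = 0) \<longrightarrow> coeff q M \<noteq> 0 \<and>
      (\<forall>i. norm (coeff (q - smult (coeff q M) QM) i) \<le> C * l ^ n * norm (coeff q M))"
    using annihilating_polynomial_close_to_node_poly[OF nodes] unfolding len QM_def by blast
  have "(\<lambda>n. C * l ^ n) \<longlonglongrightarrow> 0" using l by (intro tendsto_mult_right_zero LIMSEQ_power_zero) auto
  hence small: "\<forall>\<^sub>F n in sequentially. C * l ^ n < norm (poly QM 0)"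
    using QM0 by (intro order_tendstoD) auto
  have "\<forall>\<^sub>F n in sequentially. hp_solution f m n (Q n) (P n) \<and> degree (Q n) \<le> M \<and>
      (\<forall>g\<in>V. fps_nth (fps_of_poly (Q n) * g) n = 0) \<and> (\<forall>i. norm (coeff (Q n - QM) i) \<le> C * l ^ n)"
    using close small eventually_ge_at_top[of "Max (range m)"]
  proof eventually_elim
    case (elim n)
    have mk: "m k \<le> n" for k
    proof -
      have "m k \<le> Max (range m)" by (rule Max_ge) auto
      thus ?thesis using elim(3) by linarith
    qed
    have approx: "hp_approximant f m n (Q n) (P n)" using approximants elim(3) by blast
    obtain D Q' P' where D: "hp_solution f m n Q' P'" "Q' = D * Q n" "\<And>k. P' k = D * P n k"
      using hp_approximant_cofactor[OF approx] by blast
    have ann: "q \<noteq> 0 \<and> degree q \<le> M \<and> (\<forall>g\<in>V. fps_nth (fps_of_poly q * g) n = 0)"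
      if "hp_solution f m n q p" for q p
      using that hp_solution_annihilates[OF that mk] by (auto simp: hp_solution_def M_def V_def)
    have Q': "coeff Q' M \<noteq> 0" "norm (coeff (Q' - smult (coeff Q' M) QM) 0) \<le> C * l ^ n * norm (coeff Q' M)"
      using elim(1) ann[OF D(1)] by auto
    have "poly Q' 0 \<noteq> 0"
    proof
      assume "poly Q' 0 = 0"
      hence "norm (coeff Q' M) * norm (poly QM 0) \<le> C * l ^ n * norm (coeff Q' M)"
        using Q'(2) by (simp add: poly_0_coeff_0 norm_mult)
      hence "norm (poly QM 0) \<le> C * l ^ n" using Q'(1) by simp
      thus False using elim(2) by simp
    qed
    hence "poly D 0 \<noteq> 0" using D(2) by auto
    hence sol: "hp_solution f m n (Q n) (P n)" using hp_solution_divide_cofactor[OF D] by blast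
    have lc: "lead_coeff (Q n) = 1" using approx by (simp add: hp_approximant_def)
    have "coeff (Q n) M \<noteq> 0" using elim(1) ann[OF sol] by blast
    hence "degree (Q n) = M" using ann[OF sol] le_degree by (metis antisym)
    hence "coeff (Q n) M = 1" using lc by simp
    moreover have "\<forall>i. norm (coeff (Q n - smult (coeff (Q n) M) QM) i) \<le> C * l ^ n * norm (coeff (Q n) M)"
      using elim(1) ann[OF sol] by blast
    ultimately show ?case using sol ann[OF sol] by simp
  qed
  hence ev: "\<forall>\<^sub>F n in sequentially. hp_solution f m n (Q n) (P n)" "\<forall>\<^sub>F n in sequentially. degree (Q n) \<le> M"
    "\<forall>\<^sub>F n in sequentially. \<forall>g\<in>V. fps_nth (fps_of_poly (Q n) * g) n = 0"
    "\<And>i. \<forall>\<^sub>F n in sequentially. norm (coeff (Q n - QM) i) \<le> C * l ^ n"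
    by (auto elim: eventually_mono)
  have "realized_poles V Q QM l C M"
  proof
    show "fps_subspace V" unfolding V_def by (rule poly_combinations_subspace)
    show "\<exists>g\<in>V. \<exists>\<rho>. polar g \<xi> s \<rho>" if "poly QM \<xi> = 0" "1 \<le> s" "s \<le> Polynomial.order \<xi> QM" for \<xi> s
      using ex_polar[of s \<xi>] that by (simp add: QM_def order_node_poly)
  qed (use l ev QM0 in auto)
  thus ?thesis using ev(1) unfolding V_def M_def by blast
qed

section \<open>Counting principal parts\<close>

text \<open>
  Gaussian elimination of one unknown per equation.
\<close>

lemma underdetermined_system:
  fixes a :: "'j \<Rightarrow> 'i \<Rightarrow> complex"
  assumes "finite J" "finite I" "card J < card I"
  shows "\<exists>c. (\<exists>i\<in>I. c i \<noteq> 0) \<and> (\<forall>j\<in>J. (\<Sum>i\<in>I. a j i * c i) = 0)"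
  using assms
proof (induction J arbitrary: I a rule: finite_induct)
  case empty
  hence "I \<noteq> {}" by auto
  thus ?case by (intro exI[of _ "\<lambda>_. 1"]) auto
next
  case (insert j0 J)
  show ?case
  proof (cases "\<exists>i\<in>I. a j0 i \<noteq> 0")
    case False
    obtain c where c: "\<exists>i\<in>I. c i \<noteq> 0" "\<forall>j\<in>J. (\<Sum>i\<in>I. a j i * c i) = 0"
      using insert.IH[of I a] insert.prems insert.hyps by auto
    have "(\<Sum>i\<in>I. a j0 i * c i) = 0" using False by (intro sum.neutral) auto
    thus ?thesis using c by blast
  next
    case True
    then obtain i0 where i0: "i0 \<in> I" "a j0 i0 \<noteq> 0" by blast
    define I' where "I' = I - {i0}"
    define b where "b = (\<lambda>j i. a j i - a j i0 * a j0 i / a j0 i0)"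
    have "card J < card I'" using insert i0 by (simp add: I'_def)
    then obtain c where c: "\<exists>i\<in>I'. c i \<noteq> 0" "\<And>j. j \<in> J \<Longrightarrow> (\<Sum>i\<in>I'. b j i * c i) = 0"
      using insert.IH[of I' b] insert.prems by (auto simp: I'_def)
    define x where "x = - (\<Sum>i\<in>I'. a j0 i * c i) / a j0 i0"
    define c' where "c' = c(i0 := x)"
    have split: "(\<Sum>i\<in>I. a j i * c' i) = a j i0 * x + (\<Sum>i\<in>I'. a j i * c i)" for j
    proof -
      have "(\<Sum>i\<in>I. a j i * c' i) = a j i0 * c' i0 + (\<Sum>i\<in>I'. a j i * c' i)"
        unfolding I'_def using insert.prems(1) i0(1) by (rule sum.remove)
      also have "(\<Sum>i\<in>I'. a j i * c' i) = (\<Sum>i\<in>I'. a j i * c i)"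
        by (intro sum.cong) (auto simp: c'_def I'_def)
      finally show ?thesis by (simp add: c'_def)
    qed
    have "(\<Sum>i\<in>I. a j i * c' i) = 0" if "j \<in> J" for j
    proof -
      define r where "r = a j i0 / a j0 i0"
      have "0 = (\<Sum>i\<in>I'. b j i * c i)" using c(2)[OF that] by simp
      also have "\<dots> = (\<Sum>i\<in>I'. a j i * c i - r * (a j0 i * c i))"
        by (intro sum.cong refl) (simp add: b_def r_def left_diff_distrib)
      also have "\<dots> = (\<Sum>i\<in>I'. a j i * c i) - a j i0 * (\<Sum>i\<in>I'. a j0 i * c i) / a j0 i0"
        unfolding sum_subtractf sum_distrib_left[symmetric] by (simp add: r_def)
      finally show ?thesis unfolding split by (simp add: x_def)
    qed
    moreover have "(\<Sum>i\<in>I. a j0 i * c' i) = 0" unfolding split using i0 by (simp add: x_def)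
    moreover have "\<exists>i\<in>I. c' i \<noteq> 0" using c(1) by (auto simp: c'_def I'_def)
    ultimately show ?thesis by blast
  qed
qed

context converging_denominators
begin

context
  fixes xs :: "complex list" and b :: complex
  assumes QM_xs: "QM = smult b (node_poly xs)" and b: "b \<noteq> 0"
    and sorted: "sorted (map norm xs)" and M: "M = length xs"
begin

text \<open>
  The zeros of \<open>QM\<close> are ordered by increasing modulus. An element of \<open>V\<close> has reached stage \<open>i\<close> if the
  first \<open>i\<close> of them have ceased to be poles, up to and including the circle through the last of these \<open>i\<close> zeros.
  Passing from stage \<open>i\<close> to stage \<open>i + 1\<close> is a single linear condition, the vanishing of \<open>stage_value\<close>,
  the leading coefficient of the remaining principal part at the \<open>i\<close>-th zero.
\<close>

definition stage :: "nat \<Rightarrow> complex fps \<Rightarrow> bool" where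
  "stage i g \<longleftrightarrow> g \<in> V \<and> (\<forall>j<i. ereal (norm (xs ! j)) < fps_conv_radius (fps_of_poly (node_poly (drop i xs)) * g))"

lemma node_nonzero: "i < M \<Longrightarrow> xs ! i \<noteq> 0"
  using QM_0 poly_node_poly_eq_0_iff[of xs 0] M by (auto simp: QM_xs in_set_conv_nth)

lemma norm_node_mono: "i \<le> j \<Longrightarrow> j < M \<Longrightarrow> norm (xs ! i) \<le> norm (xs ! j)"
  using sorted_nth_mono[OF sorted, of i j] M by simp

lemma stage_radius_QM:
  assumes "stage i g" "i \<le> M"
  shows "fps_conv_radius (fps_of_poly QM * g) = fps_conv_radius (fps_of_poly (node_poly (drop i xs)) * g)"
proof -
  have "node_poly xs = node_poly (take i xs) * node_poly (drop i xs)" by (simp flip: node_poly_append)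
  hence "fps_of_poly QM * g = fps_of_poly (smult b (node_poly (take i xs))) * (fps_of_poly (node_poly (drop i xs)) * g)"
    by (simp add: QM_xs fps_of_poly_smult fps_of_poly_mult mult.assoc)
  also have "fps_conv_radius \<dots> = fps_conv_radius (fps_of_poly (node_poly (drop i xs)) * g)"
  proof (rule fps_conv_radius_inner_factor_cancel)
    fix z assume "poly (smult b (node_poly (take i xs))) z = 0"
    hence "z \<in> set (take i xs)" using b by (simp add: poly_node_poly_eq_0_iff)
    then obtain j where "j < i" "z = xs ! j" using assms(2) M by (auto simp: in_set_conv_nth)
    thus "ereal (norm z) < fps_conv_radius (fps_of_poly (node_poly (drop i xs)) * g)"
      using assms(1) by (simp add: stage_def)
  qed (use b in auto)
  finally show ?thesis .
qed

text \<open>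
  If the product with the remaining factors had a radius of convergence that does not exceed the modulus of the next zero,
  this radius would be the radius of \<open>g\<close> as well as that of \<open>QM g\<close>, but the latter is larger.
\<close>

lemma stage_radius:
  assumes "stage i g" "i < M"
  shows "ereal (norm (xs ! i)) < fps_conv_radius (fps_of_poly (node_poly (drop i xs)) * g)"
proof (rule ccontr)
  define R where "R = fps_conv_radius (fps_of_poly (node_poly (drop i xs)) * g)"
  assume "\<not> ?thesis"
  hence le: "R \<le> ereal (norm (xs ! i))" by (simp add: R_def)
  have gV: "g \<in> V" using assms(1) by (simp add: stage_def)
  have "min (ereal (norm (xs ! i))) R \<le> fps_conv_radius g"
    unfolding R_def
  proof (rule fps_conv_radius_poly_factor_cancel)
    fix z assume "poly (node_poly (drop i xs)) z = 0"
    hence "z \<in> set (drop i xs)" by (simp add: poly_node_poly_eq_0_iff)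
    then obtain j where "j < length (drop i xs)" "drop i xs ! j = z" unfolding in_set_conv_nth by blast
    hence "i + j < M" "z = xs ! (i + j)" using assms(2) M by auto
    thus "norm (xs ! i) \<le> norm z" using norm_node_mono[of i "i + j"] by simp
  qed (use node_nonzero[OF assms(2)] in auto)
  hence ge: "R \<le> fps_conv_radius g" using le by (simp add: min_def split: if_splits)
  have "fps_conv_radius g \<le> R" unfolding R_def by (rule fps_conv_radius_poly_mult)
  hence eq: "fps_conv_radius g = R" using ge by (rule antisym)
  have "R < R / ereal l" by (rule divide_l_gt) (use eq fps_conv_radius_pos_of_V[OF gV] le in auto)
  moreover have "R / ereal l \<le> R"
    using radius_QM_mult_ge_V[OF gV] stage_radius_QM[OF assms(1)] assms(2) eq by (simp add: R_def)
  ultimately show False by simp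
qed

lemma last_stage_entire:
  assumes "stage M g"
  shows "fps_conv_radius g = \<infinity>"
proof (rule ccontr)
  assume neg: "\<not> ?thesis"
  have gV: "g \<in> V" using assms by (simp add: stage_def)
  have "fps_conv_radius g < fps_conv_radius g / ereal l"
    using fps_conv_radius_pos_of_V[OF gV] neg by (intro divide_l_gt) auto
  moreover have "fps_conv_radius g / ereal l \<le> fps_conv_radius g"
    using radius_QM_mult_ge_V[OF gV] stage_radius_QM[OF assms] M by simp
  ultimately show False by simp
qed

definition stage_value :: "nat \<Rightarrow> complex fps \<Rightarrow> complex" where
  "stage_value i g = eval_fps (fps_of_poly (node_poly (drop i xs)) * g) (xs ! i)"

lemma stage_step:
  assumes g: "stage i g" and v: "stage i v" and i: "i < M"
    and 0: "stage_value i g = a * stage_value i v"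
  shows "stage (Suc i) (g + fps_const (-a) * v)"
proof -
  define z where "z = xs ! i"
  define E where "E = node_poly (drop i xs)"
  define E' where "E' = node_poly (drop (Suc i) xs)"
  define h where "h = g + fps_const (-a) * v"
  have EE': "E = [:-z, 1:] * E'" unfolding E_def E'_def z_def using i M
    by (metis Cons_nth_drop_Suc node_poly_Cons)
  have eqE: "fps_of_poly E * h = fps_of_poly [:-z, 1:] * (fps_of_poly E' * h)"
    by (simp add: EE' fps_of_poly_mult mult.assoc del: mult_pCons_left)
  have R: "ereal (norm z) < fps_conv_radius (fps_of_poly E * g)" "ereal (norm z) < fps_conv_radius (fps_of_poly E * v)"
    using stage_radius[OF g i] stage_radius[OF v i] by (simp_all add: E_def z_def)
  have eqh: "fps_of_poly E * h = fps_of_poly E * g - fps_of_poly [:a:] * (fps_of_poly E * v)"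
    by (simp add: h_def algebra_simps fps_of_poly_const flip: fps_const_neg)
  have Rv: "ereal (norm z) < fps_conv_radius (fps_of_poly [:a:] * (fps_of_poly E * v))"
    using R(2) fps_conv_radius_poly_mult by (rule less_le_trans)
  have "min (fps_conv_radius (fps_of_poly E * g)) (fps_conv_radius (fps_of_poly [:a:] * (fps_of_poly E * v))) \<le> fps_conv_radius (fps_of_poly E * h)"
    unfolding eqh by (rule fps_conv_radius_diff)
  hence Rh: "ereal (norm z) < fps_conv_radius (fps_of_poly E * h)" using R(1) Rv by (auto simp: min_def split: if_splits)
  have "eval_fps (fps_of_poly E * h) z = eval_fps (fps_of_poly E * g) z - eval_fps (fps_of_poly [:a:] * (fps_of_poly E * v)) z"
    unfolding eqh by (rule eval_fps_diff[OF R(1) Rv])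
  also have "\<dots> = 0" using 0 R(2) by (subst eval_fps_poly_mult) (auto simp: stage_value_def E_def z_def)
  finally have "fps_conv_radius (fps_of_poly E * h) \<le> fps_conv_radius (fps_of_poly E' * h)"
    using fps_conv_radius_zero_cancel[OF Rh _ eqE] by blast
  hence "ereal (norm z) < fps_conv_radius (fps_of_poly E' * h)" using Rh by order
  moreover have "ereal (norm (xs ! j)) \<le> ereal (norm z)" if "j < Suc i" for j
    using norm_node_mono[of j i] that i by (simp add: z_def)
  moreover have "h \<in> V" unfolding h_def using g v by (intro fps_subspaceD[OF subspace]) (auto simp: stage_def)
  ultimately show ?thesis unfolding stage_def h_def[symmetric] E'_def[symmetric] by (meson le_less_trans)
qed

text \<open>
  One representative for each stage that has an element with nonzero value suffices to bring every element of \<open>V\<close>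
  to the last stage, where the functions are entire.
\<close>

lemma stage_decomposition:
  assumes v: "\<And>j. j < M \<Longrightarrow> stage j (v j)"
    and v_nz: "\<And>j. j < M \<Longrightarrow> stage_value j (v j) \<noteq> 0 \<or> (\<forall>g. stage j g \<longrightarrow> stage_value j g = 0)"
    and "i \<le> M" "stage i g"
  shows "\<exists>c w. w \<in> V \<and> fps_conv_radius w = \<infinity> \<and>
      g = w + (\<Sum>j\<in>{j\<in>{i..<M}. stage_value j (v j) \<noteq> 0}. fps_const (c j) * v j)"
  using assms(3,4)
proof (induction i arbitrary: g rule: inc_induct)
  case base
  thus ?case using last_stage_entire by (intro exI[of _ "\<lambda>_. 0"] exI[of _ g]) (auto simp: stage_def)
next
  case (step i)
  define J where "J = (\<lambda>i. {j\<in>{i..<M}. stage_value j (v j) \<noteq> 0})"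
  have J_eq: "{j\<in>{i..<M}. stage_value j (v j) \<noteq> 0} = J i" for i by (simp add: J_def)
  note IH = step.IH[unfolded J_eq]
  show ?case
  proof (cases "stage_value i (v i) = 0")
    case True
    hence 0: "stage_value i g = 0" using v_nz[OF step.hyps(2)] step.prems by blast
    have "stage (Suc i) (g + fps_const (-0) * v i)"
      by (rule stage_step[OF step.prems v[OF step.hyps(2)] step.hyps(2)]) (simp add: 0)
    hence "stage (Suc i) g" by simp
    moreover have "J i = J (Suc i)" using True by (auto simp: J_def Suc_le_eq le_less)
    ultimately show ?thesis unfolding J_eq using IH[of g] by simp
  next
    case False
    define a where "a = stage_value i g / stage_value i (v i)"
    have "stage (Suc i) (g + fps_const (-a) * v i)"
      by (rule stage_step[OF step.prems v[OF step.hyps(2)] step.hyps(2)]) (use False in \<open>simp add: a_def\<close>)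
    from IH[OF this] obtain c w where cw: "w \<in> V" "fps_conv_radius w = \<infinity>"
      "g + fps_const (-a) * v i = w + (\<Sum>j\<in>J (Suc i). fps_const (c j) * v j)" by blast
    have J: "J i = insert i (J (Suc i))" "i \<notin> J (Suc i)" "finite (J (Suc i))"
      using False step.hyps by (auto simp: J_def Suc_le_eq le_less)
    have "(\<Sum>j\<in>J (Suc i). fps_const ((c(i := a)) j) * v j) = (\<Sum>j\<in>J (Suc i). fps_const (c j) * v j)"
      using J(2) by (intro sum.cong) auto
    hence "w + (\<Sum>j\<in>J i. fps_const ((c(i := a)) j) * v j) = (g + fps_const (-a) * v i) + fps_const a * v i"
      unfolding J(1) cw(3) using J(2,3) by (subst sum.insert) (auto simp: algebra_simps)
    also have "\<dots> = g" by (simp flip: fps_const_neg)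
    finally show ?thesis unfolding J_eq using cw(1,2) by (intro exI[of _ "c(i := a)"] exI[of _ w]) simp
  qed
qed

text \<open>
  If some stage had no element with nonzero value, fewer than \<open>M\<close> representatives would occur in
  \<open>stage_decomposition\<close>. Since the entire remainders are polynomials, they are annihilated by every
  polynomial of small degree when \<open>n\<close> is large, so annihilating \<open>V\<close> would amount to fewer than \<open>M\<close> linear
  conditions on the \<open>M\<close> coefficients of a polynomial of degree less than \<open>M\<close>.
  The finite set \<open>W\<close> stands for a spanning set of \<open>V\<close>.
\<close>

lemma all_stages_realized:
  assumes W: "finite W" "W \<subseteq> V"
    and gen: "\<And>q n. (\<And>w. w \<in> W \<Longrightarrow> fps_nth (q * w) n = 0) \<Longrightarrow> (\<forall>g\<in>V. fps_nth (q * g) n = 0)"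
    and no_small: "\<forall>\<^sub>F n in sequentially. \<forall>q. q \<noteq> 0 \<and> (\<forall>g\<in>V. fps_nth (fps_of_poly q * g) n = 0) \<longrightarrow> M \<le> degree q"
    and i: "i < M"
  shows "\<exists>g. stage i g \<and> stage_value i g \<noteq> 0"
proof (rule ccontr)
  assume neg: "\<not> ?thesis"
  have "stage j 0" for j using fps_subspace_0[OF subspace] by (simp add: stage_def)
  hence "\<forall>j. \<exists>v. stage j v \<and> (stage_value j v \<noteq> 0 \<or> (\<forall>g. stage j g \<longrightarrow> stage_value j g = 0))" by metis
  then obtain v where v: "\<And>j. stage j (v j)" "\<And>j. stage_value j (v j) \<noteq> 0 \<or> (\<forall>g. stage j g \<longrightarrow> stage_value j g = 0)"
    by metis
  define J where "J = {j\<in>{0..<M}. stage_value j (v j) \<noteq> 0}"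
  have "J \<subseteq> {0..<M} - {i}" using neg v(1) by (auto simp: J_def)
  hence "card J \<le> card ({0..<M} - {i})" by (intro card_mono) auto
  hence cardJ: "card J < card {..<M}" using i by simp
  have finJ: "finite J" by (simp add: J_def)
  have "\<exists>c w. w \<in> V \<and> fps_conv_radius w = \<infinity> \<and> g = w + (\<Sum>j\<in>J. fps_const (c j) * v j)" if "g \<in> W" for g
    unfolding J_def by (rule stage_decomposition) (use v that W in \<open>auto simp: stage_def\<close>)
  then obtain c w where cw: "\<And>g. g \<in> W \<Longrightarrow> w g \<in> V \<and> fps_conv_radius (w g) = \<infinity> \<and> g = w g + (\<Sum>j\<in>J. fps_const (c g j) * v j)"
    by metis
  have degM: "degree QM = M" using b by (simp add: QM_xs degree_node_poly M)
  have "\<forall>\<^sub>F n in sequentially. fps_nth (w g) n = 0" if "g \<in> W" for g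
    using cw[OF that] annihilated by (intro entire_annihilated_imp_polynomial[OF degM]) (auto elim: eventually_mono)
  hence "\<forall>\<^sub>F n in sequentially. \<forall>g\<in>W. fps_nth (w g) n = 0" using W(1) by (intro eventually_ball_finite) auto
  then obtain N where N: "\<And>n g. n \<ge> N \<Longrightarrow> g \<in> W \<Longrightarrow> fps_nth (w g) n = 0"
    unfolding eventually_sequentially by blast
  obtain n where n: "n \<ge> N + M" "\<And>q. q \<noteq> 0 \<Longrightarrow> (\<forall>g\<in>V. fps_nth (fps_of_poly q * g) n = 0) \<Longrightarrow> M \<le> degree q"
    using eventually_conj[OF eventually_ge_at_top[of "N + M"] no_small] by (auto simp: eventually_sequentially)
  \<comment> \<open>fewer conditions than coefficients: a polynomial of degree less than \<open>M\<close> annihilates everything\<close>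
  obtain e where e: "\<exists>k\<in>{..<M}. e k \<noteq> 0" "\<And>j. j \<in> J \<Longrightarrow> (\<Sum>k\<in>{..<M}. fps_nth (fps_X ^ k * v j) n * e k) = 0"
    using underdetermined_system[OF finJ _ cardJ, of "\<lambda>j k. fps_nth (fps_X ^ k * v j) n"] by auto
  define q where "q = (\<Sum>k<M. monom (e k) k)"
  have coeff_q: "coeff q k = (if k < M then e k else 0)" for k
    by (simp add: q_def coeff_sum)
  have q0: "q \<noteq> 0"
  proof
    assume "q = 0"
    hence "e k = 0" if "k < M" for k using coeff_q[of k] that by simp
    thus False using e(1) by auto
  qed
  have degq: "degree q < M"
  proof (rule ccontr)
    assume "\<not> degree q < M"
    hence "lead_coeff q = 0" by (simp add: coeff_q)
    thus False using q0 by simp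
  qed
  have qv: "fps_nth (fps_of_poly q * v j) n = 0" if "j \<in> J" for j
  proof -
    have "fps_nth (fps_of_poly q * v j) n = (\<Sum>k\<le>M - 1. coeff q k * fps_nth (fps_X ^ k * v j) n)"
      by (rule fps_nth_poly_mult) (use degq in simp)
    also have "{..M - 1} = {..<M}" using i by auto
    also have "(\<Sum>k<M. coeff q k * fps_nth (fps_X ^ k * v j) n) = (\<Sum>k<M. fps_nth (fps_X ^ k * v j) n * e k)"
      by (intro sum.cong) (auto simp: coeff_q)
    finally show ?thesis using e(2)[OF that] by simp
  qed
  have "fps_nth (fps_of_poly q * g) n = 0" if g: "g \<in> W" for g
  proof -
    have "fps_nth (fps_of_poly q * w g) n = (\<Sum>k\<le>M. coeff q k * fps_nth (fps_X ^ k * w g) n)"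
      by (rule fps_nth_poly_mult) (use degq in simp)
    also have "\<dots> = 0" using N[OF _ g] n(1) by (intro sum.neutral) (auto simp: fps_X_power_mult_nth)
    finally have "fps_nth (fps_of_poly q * w g) n = 0" .
    moreover have "fps_nth (fps_of_poly q * (\<Sum>j\<in>J. fps_const (c g j) * v j)) n = 0"
      using qv by (simp add: sum_distrib_left fps_sum_nth mult.left_commute[of "fps_of_poly q"] fps_mult_left_const_nth)
    moreover have "g = w g + (\<Sum>j\<in>J. fps_const (c g j) * v j)" using cw[OF g] by blast
    ultimately show ?thesis by (metis (no_types, lifting) add.left_neutral distrib_left fps_add_nth)
  qed
  hence "\<forall>g\<in>V. fps_nth (fps_of_poly q * g) n = 0" by (rule gen)
  from n(2)[OF q0 this] degq show False by simp
qed

end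

text \<open>
  The order of zeros of the same modulus is arbitrary, so \<open>\<xi>\<close> may be taken to be the last one on its circle. The stages
  belonging to \<open>\<xi>\<close> then provide functions without other poles in the closed disk of radius \<open>|\<xi>|\<close>.
\<close>

lemma all_poles_realized:
  assumes W: "finite W" "W \<subseteq> V"
    and gen: "\<And>q n. (\<And>w. w \<in> W \<Longrightarrow> fps_nth (q * w) n = 0) \<Longrightarrow> (\<forall>g\<in>V. fps_nth (q * g) n = 0)"
    and no_small: "\<forall>\<^sub>F n in sequentially. \<forall>q. q \<noteq> 0 \<and> (\<forall>g\<in>V. fps_nth (fps_of_poly q * g) n = 0) \<longrightarrow> M \<le> degree q"
    and M: "degree QM = M" and root: "poly QM \<xi> = 0" and s: "1 \<le> s" "s \<le> Polynomial.order \<xi> QM"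
  shows "\<exists>g\<in>V. \<exists>\<rho>. polar g \<xi> s \<rho>"
proof -
  define b where "b = lead_coeff QM"
  have b: "b \<noteq> 0" using QM_nonzero by (simp add: b_def)
  obtain zs where zs: "QM = smult b (node_poly zs)" using splits_into_node_poly[OF QM_nonzero] by (auto simp: b_def)
  define as where "as = sort_key norm (filter (\<lambda>z. norm z \<le> norm \<xi> \<and> z \<noteq> \<xi>) zs)"
  define bs where "bs = sort_key norm (filter (\<lambda>z. norm z > norm \<xi>) zs)"
  define k where "k = count_list zs \<xi>"
  define xs where "xs = as @ replicate k \<xi> @ bs"
  have "mset xs = mset zs"
  proof (rule multiset_eqI)
    fix z show "count (mset xs) z = count (mset zs) z"
    proof -
      have "replicate k \<xi> = filter (\<lambda>z. z = \<xi>) zs" unfolding k_def by (induction zs) auto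
      hence "mset xs = filter_mset (\<lambda>z. norm z \<le> norm \<xi> \<and> z \<noteq> \<xi>) (mset zs) + filter_mset (\<lambda>z. z = \<xi>) (mset zs) +
          filter_mset (\<lambda>z. norm z > norm \<xi>) (mset zs)"
        by (simp add: xs_def as_def bs_def mset_filter)
      thus ?thesis by auto
    qed
  qed
  hence QM_xs: "QM = smult b (node_poly xs)" using zs node_poly_mset by metis
  have len: "M = length xs" using M b by (simp add: QM_xs degree_node_poly)
  have sorted: "sorted (map norm xs)"
    unfolding xs_def as_def bs_def by (auto simp: sorted_append)
  have "Polynomial.order \<xi> QM = k" using b zs by (simp add: order_smult order_node_poly k_def)
  hence sk: "s \<le> k" using s by simp
  define i where "i = length as + (k - s)"
  have i: "i < M" using sk s unfolding i_def len xs_def by simp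
  have "replicate k \<xi> = replicate (k - s) \<xi> @ replicate s \<xi>" using sk by (simp flip: replicate_add)
  hence drop: "drop i xs = replicate s \<xi> @ bs" by (simp add: xs_def i_def)
  have nth: "xs ! i = \<xi>" using sk s unfolding i_def xs_def nth_append_length_plus by (simp add: nth_append)
  from all_stages_realized[OF QM_xs b sorted len W gen no_small i]
  obtain g where g: "stage xs i g" "stage_value xs i g \<noteq> 0" using QM_xs b sorted len by blast
  define u where "u = fps_of_poly ([:-\<xi>, 1:] ^ s) * g"
  have eq: "fps_of_poly (node_poly (drop i xs)) * g = fps_of_poly (node_poly bs) * u"
    by (simp add: drop node_poly_append node_poly_replicate u_def fps_of_poly_mult mult_ac)
  have R: "ereal (norm \<xi>) < fps_conv_radius (fps_of_poly (node_poly bs) * u)"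
    using stage_radius[OF QM_xs b sorted len g(1) i] unfolding eq nth .
  define r where "r = Min (insert (norm \<xi> + 1) (norm ` set bs))"
  have r: "norm \<xi> < r" unfolding r_def by (auto simp: bs_def)
  have "min (ereal r) (fps_conv_radius (fps_of_poly (node_poly bs) * u)) \<le> fps_conv_radius u"
  proof (rule fps_conv_radius_poly_factor_cancel)
    show "r \<le> norm z" if "poly (node_poly bs) z = 0" for z
      using that unfolding r_def poly_node_poly_eq_0_iff by (intro Min_le) auto
  qed (use r norm_ge_zero[of \<xi>] in linarith)
  moreover have "ereal (norm \<xi>) < min (ereal r) (fps_conv_radius (fps_of_poly (node_poly bs) * u))" using r R by simp
  ultimately have Ru: "ereal (norm \<xi>) < fps_conv_radius u" by order
  have "eval_fps u \<xi> \<noteq> 0"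
    using g(2) Ru unfolding stage_value_def[OF QM_xs b sorted len] eq nth by (auto simp: eval_fps_poly_mult)
  hence "polar g \<xi> s (fps_conv_radius u)" using Ru by (simp add: polar_def u_def)
  moreover have "g \<in> V" using g(1) by (simp add: stage_def[OF QM_xs b sorted len])
  ultimately show ?thesis by blast
qed

end

text \<open>
  Convergence to a polynomial of degree \<open>|m|\<close> forces \<open>Q\<^sub>n\<close> to have degree \<open>|m|\<close>, so nothing has been cancelled and \<open>Q\<^sub>n\<close> is
  the denominator of a solution. A solution of smaller degree would have a reduced representation of smaller
  degree, which uniqueness excludes.
\<close>

lemma convergence_imp_realized_poles:
  fixes f :: "'d::finite \<Rightarrow> complex fps"
  assumes approximants: "\<And>n. n \<ge> Max (range m) \<Longrightarrow> hp_approximant f m n (Q n) (P n)"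
    and unique: "\<forall>\<^sub>F n in sequentially. \<forall>Q' P'. hp_approximant f m n Q' P' \<longrightarrow> Q' = Q n"
    and Qlim: "degree Qlim = total_index m" "poly Qlim 0 \<noteq> 0"
    and lim: "limsup (\<lambda>n. ereal (root n (coeff_norm (Qlim - Q n)))) < 1"
  shows "\<exists>QM l C. realized_poles (poly_combinations f m) Q QM l C (total_index m) \<and>
           (\<forall>\<^sub>F n in sequentially. hp_solution f m n (Q n) (P n))"
proof -
  define V where "V = poly_combinations f m"
  define M where "M = total_index m"
  obtain l0 :: real where l0: "limsup (\<lambda>n. ereal (root n (coeff_norm (Qlim - Q n)))) < ereal l0" "l0 < 1"
    using ereal_dense2[OF lim] by (metis less_ereal.simps(1) one_ereal_def)
  define l where "l = max l0 (1/2)"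
  have l: "0 < l" "l < 1" "l0 \<le> l" using l0 by (auto simp: l_def)
  have coeff_le: "norm (coeff p i) \<le> coeff_norm p" for p i
  proof (cases "i \<le> degree p")
    case True
    thus ?thesis unfolding coeff_norm_def by (intro member_le_sum) auto
  next
    case False
    thus ?thesis by (simp add: coeff_eq_0 coeff_norm_def sum_nonneg)
  qed
  have "\<forall>\<^sub>F n in sequentially. ereal (root n (coeff_norm (Qlim - Q n))) < ereal l0"
    using Limsup_lessD[OF l0(1)] .
  hence ev_norm: "\<forall>\<^sub>F n in sequentially. coeff_norm (Qlim - Q n) \<le> l ^ n"
    using eventually_gt_at_top[of 0]
  proof eventually_elim
    case (elim n)
    have "coeff_norm (Qlim - Q n) \<ge> 0" by (simp add: coeff_norm_def sum_nonneg)
    hence "coeff_norm (Qlim - Q n) = root n (coeff_norm (Qlim - Q n)) ^ n" using elim by simp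
    also have "\<dots> \<le> l ^ n" using elim l \<open>coeff_norm (Qlim - Q n) \<ge> 0\<close> by (intro power_mono) auto
    finally show ?case .
  qed
  have conv: "\<forall>\<^sub>F n in sequentially. \<forall>i. norm (coeff (Q n - Qlim) i) \<le> 1 * l ^ n"
    using ev_norm
  proof eventually_elim
    case (elim n)
    show ?case
    proof
      fix i
      have "norm (coeff (Q n - Qlim) i) = norm (coeff (Qlim - Q n) i)" by (simp add: norm_minus_commute)
      thus "norm (coeff (Q n - Qlim) i) \<le> 1 * l ^ n" using coeff_le[of "Qlim - Q n" i] elim by simp
    qed
  qed
  have "coeff Qlim M \<noteq> 0" using Qlim by (metis M_def leading_coeff_0_iff poly_0)
  moreover have "(\<lambda>n. l ^ n) \<longlonglongrightarrow> 0" using l by (intro LIMSEQ_power_zero) auto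
  ultimately have "\<forall>\<^sub>F n in sequentially. l ^ n < norm (coeff Qlim M)" by (intro order_tendstoD(2)) auto
  hence "\<forall>\<^sub>F n in sequentially. hp_solution f m n (Q n) (P n) \<and> degree (Q n) = M \<and> (\<forall>k. m k \<le> n)"
    using conv eventually_ge_at_top[of "Max (range m)"]
  proof eventually_elim
    case (elim n)
    have mk: "m k \<le> n" for k
    proof -
      have "m k \<le> Max (range m)" by (rule Max_ge) auto
      thus ?thesis using elim(3) by linarith
    qed
    have "coeff (Q n) M \<noteq> 0"
    proof
      assume "coeff (Q n) M = 0"
      hence "norm (coeff (Q n - Qlim) M) = norm (coeff Qlim M)" by simp
      thus False using elim(1) elim(2)[rule_format, of M] by simp
    qed
    hence ge: "M \<le> degree (Q n)" by (rule le_degree)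
    obtain D Q' P' where D: "hp_solution f m n Q' P'" "Q' = D * Q n" "\<And>k. P' k = D * P n k"
      using hp_approximant_cofactor[OF approximants[OF elim(3)]] by blast
    have Q': "Q' \<noteq> 0" "degree Q' \<le> M" using D(1) by (auto simp: hp_solution_def M_def)
    hence "degree Q' = degree D + degree (Q n)" unfolding D(2) by (intro degree_mult_eq) auto
    hence deg: "degree D = 0" "degree (Q n) = M" using ge Q' by auto
    then obtain d where "D = [:d:]" by (metis degree_eq_zeroE)
    hence "poly D 0 \<noteq> 0" using Q' D(2) by auto
    thus ?case using hp_solution_divide_cofactor[OF D] deg mk by blast
  qed
  hence sol: "\<forall>\<^sub>F n in sequentially. hp_solution f m n (Q n) (P n)"
    and deg: "\<forall>\<^sub>F n in sequentially. degree (Q n) = M" and mk: "\<forall>\<^sub>F n in sequentially. \<forall>k. m k \<le> n"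
    by (auto elim: eventually_mono)
  interpret converging_denominators V Q Qlim l 1 M
  proof
    show "fps_subspace V" unfolding V_def by (rule poly_combinations_subspace)
    show "\<forall>\<^sub>F n in sequentially. norm (coeff (Q n - Qlim) i) \<le> 1 * l ^ n" for i
      using conv by (auto elim: eventually_mono)
    show "\<forall>\<^sub>F n in sequentially. degree (Q n) \<le> M" using deg by (auto elim: eventually_mono)
    show "\<forall>\<^sub>F n in sequentially. \<forall>g\<in>V. fps_nth (fps_of_poly (Q n) * g) n = 0"
      using sol mk by eventually_elim (auto simp: V_def intro: hp_solution_annihilates)
  qed (use l Qlim in auto)
  define W where "W = (\<lambda>(k, i). fps_X ^ i * f k) ` (SIGMA k:UNIV. {..<m k})"
  have "realized_poles V Q Qlim l 1 M"
  proof (unfold_locales, rule all_poles_realized)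
    show "finite W" unfolding W_def by auto
    show "W \<subseteq> V" unfolding W_def V_def by (auto intro: X_power_mult_in_poly_combinations)
    show "\<forall>g\<in>V. fps_nth (q * g) n = 0" if "\<And>w. w \<in> W \<Longrightarrow> fps_nth (q * w) n = 0" for q n
    proof
      fix g assume "g \<in> V"
      thus "fps_nth (q * g) n = 0" unfolding V_def
        by (rule annihilates_poly_combinations[rotated]) (rule that, force simp: W_def)
    qed
    show "\<forall>\<^sub>F n in sequentially. \<forall>q. q \<noteq> 0 \<and> (\<forall>g\<in>V. fps_nth (fps_of_poly q * g) n = 0) \<longrightarrow> M \<le> degree q"
      using unique deg mk
    proof eventually_elim
      case (elim n)
      show ?case
      proof (intro allI impI, rule ccontr)
        fix q assume q: "q \<noteq> 0 \<and> (\<forall>g\<in>V. fps_nth (fps_of_poly q * g) n = 0)" and lt: "\<not> M \<le> degree q"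
        obtain P' where "hp_solution f m n q P'"
          using annihilates_imp_hp_solution[of q m n f] q lt elim(3) unfolding V_def M_def by force
        then obtain Q'' P'' where "hp_approximant f m n Q'' P''" "degree Q'' \<le> degree q"
          using hp_approximant_of_solution by blast
        thus False using elim(1,2) lt by auto
      qed
    qed
  qed (use Qlim in \<open>auto simp: M_def\<close>)
  thus ?thesis using sol unfolding V_def M_def by blast
qed

section \<open>Decaying tails and the radius of the system poles\<close>

lemma order_le_imp_dvd:
  fixes A :: "complex poly"
  assumes "A \<noteq> 0" "B \<noteq> 0" "\<And>z. poly A z = 0 \<Longrightarrow> Polynomial.order z A \<le> Polynomial.order z B"
  shows "A dvd B"
  using assms
proof (induction "degree A" arbitrary: A B)
  case 0
  then obtain a where "A = [:a:]" "a \<noteq> 0" by (metis degree_eq_zeroE pCons_eq_0_iff)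
  thus ?case by (simp add: const_poly_dvd_iff dvd_field_iff)
next
  case (Suc n)
  obtain \<xi> E where AE: "A = [:-\<xi>, 1:] * E" and E: "E \<noteq> 0" "degree A = Suc (degree E)"
    using poly_split_root[of A] Suc.hyps(2) by (metis zero_less_Suc)
  have ordlin: "Polynomial.order z [:-\<xi>, 1:] = (if z = \<xi> then 1 else 0)" for z
    using order_power_n_n[of z 1] by (auto intro: order_0I)
  have ordA: "Polynomial.order z A = (if z = \<xi> then 1 else 0) + Polynomial.order z E" for z
    using Suc.prems(1) ordlin unfolding AE by (simp add: order_mult del: mult_pCons_left)
  have "poly A \<xi> = 0" using AE by simp
  hence "1 \<le> Polynomial.order \<xi> B" using Suc.prems(3)[of \<xi>] ordA[of \<xi>] by simp
  hence "poly B \<xi> = 0" using order_root[of B \<xi>] by auto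
  then obtain B' where B': "B = [:-\<xi>, 1:] * B'" by (metis poly_eq_0_iff_dvd dvdE)
  have B'0: "B' \<noteq> 0" using Suc.prems(2) B' by auto
  have ordB: "Polynomial.order z B = (if z = \<xi> then 1 else 0) + Polynomial.order z B'" for z
    using Suc.prems(2) ordlin unfolding B' by (simp add: order_mult del: mult_pCons_left)
  have "E dvd B'"
  proof (rule Suc.hyps(1))
    fix z assume "poly E z = 0"
    hence "poly A z = 0" by (simp add: AE)
    thus "Polynomial.order z E \<le> Polynomial.order z B'" using Suc.prems(3)[of z] ordA[of z] ordB[of z] by simp
  qed (use E Suc.hyps(2) B'0 in auto)
  thus ?case unfolding AE B' by (rule mult_dvd_mono[OF dvd_refl])
qed

lemma fps_conv_radius_dvd:
  assumes "A dvd B"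
  shows "fps_conv_radius (fps_of_poly A * g) \<le> fps_conv_radius (fps_of_poly B * (g :: complex fps))"
proof -
  obtain D where "B = D * A" using assms by (metis dvdE mult.commute)
  thus ?thesis using fps_conv_radius_poly_mult[of "fps_of_poly A * g" D] by (simp add: fps_of_poly_mult mult.assoc)
qed

text \<open>
  The common setting to which both assumptions of the theorem have been reduced.
\<close>

locale hermite_pade_limit = realized_poles "poly_combinations f m" Q QM l C "total_index m"
  for f :: "'d::finite \<Rightarrow> complex fps" and m Q QM l C +
  fixes P :: "nat \<Rightarrow> 'd \<Rightarrow> complex poly"
  assumes solution: "\<forall>\<^sub>F n in sequentially. hp_solution f m n (Q n) (P n)"
begin

text \<open>
  The coefficients of \<open>Q\<^sub>n f\<^sub>k - P\<^sub>n\<^sub>k\<close> at a fixed distance behind the order of contact decay like \<open>\<rho>\<^sup>-\<^sup>n\<close>.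
\<close>

definition tail_decays :: "'d \<Rightarrow> ereal \<Rightarrow> bool" where
  "tail_decays k \<rho> \<longleftrightarrow> (\<forall>c\<ge>1. decays (\<lambda>n. fps_nth (fps_of_poly (Q n) * f k) (n + c)) \<rho>)"

lemma tail_decays_mono: "tail_decays k \<rho> \<Longrightarrow> \<rho>' \<le> \<rho> \<Longrightarrow> tail_decays k \<rho>'"
  unfolding tail_decays_def using decays_mono by blast

lemma tail_decaysI:
  assumes "\<And>r. 0 < r \<Longrightarrow> ereal r < \<rho> \<Longrightarrow> tail_decays k (ereal r)"
  shows "tail_decays k \<rho>"
  unfolding tail_decays_def decays_def
proof (intro allI impI)
  fix c r assume c: "1 \<le> (c::nat)" and r: "0 < r \<and> ereal r < \<rho>"
  then obtain r' where r': "r < r'" "ereal r' < \<rho>" using ereal_dense2[of r \<rho>] by auto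
  hence "tail_decays k (ereal r')" using r by (intro assms) auto
  thus "\<exists>C. \<forall>n. norm (fps_nth (fps_of_poly (Q n) * f k) (n + c)) * r ^ n \<le> C"
    using c r r' unfolding tail_decays_def decays_def by auto
qed

lemma system_pole_iff: "system_pole f m \<xi> \<tau> \<longleftrightarrow> poly QM \<xi> = 0 \<and> \<tau> = Polynomial.order \<xi> QM"
  by (rule system_pole_iff_root) unfold_locales

lemma system_poles_eq: "system_poles f m = {\<xi>. poly QM \<xi> = 0}"
  unfolding system_poles_def system_pole_iff by auto

lemma system_pole_order_eq: "poly QM \<xi> = 0 \<Longrightarrow> system_pole_order f m \<xi> = Polynomial.order \<xi> QM"
  by (intro system_pole_order_eqI) (simp add: system_pole_iff)

lemma tail_decays_poly_mult:
  assumes tail: "tail_decays k \<rho>" and deg: "degree q < T"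
  shows "decays (\<lambda>n. fps_nth (fps_of_poly (Q n) * (fps_of_poly q * f k)) (n + T)) \<rho>"
proof -
  have "fps_nth (fps_of_poly (Q n) * (fps_of_poly q * f k)) (n + T) =
      (\<Sum>i\<le>degree q. coeff q i * fps_nth (fps_of_poly (Q n) * f k) (n + (T - i)))" for n
  proof -
    have "fps_nth (fps_of_poly (Q n) * (fps_of_poly q * f k)) (n + T) = fps_nth (fps_of_poly q * (fps_of_poly (Q n) * f k)) (n + T)"
      by (simp add: mult.left_commute)
    also have "\<dots> = (\<Sum>i\<le>degree q. coeff q i * fps_nth (fps_X ^ i * (fps_of_poly (Q n) * f k)) (n + T))"
      by (rule fps_nth_poly_mult) simp
    also have "\<dots> = (\<Sum>i\<le>degree q. coeff q i * fps_nth (fps_of_poly (Q n) * f k) (n + (T - i)))"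
    proof (intro sum.cong refl)
      fix i assume "i \<in> {..degree q}"
      hence "\<not> n + T < i" "n + T - i = n + (T - i)" using deg by auto
      thus "coeff q i * fps_nth (fps_X ^ i * (fps_of_poly (Q n) * f k)) (n + T) = coeff q i * fps_nth (fps_of_poly (Q n) * f k) (n + (T - i))"
        by (simp only: fps_X_power_mult_nth if_False)
    qed
    finally show ?thesis .
  qed
  moreover have "decays (\<lambda>n. \<Sum>i\<le>degree q. coeff q i * fps_nth (fps_of_poly (Q n) * f k) (n + (T - i))) \<rho>"
  proof (intro decays_sum)
    fix i assume "i \<in> {..degree q}"
    hence "1 \<le> T - i" using deg by auto
    hence "decays (\<lambda>n. fps_nth (fps_of_poly (Q n) * f k) (n + (T - i))) \<rho>"
      using tail unfolding tail_decays_def by blast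
    thus "decays (\<lambda>n. coeff q i * fps_nth (fps_of_poly (Q n) * f k) (n + (T - i))) \<rho>"
      by (rule decays_mult_bounded[where C = "norm (coeff q i)"]) simp
  qed
  ultimately show ?thesis by simp
qed

text \<open>
  Each multiplication by \<open>QM\<close> enlarges the radius of convergence by the factor \<open>1/l\<close> until \<open>\<rho>\<close> is reached, as products of \<open>f\<^sub>k\<close>
  with polynomials inherit the decay of the tail.
\<close>

lemma tail_decays_imp_meromorphic:
  assumes tail: "tail_decays k (ereal \<rho>)" and \<rho>: "0 < \<rho>" and R: "0 < fps_conv_radius (f k)"
  shows "\<exists>j. ereal \<rho> \<le> fps_conv_radius (fps_of_poly (QM ^ j) * f k)"
proof -
  obtain r0 where r0: "0 < r0" "ereal r0 < fps_conv_radius (f k)" using ereal_dense2[OF R] by (auto simp: zero_ereal_def)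
  have *: "ereal (min \<rho> (r0 / l ^ j)) \<le> fps_conv_radius (fps_of_poly (QM ^ j) * f k)" for j
  proof (induction j)
    case 0
    show ?case using r0 by (simp add: min_def) (meson dual_order.strict_trans1 ereal_less_eq(3) less_imp_le order_trans)
  next
    case (Suc j)
    define h where "h = fps_of_poly (QM ^ j) * f k"
    have "decays (\<lambda>n. fps_nth (fps_of_poly (Q n) * h) (n + Suc (degree (QM ^ j)))) (ereal \<rho>)"
      unfolding h_def by (rule tail_decays_poly_mult[OF tail]) simp
    from radius_QM_mult_ge[OF this] have 1: "min (ereal \<rho>) (fps_conv_radius h / ereal l) \<le> fps_conv_radius (fps_of_poly QM * h)" .
    have "ereal (min \<rho> (r0 / l ^ j)) / ereal l \<le> fps_conv_radius h / ereal l"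
      using Suc.IH l unfolding h_def by (intro ereal_divide_right_mono) auto
    moreover have "ereal (min \<rho> (r0 / l ^ j)) / ereal l = ereal (min \<rho> (r0 / l ^ j) / l)"
    proof -
      have "ereal x / ereal l = ereal (x / l)" for x using l by simp
      thus ?thesis .
    qed
    moreover have "min \<rho> (r0 / l ^ Suc j) \<le> min \<rho> (r0 / l ^ j) / l"
    proof -
      have "\<rho> \<le> \<rho> / l" using \<rho> l by (simp add: field_simps)
      moreover have "r0 / l ^ Suc j = r0 / l ^ j / l" by (simp add: field_simps)
      ultimately show ?thesis by (auto simp: min_def mult.commute)
    qed
    ultimately have "ereal (min \<rho> (r0 / l ^ Suc j)) \<le> fps_conv_radius h / ereal l"
      by (metis ereal_less_eq(3) order_trans)
    moreover have "ereal (min \<rho> (r0 / l ^ Suc j)) \<le> ereal \<rho>" by simp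
    ultimately have "ereal (min \<rho> (r0 / l ^ Suc j)) \<le> min (ereal \<rho>) (fps_conv_radius h / ereal l)"
      by (rule min.boundedI[rotated])
    hence "ereal (min \<rho> (r0 / l ^ Suc j)) \<le> fps_conv_radius (fps_of_poly QM * h)" using 1 by (rule order_trans)
    thus ?case by (simp add: h_def fps_of_poly_mult mult.assoc)
  qed
  obtain j where "l ^ j < r0 / \<rho>" using real_arch_pow_inv[of "r0 / \<rho>" l] r0 \<rho> l by auto
  hence "\<rho> \<le> r0 / l ^ j" using \<rho> l r0 by (simp add: field_simps)
  thus ?thesis using *[of j] by (auto simp: min_def)
qed

text \<open>
  In the disk defining \<open>R\<^bsub>|m|,k\<^esub>\<close>, the zeros of \<open>QM\<close> compensate the poles of \<open>f\<^sub>k\<close>.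
\<close>

lemma radius_sys_le:
  assumes "0 < fps_conv_radius (f k)"
  shows "radius_sys f m k \<le> fps_conv_radius (fps_of_poly QM * f k)" "radius_sys f m k \<le> mero_radius (f k)"
proof -
  have *: "r \<le> fps_conv_radius (fps_of_poly QM * f k) \<and> r \<le> mero_radius (f k)"
    if "r \<in> insert 0 {r. \<exists>F. mero_extends (f k) F r \<and>
     (\<forall>z\<in>eball 0 r. is_pole F z \<longrightarrow> z \<in> system_poles f m \<and> pole_order F z \<le> system_pole_order f m z)}" for r
  proof (cases "r = 0")
    case True
    have "0 \<le> fps_conv_radius (fps_of_poly QM * f k)" using assms fps_conv_radius_poly_mult by (meson order_less_imp_le order_trans)
    moreover have "0 \<le> mero_radius (f k)" unfolding mero_radius_def by (intro Sup_upper) auto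
    ultimately show ?thesis using True by simp
  next
    case False
    hence "\<exists>F. mero_extends (f k) F r \<and>
     (\<forall>z\<in>eball 0 r. is_pole F z \<longrightarrow> z \<in> system_poles f m \<and> pole_order F z \<le> system_pole_order f m z)"
      using that by blast
    then obtain F where F: "mero_extends (f k) F r"
      "\<And>z. z \<in> eball 0 r \<Longrightarrow> is_pole F z \<Longrightarrow> z \<in> system_poles f m \<and> pole_order F z \<le> system_pole_order f m z"
      by blast
    have "r \<le> fps_conv_radius (fps_of_poly QM * f k)"
    proof (rule fps_conv_radius_of_bounded_poles)
      show "pole_order F z \<le> Polynomial.order z QM" if "z \<in> eball 0 r" "is_pole F z" for z
        using F(2)[OF that] system_pole_order_eq[of z] by (auto simp: system_poles_eq)
    qed (use F(1) QM_nonzero in \<open>auto simp: mero_extends_def\<close>)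
    thus ?thesis using mero_extends_le_mero_radius[OF F(1)] by simp
  qed
  show "radius_sys f m k \<le> fps_conv_radius (fps_of_poly QM * f k)"
    unfolding radius_sys_def by (rule Sup_least) (rule *[THEN conjunct1])
  show "radius_sys f m k \<le> mero_radius (f k)"
    unfolding radius_sys_def by (rule Sup_least) (rule *[THEN conjunct2])
qed

lemma mero_ext_facts:
  assumes "0 < fps_conv_radius (f k)"
  shows "mero_ext (f k) has_fps_expansion f k" "mero_ext (f k) meromorphic_on eball 0 (mero_radius (f k))"
    "r \<le> mero_radius (f k) \<Longrightarrow> mero_ext (f k) meromorphic_on eball 0 r"
proof -
  show 1: "mero_ext (f k) has_fps_expansion f k" by (rule mero_ext_correct(1)[OF assms])
  show 2: "mero_ext (f k) meromorphic_on eball 0 (mero_radius (f k))"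
    using mero_ext_correct(2)[OF assms] by (simp add: nicely_meromorphic_on_def)
  show "mero_ext (f k) meromorphic_on eball 0 r" if "r \<le> mero_radius (f k)"
    by (rule meromorphic_on_subset[OF 2]) (use that in \<open>auto intro: less_le_trans\<close>)
qed

lemma sys_radius1_ge:
  assumes "g \<in> poly_combinations f m" "polar g \<xi> s r" "1 \<le> s" "\<xi> \<noteq> 0"
  shows "r \<le> sys_radius1 f m \<xi> s"
proof -
  have "single_pole g \<xi> s" "r \<le> radius_poles s g"
    using polar_imp_single_pole polar_imp_radius_poles assms by auto
  thus ?thesis unfolding sys_radius1_def using assms(1) by (auto intro: Sup_upper2)
qed

text \<open>
  Poles of \<open>f\<^sub>k\<close> in the disk of radius \<open>\<rho>\<close> are system poles because \<open>V\<close> contains functions whose only singularity in this disk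
  is such a pole; the same functions bound the radii attached to these system poles from below. For the poles of \<open>f\<^sub>k\<close> outside this
  disk, the radii are at least as large as their moduli, hence at least \<open>\<rho>\<close>.
\<close>

lemma tail_decays_imp_radius_real:
  assumes tail: "tail_decays k (ereal \<rho>)" and \<rho>: "0 < \<rho>" and R: "0 < fps_conv_radius (f k)"
  shows "ereal \<rho> \<le> fps_conv_radius (fps_of_poly QM * f k)" "ereal \<rho> \<le> radius_sys_star f m k"
proof -
  obtain j where "ereal \<rho> \<le> fps_conv_radius (fps_of_poly (QM ^ j) * f k)"
    using tail_decays_imp_meromorphic[OF assms] by blast
  then obtain A where A: "A \<noteq> 0" "ereal \<rho> \<le> fps_conv_radius (fps_of_poly A * f k)"
    "\<And>\<xi>. poly A \<xi> = 0 \<Longrightarrow> \<xi> \<noteq> 0 \<and> ereal (norm \<xi>) < ereal \<rho> \<and> eval_fps (fps_of_poly A * f k) \<xi> \<noteq> 0"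
    using minimal_denominator[of "QM ^ j" "ereal \<rho>" "f k"] QM_nonzero R \<rho> by (metis ereal_less(2) power_not_zero)
  \<comment> \<open>Multiplying \<open>f k\<close> by a suitable divisor of \<open>A\<close> isolates one pole with a prescribed order; the
    decay of the tail then moves this pole into the space of polynomial combinations.\<close>
  have polar: "\<exists>g\<in>poly_combinations f m. polar g \<xi> s (ereal \<rho>)"
    if root: "poly A \<xi> = 0" and s: "1 \<le> s" "s \<le> Polynomial.order \<xi> A" for \<xi> s
  proof -
    note \<xi> = A(3)[OF root]
    have "[:-\<xi>, 1:] ^ s dvd A" using s A(1) by (simp add: order_divides)
    then obtain q where q: "A = [:-\<xi>, 1:] ^ s * q" by (metis dvdE)
    define T where "T = Suc (degree A)"
    have "q dvd A" unfolding q by simp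
    hence "degree q < T" using A(1) unfolding T_def by (intro le_imp_less_Suc dvd_imp_degree_le) auto
    hence dec: "decays (\<lambda>n. fps_nth (fps_of_poly (Q n) * (fps_of_poly q * f k)) (n + T)) (ereal \<rho>)"
      by (rule tail_decays_poly_mult[OF tail])
    have "0 < fps_conv_radius (fps_of_poly q * f k)" using R fps_conv_radius_poly_mult by (rule less_le_trans)
    from subtract_V_from_decaying[OF dec this] obtain g where
      g: "g \<in> poly_combinations f m" "ereal \<rho> \<le> fps_conv_radius (fps_of_poly q * f k - fps_X ^ T * g)" by blast
    define h where "h = fps_of_poly q * f k - fps_X ^ T * g"
    define u where "u = fps_of_poly ([:-\<xi>, 1:] ^ s) * g"
    have equ: "fps_X ^ T * u = fps_of_poly A * f k - fps_of_poly ([:-\<xi>, 1:] ^ s) * h"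
      by (simp add: u_def h_def q fps_of_poly_mult algebra_simps)
    have Rh: "ereal \<rho> \<le> fps_conv_radius (fps_of_poly ([:-\<xi>, 1:] ^ s) * h)"
      using g(2) fps_conv_radius_poly_mult unfolding h_def by (rule order_trans)
    have "ereal \<rho> \<le> fps_conv_radius (fps_X ^ T * u)"
      unfolding equ using A(2) Rh by (rule fps_conv_radius_diff_ge)
    hence Ru: "ereal \<rho> \<le> fps_conv_radius u" by (simp add: fps_conv_radius_X_power_mult)
    have "eval_fps (fps_X ^ T * u) \<xi> = eval_fps (fps_of_poly A * f k) \<xi> - eval_fps (fps_of_poly ([:-\<xi>, 1:] ^ s) * h) \<xi>"
      unfolding equ using \<xi> A(2) Rh by (intro eval_fps_diff) (auto intro: less_le_trans[of _ "ereal \<rho>"])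
    also have "eval_fps (fps_of_poly ([:-\<xi>, 1:] ^ s) * h) \<xi> = 0"
      using \<xi> g(2) s(1) unfolding h_def[symmetric] by (subst eval_fps_poly_mult) (auto simp: poly_power power_0_left intro: less_le_trans[of _ "ereal \<rho>"])
    finally have "eval_fps (fps_X ^ T * u) \<xi> \<noteq> 0" using \<xi> by simp
    moreover have "eval_fps (fps_X ^ T * u) \<xi> = eval_fps (fps_X ^ T) \<xi> * eval_fps u \<xi>"
      using \<xi> Ru by (intro eval_fps_mult) (auto intro: less_le_trans[of _ "ereal \<rho>"])
    ultimately have "eval_fps u \<xi> \<noteq> 0" by auto
    hence "polar g \<xi> s (ereal \<rho>)" using \<xi> Ru by (simp add: polar_def u_def)
    thus ?thesis using g(1) by blast
  qed
  have ordA: "Polynomial.order \<xi> A \<le> Polynomial.order \<xi> QM" if root: "poly A \<xi> = 0" for \<xi>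
  proof -
    have "1 \<le> Polynomial.order \<xi> A" using root A(1) order_root[of A \<xi>] by auto
    from polar[OF root this order_refl] show ?thesis using polar_order_le A(3)[OF root] by blast
  qed
  have "A dvd QM" by (rule order_le_imp_dvd[OF A(1) QM_nonzero ordA])
  thus "ereal \<rho> \<le> fps_conv_radius (fps_of_poly QM * f k)" using A(2) fps_conv_radius_dvd order_trans by blast
  have poly_A_0: "poly A 0 \<noteq> 0" using A(3)[of 0] by auto
  define F where "F = (\<lambda>z. eval_fps (fps_of_poly A * f k) z / poly A z)"
  have F: "mero_extends (f k) F (ereal \<rho>)" unfolding mero_extends_def F_def
    using quotient_has_fps_expansion[OF poly_A_0 R] quotient_meromorphic[OF A(2)] by blast
  have poles: "poly A z = 0 \<and> pole_order G z \<le> Polynomial.order z A"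
    if G: "mero_extends (f k) G (ereal \<rho>)" and z: "z \<in> eball 0 (ereal \<rho>)" "is_pole G z" for G z
  proof -
    have ev: "\<forall>\<^sub>F w in at z. poly A w * G w = eval_fps (fps_of_poly A * f k) w"
      using G z(1) A(2) by (intro meromorphic_expansion_times_poly) (auto simp: mero_extends_def)
    have an: "eval_fps (fps_of_poly A * f k) analytic_on {z}"
      using z(1) A(2) by (intro analytic_on_eval_fps) (auto intro: less_le_trans[of _ "ereal \<rho>"])
    show ?thesis using pole_order_quotient_le[OF A(1) an ev z(2)] by blast
  qed
  have le_sys: "ereal \<rho> \<le> radius_sys f m k" unfolding radius_sys_def
  proof (intro Sup_upper insertI2 CollectI exI conjI ballI impI)
    fix z assume z: "z \<in> eball 0 (ereal \<rho>)" "is_pole F z"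
    from poles[OF F z] have zA: "poly A z = 0" "pole_order F z \<le> Polynomial.order z A" by auto
    have "Polynomial.order z QM \<noteq> 0" using ordA[OF zA(1)] zA(1) A(1) order_root[of A z] by auto
    hence "poly QM z = 0" using order_root[of QM z] by blast
    thus "z \<in> system_poles f m" "pole_order F z \<le> system_pole_order f m z"
      using zA ordA[OF zA(1)] by (auto simp: system_poles_eq system_pole_order_eq)
  qed (rule F)
  have "ereal \<rho> \<le> sys_radius f m \<xi> (pole_order (mero_ext (f k)) \<xi>)"
    if \<xi>: "\<xi> \<in> eball 0 (radius_sys f m k)" "is_pole (mero_ext (f k)) \<xi>" for \<xi>
  proof -
    define s0 where "s0 = pole_order (mero_ext (f k)) \<xi>"
    have in_mero: "\<xi> \<in> eball 0 (mero_radius (f k))" using \<xi>(1) radius_sys_le(2)[OF R] by (auto intro: less_le_trans)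
    have "1 \<le> s0" unfolding s0_def
      using in_mero by (intro pole_order_pos[OF _ \<xi>(2)] meromorphic_on_isolated_singularity meromorphic_on_subset[OF mero_ext_facts(2)[OF R]]) auto
    moreover have "ereal \<rho> \<le> sys_radius1 f m \<xi> s" if s: "s \<in> {1..s0}" for s
    proof (cases "norm \<xi> < \<rho>")
      case True
      have "ereal \<rho> \<le> mero_radius (f k)" using le_sys radius_sys_le(2)[OF R] by order
      hence "mero_extends (f k) (mero_ext (f k)) (ereal \<rho>)"
        unfolding mero_extends_def using mero_ext_facts(1,3)[OF R] by blast
      from poles[OF this _ \<xi>(2)] True have "poly A \<xi> = 0" "s0 \<le> Polynomial.order \<xi> A" by (auto simp: s0_def)
      thus ?thesis using polar[of \<xi> s] A(3)[of \<xi>] s sys_radius1_ge by fastforce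
    next
      case False
      have ev: "\<forall>\<^sub>F w in at \<xi>. poly QM w * mero_ext (f k) w = eval_fps (fps_of_poly QM * f k) w"
        using \<xi>(1) radius_sys_le[OF R] mero_ext_facts[OF R] by (intro meromorphic_expansion_times_poly[where r = "radius_sys f m k"]) auto
      have an: "eval_fps (fps_of_poly QM * f k) analytic_on {\<xi>}"
        using \<xi>(1) radius_sys_le(1)[OF R] by (intro analytic_on_eval_fps) (auto intro: less_le_trans)
      have root: "poly QM \<xi> = 0" "s0 \<le> Polynomial.order \<xi> QM"
        using pole_order_quotient_le[OF QM_nonzero an ev \<xi>(2)] by (auto simp: s0_def)
      then obtain g r where g: "g \<in> poly_combinations f m" "polar g \<xi> s r" using realized[of \<xi> s] s by auto
      have "ereal \<rho> \<le> r" using g(2) False by (auto simp: polar_def intro: order_trans[of _ "ereal (norm \<xi>)"])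
      also have "r \<le> sys_radius1 f m \<xi> s" using sys_radius1_ge[OF g] s root(1) QM_0 by fastforce
      finally show ?thesis .
    qed
    ultimately show ?thesis unfolding sys_radius_def s0_def[symmetric] by (intro Min.boundedI) auto
  qed
  thus "ereal \<rho> \<le> radius_sys_star f m k" unfolding radius_sys_star_def using le_sys by (auto intro!: INF_greatest)
qed

lemma tail_decays_imp_radius:
  assumes tail: "tail_decays k \<rho>" and R: "0 < fps_conv_radius (f k)"
  shows "\<rho> \<le> fps_conv_radius (fps_of_poly QM * f k)" "0 < \<rho> \<Longrightarrow> \<rho> \<le> radius_sys_star f m k"
proof -
  have *: "ereal r \<le> fps_conv_radius (fps_of_poly QM * f k)" "ereal r \<le> radius_sys_star f m k" if "0 < r" "ereal r < \<rho>" for r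
    using tail_decays_imp_radius_real[OF tail_decays_mono[OF tail] that(1) R] that(2) by auto
  have le: "\<rho> \<le> x" if pos: "0 < \<rho>" and x: "\<And>r. 0 < r \<Longrightarrow> ereal r < \<rho> \<Longrightarrow> ereal r \<le> x" for x
  proof (rule ccontr)
    assume "\<not> \<rho> \<le> x"
    hence "max x 0 < \<rho>" using pos by auto
    then obtain r where "max x 0 < ereal r" "ereal r < \<rho>" using ereal_dense2 by blast
    thus False using x[of r] by (auto simp: zero_ereal_def)
  qed
  show "\<rho> \<le> radius_sys_star f m k" if "0 < \<rho>" using le[OF that] * by blast
  show "\<rho> \<le> fps_conv_radius (fps_of_poly QM * f k)"
  proof (cases "0 < \<rho>")
    case False
    thus ?thesis using R fps_conv_radius_poly_mult[of "f k" QM] by order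
  qed (use le * in blast)
qed

text \<open>
  The functions that define the radii of the system poles remove all poles of \<open>f\<^sub>k\<close> in the disk of radius \<open>\<rho>\<close>, and they
  can be taken from \<open>z\<^sup>c V\<close> for every \<open>c\<close>. On \<open>z\<^sup>c V\<close> the coefficient with index \<open>n + c\<close> vanishes.
\<close>

lemma radius_sys_star_imp_tail_decays:
  assumes \<rho>: "0 < \<rho>" "\<rho> < radius_sys_star f m k"
  shows "0 < fps_conv_radius (f k)" "tail_decays k \<rho>"
proof -
  have lt: "\<rho> < radius_sys f m k" using \<rho>(2) by (simp add: radius_sys_star_def)
  then obtain r F where "\<rho> < r" "mero_extends (f k) F r"
    using \<rho>(1) unfolding radius_sys_def less_Sup_iff by force
  thus R: "0 < fps_conv_radius (f k)" using fps_conv_radius_pos_of_expansion by (auto simp: mero_extends_def)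
  have "\<rho> \<le> fps_conv_radius (fps_of_poly QM * f k)" using lt radius_sys_le(1)[OF R] by order
  then obtain A where A: "A \<noteq> 0" "\<rho> \<le> fps_conv_radius (fps_of_poly A * f k)"
    "\<And>\<xi>. poly A \<xi> = 0 \<Longrightarrow> \<xi> \<noteq> 0 \<and> ereal (norm \<xi>) < \<rho> \<and> eval_fps (fps_of_poly A * f k) \<xi> \<noteq> 0"
    using minimal_denominator[OF QM_nonzero _ R \<rho>(1)] by metis
  have polar: "\<exists>g\<in>poly_combinations f m. polar g \<xi> s \<rho>"
    if root: "poly A \<xi> = 0" and s: "1 \<le> s" "s \<le> Polynomial.order \<xi> A" for \<xi> s
  proof -
    note \<xi> = A(3)[OF root]
    have ev: "\<forall>\<^sub>F w in at \<xi>. poly A w * mero_ext (f k) w = eval_fps (fps_of_poly A * f k) w"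
      using \<xi> A(2) lt radius_sys_le[OF R] mero_ext_facts[OF R]
      by (intro meromorphic_expansion_times_poly[where r = \<rho>]) auto
    have an: "eval_fps (fps_of_poly A * f k) analytic_on {\<xi>}"
      using \<xi> A(2) by (intro analytic_on_eval_fps) (auto intro: less_le_trans)
    have pole: "is_pole (mero_ext (f k)) \<xi>" "pole_order (mero_ext (f k)) \<xi> = Polynomial.order \<xi> A"
      using pole_order_quotient_eq[OF A(1) root an _ ev] \<xi> by auto
    have "\<xi> \<in> eball 0 (radius_sys f m k)" using \<xi> lt by (auto intro: less_trans)
    hence "radius_sys_star f m k \<le> sys_radius f m \<xi> (Polynomial.order \<xi> A)"
      unfolding radius_sys_star_def using pole by (intro min.coboundedI2 INF_lower2[of \<xi>]) auto
    also have "\<dots> \<le> sys_radius1 f m \<xi> s" unfolding sys_radius_def using s by (intro Min_le) auto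
    finally have "\<rho> < sys_radius1 f m \<xi> s" using \<rho>(2) by order
    then obtain g where g: "g \<in> poly_combinations f m" "single_pole g \<xi> s" "\<rho> < radius_poles s g"
      unfolding sys_radius1_def less_Sup_iff by blast
    have "polar g \<xi> s \<rho>" using single_pole_radius_poles_imp_polar[OF g(2) _ _ g(3)] \<xi> by blast
    thus ?thesis using g(1) by blast
  qed
  show "tail_decays k \<rho>" unfolding tail_decays_def
  proof (intro allI impI)
    fix c :: nat
    have "\<exists>g\<in>poly_combinations f m. \<rho> \<le> fps_conv_radius (f k - fps_X ^ c * g)"
      by (rule subtract_principal_parts[OF subspace _ A(2), of 0])
         (use A(3)[of 0] R \<rho>(1) polar in auto)
    then obtain g where g: "g \<in> poly_combinations f m" "\<rho> \<le> fps_conv_radius (f k - fps_X ^ c * g)" by blast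
    obtain B where B: "\<And>i. \<forall>\<^sub>F n in sequentially. norm (coeff (Q n) i) \<le> B" using coeff_Q_bounded by blast
    have d: "decays (\<lambda>n. fps_nth (fps_of_poly (Q n) * (f k - fps_X ^ c * g)) (n + c)) \<rho>"
      by (rule decays_bounded_poly_mult[OF B degree_Q g(2)])
    have ev: "\<forall>\<^sub>F n in sequentially. fps_nth (fps_of_poly (Q n) * (f k - fps_X ^ c * g)) (n + c) = fps_nth (fps_of_poly (Q n) * f k) (n + c)"
      using annihilated
    proof eventually_elim
      case (elim n)
      have "fps_of_poly (Q n) * (f k - fps_X ^ c * g) = fps_of_poly (Q n) * f k - fps_X ^ c * (fps_of_poly (Q n) * g)"
        by (simp add: algebra_simps)
      thus ?case using elim g(1) by (simp add: fps_X_power_mult_nth)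
    qed
    show "decays (\<lambda>n. fps_nth (fps_of_poly (Q n) * f k) (n + c)) \<rho>"
      by (rule decays_cong[OF ev, THEN iffD1, OF d])
  qed
qed

end

section \<open>The error of the approximants\<close>

lemma norm_eval_fps_le_of_high_order:
  assumes low: "\<And>i. i \<le> n \<Longrightarrow> fps_nth H i = 0" and bd: "\<And>i. norm (fps_nth H i) * t ^ i \<le> D"
    and z: "norm z < t" "ereal (norm z) < fps_conv_radius H"
  shows "norm (eval_fps H z) \<le> D * (norm z / t) ^ Suc n / (1 - norm z / t)"
proof -
  define x where "x = norm z / t"
  have t: "t > 0" using z(1) norm_ge_zero[of z] by linarith
  have x: "0 \<le> x" "x < 1" using t z(1) by (auto simp: x_def)
  have "summable (\<lambda>i. fps_nth H i * z ^ i)" by (rule summable_fps[OF z(2)])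
  hence "eval_fps H z = (\<Sum>i. fps_nth H (i + Suc n) * z ^ (i + Suc n)) + (\<Sum>i<Suc n. fps_nth H i * z ^ i)"
    unfolding eval_fps_def by (rule suminf_split_initial_segment)
  also have "(\<Sum>i<Suc n. fps_nth H i * z ^ i) = 0" using low by (intro sum.neutral) auto
  finally have "norm (eval_fps H z) = norm (\<Sum>i. fps_nth H (i + Suc n) * z ^ (i + Suc n))" by simp
  also have "\<dots> \<le> (\<Sum>i. D * x ^ Suc n * x ^ i)"
  proof (rule norm_suminf_le)
    fix i
    have "norm (fps_nth H (i + Suc n) * z ^ (i + Suc n)) = (norm (fps_nth H (i + Suc n)) * t ^ (i + Suc n)) * x ^ (i + Suc n)"
      using t by (simp add: norm_mult norm_power x_def power_divide)
    also have "\<dots> \<le> D * x ^ (i + Suc n)" by (rule mult_right_mono[OF bd]) (use x in simp)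
    also have "\<dots> = D * x ^ Suc n * x ^ i" by (simp add: power_add mult_ac)
    finally show "norm (fps_nth H (i + Suc n) * z ^ (i + Suc n)) \<le> D * x ^ Suc n * x ^ i" .
  qed (use x in \<open>intro summable_mult summable_geometric, auto\<close>)
  also have "\<dots> = D * x ^ Suc n / (1 - x)" using x by (subst suminf_mult) (auto simp: suminf_geometric intro!: summable_geometric)
  finally show ?thesis by (simp add: x_def)
qed

lemma ext_modulus_eqI:
  assumes "\<forall>\<^sub>F w in at z. h w = \<phi> w" "isCont \<phi> z"
  shows "ext_modulus h z = ereal (norm (\<phi> z))"
proof -
  have "\<phi> \<midarrow>z\<rightarrow> \<phi> z" using assms(2) by (rule isContD)
  hence lim: "h \<midarrow>z\<rightarrow> \<phi> z" using assms(1) tendsto_cong by fastforce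
  hence "\<not> is_pole h z" unfolding is_pole_def using not_tendsto_and_filterlim_at_infinity at_neq_bot by blast
  thus ?thesis using remove_sings_eqI[OF lim] by (simp add: ext_modulus_def)
qed

context hermite_pade_limit
begin

text \<open>
  Multiplication by \<open>QM\<close> turns the error into a power series that converges in the whole disk where the rate is to be proved.
\<close>

definition remainder :: "'d \<Rightarrow> nat \<Rightarrow> complex fps" where
  "remainder k n = fps_of_poly QM * (fps_of_poly (Q n) * f k - fps_of_poly (P n k))"

lemma remainder_eq: "remainder k n = fps_of_poly (Q n) * (fps_of_poly QM * f k) - fps_of_poly (QM * P n k)"
  by (simp add: remainder_def fps_of_poly_mult algebra_simps)

lemma remainder_radius: "fps_conv_radius (fps_of_poly QM * f k) \<le> fps_conv_radius (remainder k n)"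
  unfolding remainder_eq by (intro fps_conv_radius_diff_ge fps_conv_radius_poly_mult) simp

lemma eval_remainder:
  assumes "ereal (norm z) < fps_conv_radius (fps_of_poly QM * f k)"
  shows "eval_fps (remainder k n) z = poly (Q n) z * eval_fps (fps_of_poly QM * f k) z - poly QM z * poly (P n k) z"
proof -
  have "ereal (norm z) < fps_conv_radius (fps_of_poly (Q n) * (fps_of_poly QM * f k))"
    using assms fps_conv_radius_poly_mult by (rule less_le_trans)
  hence "eval_fps (remainder k n) z = eval_fps (fps_of_poly (Q n) * (fps_of_poly QM * f k)) z - eval_fps (fps_of_poly (QM * P n k)) z"
    unfolding remainder_eq by (intro eval_fps_diff) auto
  thus ?thesis using assms by (simp add: eval_fps_poly_mult)
qed

lemma hp_error_nth:
  assumes "hp_solution f m n (Q n) (P n)"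
  shows "fps_nth (fps_of_poly (Q n) * f k - fps_of_poly (P n k)) i = (if i \<le> n then 0 else fps_nth (fps_of_poly (Q n) * f k) i)"
proof (cases "i \<le> n")
  case True
  thus ?thesis using assms by (simp add: hp_solution_def)
next
  case False
  have "degree (P n k) \<le> n - m k" using assms by (simp add: hp_solution_def)
  hence "coeff (P n k) i = 0" using False by (intro coeff_eq_0) simp
  thus ?thesis using False by simp
qed

text \<open>
  The coefficients at a bounded distance behind index \<open>n\<close> are combinations of coefficients in the tail of \<open>Q\<^sub>n f\<^sub>k\<close>. Beyond the degree of
  \<open>QM P\<^sub>n\<^sub>k\<close> they are coefficients of \<open>Q\<^sub>n (QM f\<^sub>k)\<close> and are controlled by the radius of convergence of \<open>QM f\<^sub>k\<close>.
\<close>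

lemma remainder_coeff_bound:
  assumes tail: "tail_decays k \<rho>" and R: "\<rho> \<le> fps_conv_radius (fps_of_poly QM * f k)"
    and t: "0 < t" "ereal t < \<rho>"
  shows "\<exists>D. \<forall>\<^sub>F n in sequentially. (\<forall>i\<le>n. fps_nth (remainder k n) i = 0) \<and> (\<forall>i. norm (fps_nth (remainder k n) i) * t ^ i \<le> D)"
proof -
  define M where "M = total_index m"
  define M' where "M' = degree QM"
  define E where "E = (\<lambda>n. fps_of_poly (Q n) * f k - fps_of_poly (P n k))"
  define r where "r = (\<lambda>c n. \<Sum>j\<le>M'. coeff QM j * (if j < c then fps_nth (fps_of_poly (Q n) * f k) (n + (c - j)) else 0))"
  have "\<exists>D. \<forall>n. norm (r c n) * t ^ n \<le> D" for c
  proof -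
    have "decays (r c) \<rho>" unfolding r_def
    proof (intro decays_sum decays_mult_bounded)
      fix j show "decays (\<lambda>n. if j < c then fps_nth (fps_of_poly (Q n) * f k) (n + (c - j)) else 0) \<rho>"
      proof (cases "j < c")
        case True
        hence "1 \<le> c - j" by simp
        hence "decays (\<lambda>n. fps_nth (fps_of_poly (Q n) * f k) (n + (c - j))) \<rho>" using tail unfolding tail_decays_def by blast
        thus ?thesis using True by simp
      qed simp
      show "\<forall>\<^sub>F n in sequentially. norm (coeff QM j) \<le> norm (coeff QM j)" by simp
    qed
    thus ?thesis using t unfolding decays_def by blast
  qed
  then obtain D1 where D1: "\<And>c n. norm (r c n) * t ^ n \<le> D1 c" by metis
  have "\<exists>D. \<forall>i. norm (fps_nth (fps_X ^ j * (fps_of_poly QM * f k)) i) * t ^ i \<le> D" for j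
  proof -
    have "decays (fps_nth (fps_X ^ j * (fps_of_poly QM * f k))) \<rho>"
      using R by (simp add: decays_iff_fps_conv_radius fps_conv_radius_X_power_mult)
    thus ?thesis using t unfolding decays_def by blast
  qed
  then obtain D2 where D2: "\<And>j i. norm (fps_nth (fps_X ^ j * (fps_of_poly QM * f k)) i) * t ^ i \<le> D2 j" by metis
  have D1pos: "0 \<le> D1 c" for c using order_trans[OF _ D1[of c 0]] by simp
  have D2pos: "0 \<le> D2 j" for j using order_trans[OF _ D2[of j 0]] by simp
  obtain B where B: "\<And>i. \<forall>\<^sub>F n in sequentially. norm (coeff (Q n) i) \<le> B" using coeff_Q_bounded by blast
  have "\<forall>\<^sub>F n in sequentially. \<forall>i\<in>{..M}. norm (coeff (Q n) i) \<le> B"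
    by (intro eventually_ball_finite) (use B in auto)
  define S1 where "S1 = (\<Sum>c\<le>M'. D1 c * t ^ c)"
  define S2 where "S2 = (\<Sum>j\<le>M. \<bar>B\<bar> * D2 j)"
  have S: "0 \<le> S1" "0 \<le> S2" unfolding S1_def S2_def using D1pos D2pos t by (auto intro!: sum_nonneg)
  have "\<forall>\<^sub>F n in sequentially. (\<forall>i\<le>n. fps_nth (remainder k n) i = 0) \<and> (\<forall>i. norm (fps_nth (remainder k n) i) * t ^ i \<le> S1 + S2)"
    using \<open>\<forall>\<^sub>F n in sequentially. \<forall>i\<in>{..M}. norm (coeff (Q n) i) \<le> B\<close> degree_Q solution
  proof eventually_elim
    case (elim n)
    have E: "fps_nth (E n) i = (if i \<le> n then 0 else fps_nth (fps_of_poly (Q n) * f k) i)" for i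
      unfolding E_def by (rule hp_error_nth[OF elim(3)])
    have rem: "fps_nth (remainder k n) i = (\<Sum>j\<le>M'. coeff QM j * fps_nth (fps_X ^ j * E n) i)" for i
      unfolding remainder_def E_def by (rule fps_nth_poly_mult) (simp add: M'_def)
    have low: "fps_nth (remainder k n) i = 0" if "i \<le> n" for i
      unfolding rem using that by (intro sum.neutral) (auto simp: fps_X_power_mult_nth E)
    have "norm (fps_nth (remainder k n) i) * t ^ i \<le> S1 + S2" for i
    proof -
      consider "i \<le> n" | c where "i = n + c" "1 \<le> c" "c \<le> M'" | "n + M' < i"
      proof -
        have "i \<le> n \<or> (i = n + (i - n) \<and> 1 \<le> i - n \<and> i - n \<le> M') \<or> n + M' < i" by linarith
        thus ?thesis using that by blast
      qed
      thus ?thesis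
      proof cases
        case 1
        thus ?thesis using low S by simp
      next
        case 2
        have "fps_nth (fps_X ^ j * E n) i = (if j < c then fps_nth (fps_of_poly (Q n) * f k) (n + (c - j)) else 0)" for j
        proof (cases "j < c")
          case True
          hence "\<not> i < j" "i - j = n + (c - j)" "\<not> i - j \<le> n" using 2 by auto
          thus ?thesis using True by (simp only: fps_X_power_mult_nth if_False E if_True)
        next
          case False
          hence "i - j \<le> n" using 2 by auto
          thus ?thesis using False by (simp add: fps_X_power_mult_nth E)
        qed
        hence "fps_nth (remainder k n) i = r c n" by (simp add: rem r_def)
        hence "norm (fps_nth (remainder k n) i) * t ^ i = norm (r c n) * t ^ n * t ^ c" by (simp add: 2 power_add)
        also have "\<dots> \<le> D1 c * t ^ c" using D1 t by (intro mult_right_mono) auto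
        also have "\<dots> \<le> S1" unfolding S1_def using 2 D1pos t by (intro member_le_sum) auto
        finally show ?thesis using S by simp
      next
        case 3
        have "coeff (QM * P n k) i = 0"
        proof (rule coeff_eq_0)
          have "degree (QM * P n k) \<le> M' + degree (P n k)" unfolding M'_def by (rule degree_mult_le)
          also have "degree (P n k) \<le> n" using elim(3) unfolding hp_solution_def by (meson diff_le_self order_trans)
          finally show "degree (QM * P n k) < i" using 3 by simp
        qed
        hence "fps_nth (remainder k n) i = fps_nth (fps_of_poly (Q n) * (fps_of_poly QM * f k)) i" by (simp add: remainder_eq)
        also have "\<dots> = (\<Sum>j\<le>M. coeff (Q n) j * fps_nth (fps_X ^ j * (fps_of_poly QM * f k)) i)"
          by (rule fps_nth_poly_mult) (use elim(2) in \<open>simp add: M_def\<close>)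
        finally have "norm (fps_nth (remainder k n) i) * t ^ i \<le> (\<Sum>j\<le>M. norm (coeff (Q n) j * fps_nth (fps_X ^ j * (fps_of_poly QM * f k)) i)) * t ^ i"
          using t by (intro mult_right_mono) (auto intro: norm_sum)
        also have "\<dots> = (\<Sum>j\<le>M. norm (coeff (Q n) j) * (norm (fps_nth (fps_X ^ j * (fps_of_poly QM * f k)) i) * t ^ i))"
          by (simp add: sum_distrib_right norm_mult mult.assoc)
        also have "\<dots> \<le> S2" unfolding S2_def
        proof (rule sum_mono, rule mult_mono)
          fix j assume "j \<in> {..M}"
          hence "norm (coeff (Q n) j) \<le> B" using elim(1) by blast
          thus "norm (coeff (Q n) j) \<le> \<bar>B\<bar>" by linarith
        qed (use D2 t in auto)
        finally show ?thesis using S by simp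
      qed
    qed
    thus ?case using low by blast
  qed
  thus ?thesis by blast
qed

lemma poly_Q_uniform_limit:
  assumes "0 < \<epsilon>"
  shows "\<forall>\<^sub>F n in sequentially. \<forall>z. norm z \<le> s \<longrightarrow> norm (poly (Q n) z - poly QM z) < \<epsilon>"
proof (cases "0 \<le> s")
  case True
  define N where "N = max (total_index m) (degree QM)"
  have "(\<lambda>n. \<Sum>i\<le>N. norm (coeff (Q n) i - coeff QM i) * s ^ i) \<longlonglongrightarrow> (\<Sum>i\<le>N. norm (coeff QM i - coeff QM i) * s ^ i)"
    by (intro tendsto_intros coeff_Q_tendsto)
  hence "(\<lambda>n. \<Sum>i\<le>N. norm (coeff (Q n) i - coeff QM i) * s ^ i) \<longlonglongrightarrow> 0" by simp
  hence "\<forall>\<^sub>F n in sequentially. (\<Sum>i\<le>N. norm (coeff (Q n) i - coeff QM i) * s ^ i) < \<epsilon>"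
    using assms by (rule order_tendstoD(2))
  thus ?thesis using degree_diff_bounded
  proof eventually_elim
    case (elim n)
    show ?case
    proof (intro allI impI)
      fix z :: complex assume z: "norm z \<le> s"
      have "poly (Q n) z - poly QM z = poly (Q n - QM) z" by simp
      also have "\<dots> = (\<Sum>i\<le>N. coeff (Q n - QM) i * z ^ i)"
        unfolding poly_altdef
      proof (intro sum.mono_neutral_left ballI)
        show "{..degree (Q n - QM)} \<subseteq> {..N}" using elim(2) by (simp add: N_def)
        fix i assume "i \<in> {..N} - {..degree (Q n - QM)}"
        hence "coeff (Q n - QM) i = 0" by (intro coeff_eq_0) simp
        thus "coeff (Q n - QM) i * z ^ i = 0" by (simp only: mult_zero_left)
      qed simp
      finally have "norm (poly (Q n) z - poly QM z) \<le> (\<Sum>i\<le>N. norm (coeff (Q n) i - coeff QM i) * norm z ^ i)"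
        by (simp only: coeff_diff) (auto intro!: order_trans[OF norm_sum] sum_mono simp: norm_mult norm_power)
      also have "\<dots> \<le> (\<Sum>i\<le>N. norm (coeff (Q n) i - coeff QM i) * s ^ i)"
        using z by (intro sum_mono mult_left_mono power_mono) auto
      finally show "norm (poly (Q n) z - poly QM z) < \<epsilon>" using elim(1) by simp
    qed
  qed
next
  case False
  hence "\<not> norm z \<le> s" for z :: complex using norm_ge_zero[of z] by linarith
  thus ?thesis by simp
qed

lemma remainder_quotient_bound:
  assumes tail: "tail_decays k \<rho>" and R: "\<rho> \<le> fps_conv_radius (fps_of_poly QM * f k)"
    and t: "0 < t" "ereal t < \<rho>" and K: "compact K" "\<And>z. z \<in> K \<Longrightarrow> norm z \<le> s" "s < t" "\<And>z. z \<in> K \<Longrightarrow> poly QM z \<noteq> 0"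
  shows "\<exists>D. \<forall>\<^sub>F n in sequentially. \<forall>z\<in>K. poly (Q n) z \<noteq> 0 \<and>
      norm (eval_fps (remainder k n) z / (poly QM z * poly (Q n) z)) \<le> D * (norm z / t) ^ Suc n"
proof (cases "K = {}")
  case False
  have s: "0 \<le> s" using False K(2) norm_ge_zero order_trans by blast
  obtain D where D: "\<forall>\<^sub>F n in sequentially. (\<forall>i\<le>n. fps_nth (remainder k n) i = 0) \<and> (\<forall>i. norm (fps_nth (remainder k n) i) * t ^ i \<le> D)"
    using remainder_coeff_bound[OF tail R t] by blast
  have "continuous_on K (\<lambda>z. norm (poly QM z))" by (intro continuous_intros)
  then obtain z0 where z0: "z0 \<in> K" "\<And>z. z \<in> K \<Longrightarrow> norm (poly QM z0) \<le> norm (poly QM z)"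
    using continuous_attains_inf[OF K(1) False] by blast
  define \<delta> where "\<delta> = norm (poly QM z0)"
  have \<delta>: "0 < \<delta>" using K(4)[OF z0(1)] by (simp add: \<delta>_def)
  define D' where "D' = \<bar>D\<bar> / (1 - s / t) / (\<delta> * (\<delta> / 2))"
  have st: "0 < 1 - s / t" using K(3) t s by simp
  have "\<forall>\<^sub>F n in sequentially. \<forall>z. norm z \<le> s \<longrightarrow> norm (poly (Q n) z - poly QM z) < \<delta> / 2"
    using \<delta> by (intro poly_Q_uniform_limit) simp
  hence "\<forall>\<^sub>F n in sequentially. \<forall>z\<in>K. poly (Q n) z \<noteq> 0 \<and>
      norm (eval_fps (remainder k n) z / (poly QM z * poly (Q n) z)) \<le> D' * (norm z / t) ^ Suc n"
    using D
  proof eventually_elim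
    case (elim n)
    show ?case
    proof
      fix z assume z: "z \<in> K"
      note zs = K(2)[OF z]
      have dQM: "\<delta> \<le> norm (poly QM z)" unfolding \<delta>_def by (rule z0(2)[OF z])
      have "norm (poly (Q n) z - poly QM z) < \<delta> / 2" using elim(1) zs by blast
      hence dQ: "\<delta> / 2 \<le> norm (poly (Q n) z)"
        using dQM norm_triangle_ineq2[of "poly QM z" "poly (Q n) z"] by (simp add: norm_minus_commute)
      have "ereal (norm z) < ereal t" using zs K(3) by simp
      hence "ereal (norm z) < fps_conv_radius (remainder k n)" using t(2) R remainder_radius[of k n] by order
      hence "norm (eval_fps (remainder k n) z) \<le> D * (norm z / t) ^ Suc n / (1 - norm z / t)"
        using elim(2) zs K(3) by (intro norm_eval_fps_le_of_high_order) auto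
      also have "\<dots> \<le> \<bar>D\<bar> * (norm z / t) ^ Suc n / (1 - s / t)"
        using st t zs by (intro frac_le mult_right_mono) (auto simp: divide_right_mono)
      finally have num: "norm (eval_fps (remainder k n) z) \<le> \<bar>D\<bar> * (norm z / t) ^ Suc n / (1 - s / t)" .
      have "norm (eval_fps (remainder k n) z / (poly QM z * poly (Q n) z)) = norm (eval_fps (remainder k n) z) / (norm (poly QM z) * norm (poly (Q n) z))"
        by (simp add: norm_divide norm_mult)
      also have "\<dots> \<le> (\<bar>D\<bar> * (norm z / t) ^ Suc n / (1 - s / t)) / (\<delta> * (\<delta> / 2))"
        using num dQM dQ \<delta> st t by (intro frac_le mult_mono) auto
      also have "\<dots> = D' * (norm z / t) ^ Suc n" unfolding D'_def by (simp only: times_divide_eq_left times_divide_eq_right)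
      finally show "poly (Q n) z \<noteq> 0 \<and> norm (eval_fps (remainder k n) z / (poly QM z * poly (Q n) z)) \<le> D' * (norm z / t) ^ Suc n"
        using dQ \<delta> by auto
    qed
  qed
  thus ?thesis by blast
qed auto

lemma approximant_error_modulus:
  assumes F: "F has_fps_expansion f k" "F meromorphic_on eball 0 \<rho>" and R: "\<rho> \<le> fps_conv_radius (fps_of_poly QM * f k)"
    and z: "z \<in> eball 0 \<rho>" "poly QM z \<noteq> 0" "poly (Q n) z \<noteq> 0"
  shows "ext_modulus (\<lambda>w. F w - poly (P n k) w / poly (Q n) w) z = ereal (norm (eval_fps (remainder k n) z / (poly QM z * poly (Q n) z)))"
    and "ext_modulus (\<lambda>w. poly (P n k) w / poly (Q n) w - F w) z = ereal (norm (eval_fps (remainder k n) z / (poly QM z * poly (Q n) z)))"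
proof -
  define \<phi> where "\<phi> = (\<lambda>w. eval_fps (remainder k n) w / (poly QM w * poly (Q n) w))"
  have zR: "ereal (norm z) < fps_conv_radius (fps_of_poly QM * f k)" using z(1) R by (auto intro: less_le_trans)
  have cont: "isCont \<phi> z" unfolding \<phi>_def
    using z zR remainder_radius[of k n] by (intro continuous_intros) (auto intro: less_le_trans)
  have "\<forall>\<^sub>F w in at z. w \<in> eball 0 \<rho>" using z(1) by (intro eventually_at_in_open') auto
  moreover note meromorphic_expansion_times_poly[OF F R z(1)]
  moreover have "\<forall>\<^sub>F w in at z. poly (Q n) w \<noteq> 0" using z(3) by (intro eventually_poly_nonzero) auto
  ultimately have eq: "\<forall>\<^sub>F w in at z. F w - poly (P n k) w / poly (Q n) w = \<phi> w"
    using eventually_poly_nonzero[OF QM_nonzero, of z]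
  proof eventually_elim
    case (elim w)
    hence "ereal (norm w) < fps_conv_radius (fps_of_poly QM * f k)" using R by (auto intro: less_le_trans)
    hence "eval_fps (remainder k n) w = poly (Q n) w * (poly QM w * F w) - poly QM w * poly (P n k) w"
      using elim(2) by (simp add: eval_remainder)
    thus ?case unfolding \<phi>_def using elim by (simp add: divide_simps) (simp add: algebra_simps)
  qed
  show "ext_modulus (\<lambda>w. F w - poly (P n k) w / poly (Q n) w) z = ereal (norm (\<phi> z))"
    by (rule ext_modulus_eqI[OF eq cont])
  have "ext_modulus (\<lambda>w. poly (P n k) w / poly (Q n) w - F w) z = ereal (norm (- \<phi> z))"
  proof (rule ext_modulus_eqI)
    show "\<forall>\<^sub>F w in at z. poly (P n k) w / poly (Q n) w - F w = - \<phi> w" using eq by eventually_elim (simp add: algebra_simps)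
    show "isCont (\<lambda>w. - \<phi> w) z" using cont by (rule continuous_minus)
  qed
  thus "ext_modulus (\<lambda>w. poly (P n k) w / poly (Q n) w - F w) z = ereal (norm (\<phi> z))" by simp
qed

end

section \<open>Hausdorff content and polynomials\<close>

lemma content_mono: "A \<subseteq> B \<Longrightarrow> content A \<le> content B"
  unfolding content_def by (rule Inf_superset_mono) blast

lemma content_leI:
  assumes "\<And>i. 0 \<le> \<rho> i" "B \<subseteq> (\<Union>i. ball (c i) (\<rho> i))"
  shows "content B \<le> (\<Sum>i. ennreal (\<rho> i))"
  unfolding content_def using assms by (intro Inf_lower) blast

text \<open>
  Interleaving two coverings gives a covering of the union.
\<close>

lemma content_Un_le: "content (A \<union> B) \<le> content A + content B"
proof (rule ennreal_le_epsilon)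
  fix e :: real assume fin: "content A + content B < top" and e: "0 < e"
  have "content A < content A + ennreal (e / 2)" "content B < content B + ennreal (e / 2)"
    using fin e by (auto intro!: ennreal_add_left_cancel_less[THEN iffD2, of _ 0, simplified] simp: less_top)
  then obtain cA \<rho>A cB \<rho>B where A: "\<And>i. 0 \<le> \<rho>A i" "A \<subseteq> (\<Union>i. ball (cA i) (\<rho>A i))" "(\<Sum>i. ennreal (\<rho>A i)) < content A + ennreal (e / 2)"
    and B: "\<And>i. 0 \<le> \<rho>B i" "B \<subseteq> (\<Union>i. ball (cB i) (\<rho>B i))" "(\<Sum>i. ennreal (\<rho>B i)) < content B + ennreal (e / 2)"
    unfolding content_def Inf_less_iff by blast
  define c where "c = (\<lambda>i::nat. if even i then cA (i div 2) else cB (i div 2))"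
  define \<rho> where "\<rho> = (\<lambda>i::nat. if even i then \<rho>A (i div 2) else \<rho>B (i div 2))"
  have "A \<union> B \<subseteq> (\<Union>i. ball (c i) (\<rho> i))"
  proof
    fix x assume "x \<in> A \<union> B"
    then consider i where "x \<in> ball (cA i) (\<rho>A i)" | i where "x \<in> ball (cB i) (\<rho>B i)" using A(2) B(2) by blast
    thus "x \<in> (\<Union>i. ball (c i) (\<rho> i))"
    proof cases
      case (1 i)
      hence "x \<in> ball (c (2 * i)) (\<rho> (2 * i))" by (simp add: c_def \<rho>_def)
      thus ?thesis by blast
    next
      case (2 i)
      hence "x \<in> ball (c (Suc (2 * i))) (\<rho> (Suc (2 * i)))" by (simp add: c_def \<rho>_def)
      thus ?thesis by blast
    qed
  qed
  hence "content (A \<union> B) \<le> (\<Sum>i. ennreal (\<rho> i))" using A(1) B(1) by (intro content_leI) (auto simp: \<rho>_def)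
  also have "\<dots> \<le> (\<Sum>i. ennreal (\<rho>A i)) + (\<Sum>i. ennreal (\<rho>B i))"
    unfolding suminf_eq_SUP[of "\<lambda>i. ennreal (\<rho> i)"]
  proof (rule SUP_least)
    fix n
    have "(\<Sum>i<n. ennreal (\<rho> i)) \<le> (\<Sum>i<2 * n. ennreal (\<rho> i))" by (intro sum_mono2) auto
    also have "\<dots> = (\<Sum>i<n. ennreal (\<rho>A i)) + (\<Sum>i<n. ennreal (\<rho>B i))"
      by (induction n) (auto simp: \<rho>_def algebra_simps)
    also have "\<dots> \<le> (\<Sum>i. ennreal (\<rho>A i)) + (\<Sum>i. ennreal (\<rho>B i))"
      by (intro add_mono sum_le_suminf) auto
    finally show "(\<Sum>i<n. ennreal (\<rho> i)) \<le> (\<Sum>i. ennreal (\<rho>A i)) + (\<Sum>i. ennreal (\<rho>B i))" .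
  qed
  also have "\<dots> \<le> (content A + ennreal (e / 2)) + (content B + ennreal (e / 2))"
    using A(3) B(3) by (intro add_mono) auto
  also have "\<dots> = content A + content B + (ennreal (e / 2) + ennreal (e / 2))" by (simp add: algebra_simps)
  also have "ennreal (e / 2) + ennreal (e / 2) = ennreal e" using e by (simp flip: ennreal_plus)
  finally show "content (A \<union> B) \<le> content A + content B + ennreal e" .
qed

lemma content_ball_le:
  assumes "0 \<le> r"
  shows "content (ball c r) \<le> ennreal r"
proof -
  have "content (ball c r) \<le> (\<Sum>i. ennreal ((\<lambda>i::nat. if i = 0 then r else 0) i))"
    using assms by (intro content_leI[where c = "\<lambda>_. c"]) (auto split: if_splits)
  also have "\<dots> = (\<Sum>i\<in>{0}. ennreal ((\<lambda>i::nat. if i = 0 then r else 0) i))"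
    by (intro suminf_finite) auto
  finally show ?thesis by simp
qed

lemma content_empty [simp]: "content {} = 0"
  using content_ball_le[of 0 0] by simp

lemma content_UN_balls_le:
  assumes "finite S" "0 \<le> \<delta>"
  shows "content (\<Union>x\<in>S. ball x \<delta>) \<le> ennreal (real (card S) * \<delta>)"
  using assms(1)
proof (induction S rule: finite_induct)
  case (insert x S)
  have "content (\<Union>x\<in>insert x S. ball x \<delta>) \<le> content (ball x \<delta>) + content (\<Union>x\<in>S. ball x \<delta>)"
    using content_Un_le[of "ball x \<delta>" "\<Union>x\<in>S. ball x \<delta>"] by simp
  also have "\<dots> \<le> ennreal \<delta> + ennreal (real (card S) * \<delta>)"
    using assms(2) by (intro add_mono content_ball_le insert.IH)
  also have "\<dots> = ennreal (real (card (insert x S)) * \<delta>)"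
    using insert.hyps assms(2) by (simp flip: ennreal_plus add: algebra_simps)
  finally show ?case .
qed simp

text \<open>
  Projecting the disks to the real line gives intervals of length \<open>2 \<rho>\<^sub>i\<close> that cover \<open>[r1, r2]\<close>.
\<close>

lemma content_segment_ge:
  assumes "r1 \<le> r2"
  shows "ennreal ((r2 - r1) / 2) \<le> content (complex_of_real ` {r1..r2})"
  unfolding content_def
proof (rule Inf_greatest, clarify)
  fix c :: "nat \<Rightarrow> complex" and \<rho> :: "nat \<Rightarrow> real"
  assume \<rho>: "\<forall>i. 0 \<le> \<rho> i" and cover: "complex_of_real ` {r1..r2} \<subseteq> (\<Union>i. ball (c i) (\<rho> i))"
  define I where "I = (\<lambda>i. {Re (c i) - \<rho> i..Re (c i) + \<rho> i})"
  have "{r1..r2} \<subseteq> (\<Union>i. I i)"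
  proof
    fix x assume "x \<in> {r1..r2}"
    then obtain i where "complex_of_real x \<in> ball (c i) (\<rho> i)" using cover by blast
    hence "norm (c i - of_real x) < \<rho> i" by (simp add: dist_norm)
    moreover have "\<bar>Re (c i) - x\<bar> \<le> norm (c i - of_real x)" using abs_Re_le_cmod[of "c i - of_real x"] by simp
    ultimately have "x \<in> I i" by (auto simp: I_def)
    thus "x \<in> (\<Union>i. I i)" by blast
  qed
  hence "emeasure lborel {r1..r2} \<le> emeasure lborel (\<Union>i. I i)" by (intro emeasure_mono) (auto simp: I_def)
  also have "\<dots> \<le> (\<Sum>i. emeasure lborel (I i))" by (intro emeasure_subadditive_countably) (auto simp: I_def)
  also have "\<dots> = (\<Sum>i. 2 * ennreal (\<rho> i))"
  proof (rule suminf_cong)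
    fix i
    have "emeasure lborel (I i) = ennreal (2 * \<rho> i)" using \<rho> by (simp add: I_def)
    also have "\<dots> = 2 * ennreal (\<rho> i)" using \<rho> by (subst ennreal_mult) auto
    finally show "emeasure lborel (I i) = 2 * ennreal (\<rho> i)" .
  qed
  also have "\<dots> = 2 * (\<Sum>i. ennreal (\<rho> i))" by (rule ennreal_suminf_cmult)
  finally have le: "ennreal (r2 - r1) \<le> 2 * (\<Sum>i. ennreal (\<rho> i))" using assms by simp
  have "ennreal (r2 - r1) = 2 * ennreal ((r2 - r1) / 2)"
    using assms by (simp add: mult_2 flip: ennreal_plus)
  hence "2 * ennreal ((r2 - r1) / 2) \<le> 2 * (\<Sum>i. ennreal (\<rho> i))" using le by simp
  thus "ennreal ((r2 - r1) / 2) \<le> (\<Sum>i. ennreal (\<rho> i))"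
    by (subst (asm) ennreal_mult_le_mult_iff) auto
qed

text \<open>
  Points are chosen greedily: the disks of radius \<open>d\<close> around at most \<open>N\<close> points cannot cover \<open>E\<close>.
\<close>

lemma separated_points_exist:
  assumes "0 \<le> d" "ennreal (real N * d) < content E"
  shows "\<exists>x::nat \<Rightarrow> complex. (\<forall>i\<le>N. x i \<in> E) \<and> (\<forall>j\<le>N. \<forall>i<j. d \<le> norm (x j - x i))"
proof -
  have "\<exists>x::nat \<Rightarrow> complex. (\<forall>i<n. x i \<in> E) \<and> (\<forall>j<n. \<forall>i<j. d \<le> norm (x j - x i))" if "n \<le> Suc N" for n
    using that
  proof (induction n)
    case (Suc n)
    then obtain x where x: "\<forall>i<n. x i \<in> E" "\<forall>j<n. \<forall>i<j. d \<le> norm (x j - x i)" by auto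
    have "content (\<Union>y\<in>x ` {..<n}. ball y d) \<le> ennreal (real (card (x ` {..<n})) * d)"
      using assms(1) by (intro content_UN_balls_le) auto
    also have "\<dots> \<le> ennreal (real N * d)"
    proof (intro ennreal_leI mult_right_mono)
      have "card (x ` {..<n}) \<le> n" using card_image_le[of "{..<n}" x] by simp
      thus "real (card (x ` {..<n})) \<le> real N" using Suc.prems by simp
    qed (use assms in auto)
    also have "\<dots> < content E" by fact
    finally have "\<not> E \<subseteq> (\<Union>y\<in>x ` {..<n}. ball y d)" using content_mono by (meson not_le)
    then obtain y where y: "y \<in> E" "\<And>i. i < n \<Longrightarrow> d \<le> norm (y - x i)"
      by (force simp: dist_norm norm_minus_commute not_less)
    have "(\<forall>i<Suc n. (x(n := y)) i \<in> E) \<and> (\<forall>j<Suc n. \<forall>i<j. d \<le> norm ((x(n := y)) j - (x(n := y)) i))"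
      using x y by (auto simp: less_Suc_eq)
    thus ?case by blast
  qed auto
  from this[of "Suc N"] show ?thesis by (auto simp: less_Suc_eq_le)
qed

text \<open>
  Quantitative interpolation: subtracting the value at \<open>x\<^sub>0\<close> and dividing by \<open>z - x\<^sub>0\<close> lowers the degree, and at the other
  points the division costs a factor of at most \<open>1/d\<close>.
\<close>

lemma coeffs_bounded_by_values:
  assumes "0 < d" "0 \<le> r"
  shows "\<exists>K\<ge>0. \<forall>(p::complex poly) x X. degree p \<le> N \<longrightarrow> (\<forall>i\<le>N. norm (x i) \<le> r \<and> norm (poly p (x i)) \<le> X) \<longrightarrow>
     (\<forall>j\<le>N. \<forall>i<j. d \<le> norm (x j - x i)) \<longrightarrow> (\<forall>i. norm (coeff p i) \<le> K * X)"
proof (induction N)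
  case 0
  have *: "norm (coeff p i) \<le> 1 * X" if deg: "degree p \<le> 0" and bd: "norm (poly p (x 0)) \<le> X" for p :: "complex poly" and x :: "nat \<Rightarrow> complex" and X i
  proof -
    obtain a where a: "p = [:a:]" using deg by (metis degree_eq_zeroE le_zero_eq)
    have "norm a \<le> X" using bd by (simp add: a)
    moreover from this have "0 \<le> X" by (rule order_trans[OF norm_ge_zero])
    ultimately show ?thesis unfolding a by (cases i) simp_all
  qed
  show ?case
  proof (intro exI[of _ 1] conjI allI impI)
    fix p :: "complex poly" and x :: "nat \<Rightarrow> complex" and X i
    assume "degree p \<le> 0" "\<forall>i\<le>0. norm (x i) \<le> r \<and> norm (poly p (x i)) \<le> X"
    thus "norm (coeff p i) \<le> 1 * X" by (intro *) auto
  qed simp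
next
  case (Suc N)
  from Suc.IH obtain K where K0: "0 \<le> K" and
    K1: "\<forall>(p::complex poly) x X. degree p \<le> N \<longrightarrow> (\<forall>i\<le>N. norm (x i) \<le> r \<and> norm (poly p (x i)) \<le> X) \<longrightarrow>
     (\<forall>j\<le>N. \<forall>i<j. d \<le> norm (x j - x i)) \<longrightarrow> (\<forall>i. norm (coeff p i) \<le> K * X)"
    by blast
  define K' where "K' = 1 + (1 + r) * (K * (2 / d))"
  have "norm (coeff p i) \<le> K' * X"
    if p: "degree p \<le> Suc N" and x: "\<forall>i\<le>Suc N. norm (x i) \<le> r \<and> norm (poly p (x i)) \<le> X"
      and sep: "\<forall>j\<le>Suc N. \<forall>i<j. d \<le> norm (x j - x i)" for p :: "complex poly" and x X i
  proof -
    have "poly (p - [:poly p (x 0):]) (x 0) = 0" by simp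
    then obtain q where q: "p - [:poly p (x 0):] = [:-x 0, 1:] * q" by (metis poly_eq_0_iff_dvd dvdE)
    have X: "0 \<le> X" using x norm_ge_zero order_trans by blast
    have degq: "degree q \<le> N"
    proof (cases "q = 0")
      case False
      have "degree (p - [:poly p (x 0):]) \<le> Suc N" using p by (intro degree_diff_le) auto
      moreover have "degree ([:-x 0, 1:] * q) = Suc (degree q)" using False by (subst degree_mult_eq) auto
      ultimately show ?thesis using q by simp
    qed simp
    have bd: "norm (coeff q j) \<le> K * (2 * X / d)" for j
    proof (rule K1[THEN spec[of _ q], THEN spec[of _ "\<lambda>i. x (Suc i)"], THEN spec[of _ "2 * X / d"],
        THEN mp, THEN mp, THEN mp, THEN spec, OF degq]; intro allI impI)
      fix i assume i: "i \<le> N"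
      have "poly p (x (Suc i)) - poly p (x 0) = (x (Suc i) - x 0) * poly q (x (Suc i))"
        using arg_cong[OF q, of "\<lambda>p. poly p (x (Suc i))"] by (simp add: algebra_simps)
      hence "norm (x (Suc i) - x 0) * norm (poly q (x (Suc i))) = norm (poly p (x (Suc i)) - poly p (x 0))"
        by (simp add: norm_mult)
      also have "\<dots> \<le> norm (poly p (x (Suc i))) + norm (poly p (x 0))" by (rule norm_triangle_ineq4)
      also have "\<dots> \<le> 2 * X" using x i by (smt (verit) Suc_le_mono le0)
      finally have "norm (x (Suc i) - x 0) * norm (poly q (x (Suc i))) \<le> 2 * X" .
      moreover have "d * norm (poly q (x (Suc i))) \<le> norm (x (Suc i) - x 0) * norm (poly q (x (Suc i)))"
        using sep i by (intro mult_right_mono) auto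
      ultimately have "d * norm (poly q (x (Suc i))) \<le> 2 * X" by linarith
      hence "norm (poly q (x (Suc i))) \<le> 2 * X / d" using assms(1) by (simp add: field_simps)
      thus "norm (x (Suc i)) \<le> r \<and> norm (poly q (x (Suc i))) \<le> 2 * X / d" using x i by auto
    next
      fix j i assume "j \<le> N" "i < j"
      thus "d \<le> norm (x (Suc j) - x (Suc i))" using sep by simp
    qed
    have "p = [:poly p (x 0):] + [:-x 0, 1:] * q" using q by (simp only: algebra_simps)
    hence "coeff p i = coeff [:poly p (x 0):] i + coeff ([:-x 0, 1:] * q) i" by (metis coeff_add)
    also have "coeff ([:-x 0, 1:] * q) i = (if i = 0 then 0 else coeff q (i - 1)) - x 0 * coeff q i"
      by (cases i) auto
    finally have "coeff p i = coeff [:poly p (x 0):] i + ((if i = 0 then 0 else coeff q (i - 1)) - x 0 * coeff q i)" .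
    moreover have "norm (a + (b - c * e)) \<le> norm a + (norm b + norm c * norm e)" for a b c e :: complex
      using norm_triangle_ineq[of a "b - c * e"] norm_triangle_ineq4[of b "c * e"] by (simp add: norm_mult)
    ultimately have "norm (coeff p i) \<le> norm (coeff [:poly p (x 0):] i) + (norm (if i = 0 then 0 else coeff q (i - 1)) + norm (x 0) * norm (coeff q i))"
      by (simp only:)
    also have "\<dots> \<le> X + (K * (2 * X / d) + r * (K * (2 * X / d)))"
    proof (intro add_mono mult_mono)
      show "norm (coeff [:poly p (x 0):] i) \<le> X" using x X by (cases i) auto
      show "norm (if i = 0 then 0 else coeff q (i - 1)) \<le> K * (2 * X / d)"
        using bd[of "i - 1"] K0 X assms by auto
      show "norm (x 0) \<le> r" using x by blast
    qed (use bd assms in auto)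
    also have "\<dots> = K' * X" using assms(1) by (simp add: K'_def field_simps)
    finally show ?thesis .
  qed
  moreover have "0 \<le> K'" using K0 assms by (simp add: K'_def)
  ultimately show ?case by blast
qed

lemma ext_modulus_le_imp_limit:
  assumes "h meromorphic_on {z}" "ext_modulus h z \<le> ereal a"
  shows "\<exists>c. h \<midarrow>z\<rightarrow> c \<and> norm c \<le> a"
proof -
  have np: "\<not> is_pole h z" using assms(2) by (auto simp: ext_modulus_def)
  moreover have "not_essential h z" using assms(1) by (simp add: meromorphic_at_iff)
  ultimately obtain c where c: "h \<midarrow>z\<rightarrow> c" unfolding not_essential_def by blast
  hence "norm c \<le> a" using assms(2) np remove_sings_eqI[OF c] by (simp add: ext_modulus_def)
  thus ?thesis using c by blast
qed

text \<open>
  The bound passes to the limit at \<open>z\<close>, where the functions themselves may have removable singularities.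
\<close>

lemma norm_le_of_ext_modulus:
  assumes h: "h1 meromorphic_on {z}" "h2 meromorphic_on {z}" "ext_modulus h1 z \<le> ereal a" "ext_modulus h2 z \<le> ereal b"
    and eq: "\<forall>\<^sub>F w in at z. X w = Y w * (h1 w - h2 w)" and cont: "isCont X z" "isCont Y z"
  shows "norm (X z) \<le> norm (Y z) * (a + b)"
proof -
  obtain c1 where c1: "h1 \<midarrow>z\<rightarrow> c1" "norm c1 \<le> a" using ext_modulus_le_imp_limit[OF h(1,3)] by blast
  obtain c2 where c2: "h2 \<midarrow>z\<rightarrow> c2" "norm c2 \<le> b" using ext_modulus_le_imp_limit[OF h(2,4)] by blast
  have "(\<lambda>w. Y w * (h1 w - h2 w)) \<midarrow>z\<rightarrow> Y z * (c1 - c2)"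
    by (intro tendsto_intros c1 c2 isContD[OF cont(2)])
  hence "X \<midarrow>z\<rightarrow> Y z * (c1 - c2)" using eq tendsto_cong by fastforce
  hence "X z = Y z * (c1 - c2)" using isContD[OF cont(1)] LIM_unique by blast
  hence "norm (X z) = norm (Y z) * norm (c1 - c2)" by (simp add: norm_mult)
  also have "\<dots> \<le> norm (Y z) * (a + b)"
    using c1(2) c2(2) norm_triangle_ineq4[of c1 c2] by (intro mult_left_mono) auto
  finally show ?thesis .
qed

section \<open>From small differences to decaying tails\<close>

context hermite_pade_limit
begin

text \<open>
  The numerator of the difference of consecutive approximants.
\<close>

definition cross :: "'d \<Rightarrow> nat \<Rightarrow> complex poly" where
  "cross k n = P (Suc n) k * Q n - P n k * Q (Suc n)"

lemma cross_eq:
  "fps_of_poly (cross k n) = fps_of_poly (Q (Suc n)) * (fps_of_poly (Q n) * f k - fps_of_poly (P n k))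
     - fps_of_poly (Q n) * (fps_of_poly (Q (Suc n)) * f k - fps_of_poly (P (Suc n) k))"
  by (simp add: cross_def fps_of_poly_diff fps_of_poly_mult algebra_simps)

lemma cross_coeff:
  assumes sol: "hp_solution f m n (Q n) (P n)" "hp_solution f m (Suc n) (Q (Suc n)) (P (Suc n))"
  shows "i \<le> n \<Longrightarrow> coeff (cross k n) i = 0"
    and "coeff (cross k n) (n + c) =
      (\<Sum>i\<le>total_index m. coeff (Q (Suc n)) i * (if i < c then fps_nth (fps_of_poly (Q n) * f k) (n + (c - i)) else 0)) -
      (\<Sum>i\<le>total_index m. coeff (Q n) i * (if Suc i < c then fps_nth (fps_of_poly (Q (Suc n)) * f k) (Suc n + (c - Suc i)) else 0))"
proof -
  define E where "E = fps_of_poly (Q n) * f k - fps_of_poly (P n k)"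
  define E' where "E' = fps_of_poly (Q (Suc n)) * f k - fps_of_poly (P (Suc n) k)"
  have E: "fps_nth E i = (if i \<le> n then 0 else fps_nth (fps_of_poly (Q n) * f k) i)" for i
    unfolding E_def by (rule hp_error_nth[OF sol(1)])
  have E': "fps_nth E' i = (if i \<le> Suc n then 0 else fps_nth (fps_of_poly (Q (Suc n)) * f k) i)" for i
    unfolding E'_def by (rule hp_error_nth[OF sol(2)])
  have deg: "degree (Q n) \<le> total_index m" "degree (Q (Suc n)) \<le> total_index m" using sol by (auto simp: hp_solution_def)
  have "coeff (cross k n) i = fps_nth (fps_of_poly (cross k n)) i" for i by simp
  hence *: "coeff (cross k n) i = (\<Sum>j\<le>total_index m. coeff (Q (Suc n)) j * fps_nth (fps_X ^ j * E) i) -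
      (\<Sum>j\<le>total_index m. coeff (Q n) j * fps_nth (fps_X ^ j * E') i)" for i
    unfolding cross_eq E_def[symmetric] E'_def[symmetric] by (simp only: fps_sub_nth fps_nth_poly_mult[OF deg(1)] fps_nth_poly_mult[OF deg(2)])
  show "coeff (cross k n) i = 0" if "i \<le> n"
  proof -
    have "fps_nth (fps_X ^ j * E) i = 0" "fps_nth (fps_X ^ j * E') i = 0" for j
      using that by (auto simp: fps_X_power_mult_nth E E')
    thus ?thesis by (simp add: *)
  qed
  have "fps_nth (fps_X ^ i * E) (n + c) = (if i < c then fps_nth (fps_of_poly (Q n) * f k) (n + (c - i)) else 0)" for i
  proof (cases "i < c")
    case True
    hence "\<not> n + c < i" "n + c - i = n + (c - i)" "\<not> n + (c - i) \<le> n" by auto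
    thus ?thesis using True by (simp only: fps_X_power_mult_nth if_False E if_True)
  next
    case False
    hence "n + c - i \<le> n" by auto
    thus ?thesis using False by (simp add: fps_X_power_mult_nth E)
  qed
  moreover have "fps_nth (fps_X ^ i * E') (n + c) = (if Suc i < c then fps_nth (fps_of_poly (Q (Suc n)) * f k) (Suc n + (c - Suc i)) else 0)" for i
  proof (cases "Suc i < c")
    case True
    hence "\<not> n + c < i" "n + c - i = Suc n + (c - Suc i)" "\<not> Suc n + (c - Suc i) \<le> Suc n" by auto
    thus ?thesis using True by (simp only: fps_X_power_mult_nth if_False E' if_True)
  next
    case False
    hence "n + c - i \<le> Suc n" by auto
    thus ?thesis using False by (simp add: fps_X_power_mult_nth E')
  qed
  ultimately show "coeff (cross k n) (n + c) =
      (\<Sum>i\<le>total_index m. coeff (Q (Suc n)) i * (if i < c then fps_nth (fps_of_poly (Q n) * f k) (n + (c - i)) else 0)) -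
      (\<Sum>i\<le>total_index m. coeff (Q n) i * (if Suc i < c then fps_nth (fps_of_poly (Q (Suc n)) * f k) (Suc n + (c - Suc i)) else 0))"
    by (simp only: *)
qed

lemma solution_Suc: "\<forall>\<^sub>F n in sequentially. hp_solution f m n (Q n) (P n) \<and> hp_solution f m (Suc n) (Q (Suc n)) (P (Suc n))"
  using solution eventually_sequentially_Suc[of "\<lambda>n. hp_solution f m n (Q n) (P n)"] by (auto intro: eventually_conj)

text \<open>
  The coefficient of \<open>cross\<close> at distance \<open>c\<close> behind \<open>n\<close> contains the coefficient of \<open>Q\<^sub>n f\<^sub>k\<close> with index \<open>n + c\<close>, multiplied by \<open>Q\<^sub>n\<^sub>+\<^sub>1(0)\<close>,
  and otherwise only coefficients at smaller distances from \<open>n\<close> or \<open>n + 1\<close>.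
\<close>

lemma cross_decays_imp_tail_decays:
  assumes "\<And>c. 1 \<le> c \<Longrightarrow> decays (\<lambda>n. coeff (cross k n) (n + c)) \<rho>"
  shows "tail_decays k \<rho>"
  unfolding tail_decays_def
proof (intro allI impI)
  fix c :: nat assume "1 \<le> c"
  thus "decays (\<lambda>n. fps_nth (fps_of_poly (Q n) * f k) (n + c)) \<rho>"
  proof (induction c rule: less_induct)
    case (less c)
    define M where "M = total_index m"
    define e where "e = (\<lambda>c n. fps_nth (fps_of_poly (Q n) * f k) (n + c))"
    obtain B where B: "\<And>i. \<forall>\<^sub>F n in sequentially. norm (coeff (Q n) i) \<le> B" using coeff_Q_bounded by blast
    have BS: "\<forall>\<^sub>F n in sequentially. norm (coeff (Q (Suc n)) i) \<le> B" for i
      using B[of i] eventually_sequentially_Suc[of "\<lambda>n. norm (coeff (Q n) i) \<le> B"] by simp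
    obtain B0 where "\<forall>\<^sub>F n in sequentially. coeff (Q n) 0 \<noteq> 0 \<and> norm (inverse (coeff (Q n) 0)) \<le> B0"
      using inverse_Q0_bounded by blast
    hence B0: "\<forall>\<^sub>F n in sequentially. coeff (Q (Suc n)) 0 \<noteq> 0 \<and> norm (inverse (coeff (Q (Suc n)) 0)) \<le> B0"
      using eventually_sequentially_Suc[of "\<lambda>n. coeff (Q n) 0 \<noteq> 0 \<and> norm (inverse (coeff (Q n) 0)) \<le> B0"] by simp
    define S1 where "S1 = (\<lambda>n. \<Sum>i\<in>{1..M}. coeff (Q (Suc n)) i * (if i < c then e (c - i) n else 0))"
    define S2 where "S2 = (\<lambda>n. \<Sum>i\<le>M. coeff (Q n) i * (if Suc i < c then e (c - Suc i) (Suc n) else 0))"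
    have IH: "decays (e c') \<rho>" if "1 \<le> c'" "c' < c" for c' unfolding e_def using less.IH that by blast
    have d1: "decays S1 \<rho>" unfolding S1_def
    proof (intro decays_sum decays_mult_bounded[where C = B] BS)
      fix i assume "i \<in> {1..M}"
      thus "decays (\<lambda>n. if i < c then e (c - i) n else 0) \<rho>"
        using IH[of "c - i"] by (cases "i < c") (auto simp: Suc_le_eq)
    qed
    have d2: "decays S2 \<rho>" unfolding S2_def
    proof (intro decays_sum decays_mult_bounded[where C = B] B)
      fix i assume "i \<in> {..M}"
      show "decays (\<lambda>n. if Suc i < c then e (c - Suc i) (Suc n) else 0) \<rho>"
        using IH[of "c - Suc i"] decays_shift[of "e (c - Suc i)" 1 \<rho>] by (cases "Suc i < c") (auto simp: Suc_le_eq)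
    qed
    have d: "decays (\<lambda>n. inverse (coeff (Q (Suc n)) 0) * (coeff (cross k n) (n + c) - S1 n + S2 n)) \<rho>"
      by (rule decays_mult_bounded[where C = B0], intro decays_add decays_diff d1 d2 assms less.prems)
         (use B0 in \<open>auto elim: eventually_mono\<close>)
    have ev: "\<forall>\<^sub>F n in sequentially. e c n = inverse (coeff (Q (Suc n)) 0) * (coeff (cross k n) (n + c) - S1 n + S2 n)"
      using solution_Suc B0
    proof eventually_elim
      case (elim n)
      have "coeff (cross k n) (n + c) = (\<Sum>i\<le>M. coeff (Q (Suc n)) i * (if i < c then e (c - i) n else 0)) - S2 n"
        using cross_coeff(2)[of n k c] elim(1) unfolding S2_def e_def M_def by blast
      also have "{..M} = insert 0 {1..M}" by auto
      also have "(\<Sum>i\<in>insert 0 {1..M}. coeff (Q (Suc n)) i * (if i < c then e (c - i) n else 0)) = coeff (Q (Suc n)) 0 * e c n + S1 n"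
        using less.prems unfolding S1_def by (subst sum.insert) auto
      finally show ?case using elim(2) by (simp add: field_simps)
    qed
    have "decays (e c) \<rho>" by (rule decays_cong[OF ev, THEN iffD2, OF d])
    thus ?case by (simp add: e_def)
  qed
qed

text \<open>
  After division by \<open>z\<^sup>n\<^sup>+\<^sup>1\<close> a polynomial of degree at most \<open>|m|\<close> remains, which is controlled by its values on a set of positive
  content. The set may depend on \<open>n\<close> as long as its content is bounded below.
\<close>

lemma cross_small_imp_tail_decays:
  assumes r: "0 < r1" "r1 \<le> r2" and \<delta>: "0 < \<delta>" and c0: "0 < c0"
    and small: "\<forall>\<^sub>F n in sequentially. \<exists>E. (\<forall>z\<in>E. r1 \<le> norm z \<and> norm z \<le> r2) \<and> ennreal c0 \<le> content E \<and>
       (\<forall>z\<in>E. norm (poly (cross k n) z) \<le> A * \<delta> ^ n)"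
  shows "tail_decays k (ereal (r1 / \<delta>))"
proof (rule cross_decays_imp_tail_decays)
  fix c :: nat assume c: "1 \<le> c"
  define N where "N = 1 + total_index m"
  define d where "d = c0 / (2 * real N)"
  have "real N > 0" by (simp add: N_def)
  hence d: "0 < d" "real N * d < c0" using c0 by (auto simp: d_def field_simps)
  have "0 \<le> r2" using r by linarith
  from coeffs_bounded_by_values[OF d(1) this, of N] obtain K where K0: "0 \<le> K" and
    K1: "\<forall>(p::complex poly) x X. degree p \<le> N \<longrightarrow> (\<forall>i\<le>N. norm (x i) \<le> r2 \<and> norm (poly p (x i)) \<le> X) \<longrightarrow>
     (\<forall>j\<le>N. \<forall>i<j. d \<le> norm (x j - x i)) \<longrightarrow> (\<forall>i. norm (coeff p i) \<le> K * X)"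
    by blast
  note K = K0 K1[THEN spec, THEN spec, THEN spec, THEN mp, THEN mp, THEN mp]
  have "\<forall>\<^sub>F n in sequentially. norm (coeff (cross k n) (n + c)) * (r1 / \<delta>) ^ n \<le> K * \<bar>A\<bar> / r1"
    using small solution_Suc
  proof eventually_elim
    case (elim n)
    note sol = elim(2)[THEN conjunct1] elim(2)[THEN conjunct2]
    obtain E where E: "\<forall>z\<in>E. r1 \<le> norm z \<and> norm z \<le> r2" "ennreal c0 \<le> content E"
       "\<forall>z\<in>E. norm (poly (cross k n) z) \<le> A * \<delta> ^ n" using elim(1) by blast
    define b where "b = poly_shift (Suc n) (cross k n)"
    have "coeff (cross k n) i = coeff (monom 1 (Suc n) * b) i" for i
      using cross_coeff(1)[OF sol, of i k] by (auto simp: b_def coeff_monom_mult coeff_poly_shift)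
    hence cross_b: "cross k n = monom 1 (Suc n) * b" by (simp add: poly_eq_iff)
    have "degree (cross k n) \<le> n + 1 + total_index m"
    proof -
      have "degree (P (Suc n) k) \<le> Suc n" "degree (P n k) \<le> n" "degree (Q n) \<le> total_index m" "degree (Q (Suc n)) \<le> total_index m"
        using sol unfolding hp_solution_def by (meson diff_le_self order_trans)+
      thus ?thesis unfolding cross_def
        by (intro degree_diff_le order_trans[OF degree_mult_le]) auto
    qed
    hence degb: "degree b \<le> N"
      unfolding b_def N_def by (intro degree_le) (auto simp: coeff_poly_shift intro!: coeff_eq_0)
    have "ennreal (real N * d) < content E"
      using d c0 by (intro less_le_trans[OF _ E(2)] ennreal_lessI) auto
    then obtain x where x: "\<forall>i\<le>N. x i \<in> E" "\<forall>j\<le>N. \<forall>i<j. d \<le> norm (x j - x i)"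
      using separated_points_exist[of d N E] d(1) by auto
    have "norm (x i) \<le> r2 \<and> norm (poly b (x i)) \<le> \<bar>A\<bar> * \<delta> ^ n / r1 ^ Suc n" if "i \<le> N" for i
    proof -
      define z where "z = x i"
      have z: "r1 \<le> norm z" "norm z \<le> r2" "norm (poly (cross k n) z) \<le> A * \<delta> ^ n" using x(1) that E by (auto simp: z_def)
      have "r1 ^ Suc n * norm (poly b z) \<le> norm z ^ Suc n * norm (poly b z)"
        using z r by (intro mult_right_mono power_mono) auto
      also have "\<dots> = norm (poly (cross k n) z)" unfolding cross_b by (simp add: poly_monom norm_mult norm_power)
      also have "\<dots> \<le> A * \<delta> ^ n" by (rule z(3))
      also have "\<dots> \<le> \<bar>A\<bar> * \<delta> ^ n" using \<delta> by (intro mult_right_mono) auto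
      finally have "norm (poly b z) \<le> \<bar>A\<bar> * \<delta> ^ n / r1 ^ Suc n" using r by (subst pos_le_divide_eq) (auto simp: mult.commute)
      thus ?thesis using z(2) by (simp add: z_def)
    qed
    hence "norm (coeff b (c - 1)) \<le> K * (\<bar>A\<bar> * \<delta> ^ n / r1 ^ Suc n)" using K(2)[OF degb _ x(2)] by blast
    moreover have "coeff (cross k n) (n + c) = coeff b (c - 1)" using c by (simp add: b_def coeff_poly_shift add.commute)
    ultimately have "norm (coeff (cross k n) (n + c)) * (r1 / \<delta>) ^ n \<le> K * (\<bar>A\<bar> * \<delta> ^ n / r1 ^ Suc n) * (r1 / \<delta>) ^ n"
      using r \<delta> by (intro mult_right_mono) auto
    also have "\<dots> = K * \<bar>A\<bar> / r1" using r \<delta> by (simp add: power_divide field_simps)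
    finally show ?case .
  qed
  thus "decays (\<lambda>n. coeff (cross k n) (n + c)) (ereal (r1 / \<delta>))" using r \<delta> by (intro decays_bound) auto
qed

end

section \<open>Rates and radii of convergence\<close>

lemma ennreal_pos_real_lower_bound:
  assumes "0 < (a :: ennreal)"
  shows "\<exists>b::real. 0 < b \<and> ennreal b \<le> a"
proof (cases a rule: ennreal_cases)
  case (real r)
  thus ?thesis using assms by (intro exI[of _ r]) auto
next
  case top
  thus ?thesis by (intro exI[of _ 1]) auto
qed

lemma limsup_ereal_root_le:
  assumes q: "0 \<le> q" and x: "\<forall>\<^sub>F n in sequentially. 0 \<le> x n \<and> x n \<le> ereal (D * q ^ Suc n)"
  shows "limsup (\<lambda>n. ereal_root n (x n)) \<le> ereal q"
proof -
  define A where "A = \<bar>D\<bar> * q + 1"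
  have A: "0 < A" using q by (simp add: A_def add_nonneg_pos)
  have "\<forall>\<^sub>F n in sequentially. ereal_root n (x n) \<le> ereal (root n A * q)"
    using x eventually_gt_at_top[of 0]
  proof eventually_elim
    case (elim n)
    then obtain y where y: "x n = ereal y" by (cases "x n") auto
    have "y \<le> D * q ^ Suc n" using elim y by auto
    also have "D * q ^ Suc n \<le> A * q ^ n"
    proof -
      have "D * q ^ Suc n = (D * q) * q ^ n" by simp
      also have "\<dots> \<le> A * q ^ n"
      proof (rule mult_right_mono)
        have "D * q \<le> \<bar>D\<bar> * q" using q by (intro mult_right_mono) auto
        thus "D * q \<le> A" by (simp add: A_def)
      qed (use q in simp)
      finally show ?thesis .
    qed
    finally have "y \<le> A * q ^ n" .
    hence "root n y \<le> root n (A * q ^ n)" using elim(2) by simp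
    also have "\<dots> = root n A * q" using elim(2) q by (simp add: real_root_mult real_root_power_cancel)
    finally show ?case by (simp add: ereal_root_def y)
  qed
  hence "limsup (\<lambda>n. ereal_root n (x n)) \<le> limsup (\<lambda>n. ereal (root n A * q))" by (rule Limsup_mono)
  also have "(\<lambda>n. root n A * q) \<longlonglongrightarrow> 1 * q" by (intro tendsto_intros LIMSEQ_root_const A)
  hence "limsup (\<lambda>n. ereal (root n A * q)) = ereal q"
    by (intro lim_imp_Limsup) (auto intro: tendsto_ereal)
  finally show ?thesis .
qed

lemma ereal_root_nonneg: "0 \<le> x \<Longrightarrow> 0 \<le> ereal_root n x"
proof (cases n)
  case 0
  thus "0 \<le> x \<Longrightarrow> 0 \<le> ereal_root n x" by (simp add: ereal_root_def)
next
  case (Suc k)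
  thus "0 \<le> x \<Longrightarrow> 0 \<le> ereal_root n x" by (auto simp: ereal_root_def real_of_ereal_pos)
qed

lemma sup_norm_on_nonneg: "0 \<le> sup_norm_on K h"
  unfolding sup_norm_on_def by (rule Sup_upper) simp

lemma ext_modulus_le_sup_norm: "z \<in> K \<Longrightarrow> ext_modulus h z \<le> sup_norm_on K h"
  unfolding sup_norm_on_def by (rule Sup_upper) simp

lemma sup_norm_on_leI: "0 \<le> b \<Longrightarrow> (\<And>z. z \<in> K \<Longrightarrow> ext_modulus h z \<le> b) \<Longrightarrow> sup_norm_on K h \<le> b"
  unfolding sup_norm_on_def by (rule Sup_least) auto

lemma sup_norm_on_id:
  assumes "z0 \<in> K" "\<And>z. z \<in> K \<Longrightarrow> norm z \<le> norm z0"
  shows "sup_norm_on K (\<lambda>z. z) = ereal (norm z0)"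
proof -
  have id: "ext_modulus (\<lambda>z. z) z = ereal (norm z)" for z by (rule ext_modulus_eqI[where \<phi> = "\<lambda>z. z"]) auto
  show ?thesis
  proof (rule antisym)
    show "sup_norm_on K (\<lambda>z. z) \<le> ereal (norm z0)" by (rule sup_norm_on_leI) (use assms id in auto)
    show "ereal (norm z0) \<le> sup_norm_on K (\<lambda>z. z)" using ext_modulus_le_sup_norm[OF assms(1), of "\<lambda>z. z"] by (simp add: id)
  qed
qed

lemma compact_in_eball_norm_bound:
  assumes "compact K" "K \<subseteq> eball 0 r" "0 < r"
  shows "\<exists>s t. 0 \<le> s \<and> s < t \<and> ereal t < r \<and> (\<forall>z\<in>K. norm z \<le> s)"
proof (cases "K = {}")
  case True
  obtain t where "0 < ereal t" "ereal t < r" using ereal_dense2[OF assms(3)] by blast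
  thus ?thesis using True by (intro exI[of _ 0] exI[of _ t]) auto
next
  case False
  have "continuous_on K norm" by (intro continuous_intros)
  then obtain z0 where z0: "z0 \<in> K" "\<And>z. z \<in> K \<Longrightarrow> norm z \<le> norm z0"
    using continuous_attains_sup[OF assms(1) False] by blast
  have "ereal (norm z0) < r" using z0(1) assms(2) by auto
  then obtain t where "ereal (norm z0) < ereal t" "ereal t < r" using ereal_dense2 by blast
  thus ?thesis using z0(2) by (intro exI[of _ "norm z0"] exI[of _ t]) auto
qed

lemma ereal_divide_less_scale:
  assumes "0 \<le> s" "0 < r" "ereal s / r < ereal y"
  shows "0 < y" "ereal (s / y) < r"
proof -
  have "0 \<le> ereal s / r" using assms by (cases r) auto
  thus y: "0 < y" using assms(3) by (metis ereal_less(2) less_le_trans not_le order_le_less_trans)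
  show "ereal (s / y) < r" using assms y by (cases r) (auto simp: field_simps)
qed

context hermite_pade_limit
begin

text \<open>
  Away from small disks around the zeros of \<open>QM\<close> the convergence is uniform, and the content of these disks is arbitrarily small.
\<close>

lemma tail_decays_imp_content_convergence:
  assumes tail: "tail_decays k \<rho>" and R: "0 < fps_conv_radius (f k)" and \<rho>: "0 < \<rho>"
  shows "\<exists>F. mero_extends (f k) F \<rho> \<and> converges_in_content (\<lambda>n z. poly (P n k) z / poly (Q n) z) F (eball 0 \<rho>)"
proof (intro exI conjI)
  note RQ = tail_decays_imp_radius(1)[OF tail R]
  define F where "F = (\<lambda>z. eval_fps (fps_of_poly QM * f k) z / poly QM z)"
  have F: "F has_fps_expansion f k" "F meromorphic_on eball 0 \<rho>" unfolding F_def
    using quotient_has_fps_expansion[OF QM_0 R] quotient_meromorphic[OF RQ] by auto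
  show "mero_extends (f k) F \<rho>" using F by (simp add: mero_extends_def)
  show "converges_in_content (\<lambda>n z. poly (P n k) z / poly (Q n) z) F (eball 0 \<rho>)"
    unfolding converges_in_content_def
  proof (intro allI impI, elim conjE)
    fix K :: "complex set" and \<epsilon> :: real assume K: "compact K" "K \<subseteq> eball 0 \<rho>" and \<epsilon>: "0 < \<epsilon>"
    define bad where "bad = (\<lambda>n. {z\<in>K. ereal \<epsilon> < ext_modulus (\<lambda>w. poly (P n k) w / poly (Q n) w - F w) z})"
    define Z where "Z = {z. poly QM z = 0}"
    have finZ: "finite Z" unfolding Z_def by (rule poly_roots_finite[OF QM_nonzero])
    obtain s t where st: "0 \<le> s" "s < t" "ereal t < \<rho>" "\<forall>z\<in>K. norm z \<le> s"
      using compact_in_eball_norm_bound[OF K \<rho>] by blast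
    have "(\<lambda>n. content (bad n)) \<longlonglongrightarrow> 0"
    proof (rule order_tendstoI)
      fix a :: ennreal assume a: "0 < a"
      then obtain b :: real where b: "0 < b" "ennreal b \<le> a"
        using ennreal_pos_real_lower_bound by blast
      define \<delta> where "\<delta> = b / (2 * (real (card Z) + 1))"
      have \<delta>: "0 < \<delta>" "real (card Z) * \<delta> < b" using b(1) by (auto simp: \<delta>_def field_simps intro!: add_nonneg_pos)
      define K' where "K' = K - (\<Union>z\<in>Z. ball z \<delta>)"
      have K': "compact K'" "K' \<subseteq> K" "\<And>z. z \<in> K' \<Longrightarrow> poly QM z \<noteq> 0"
        unfolding K'_def using K(1) \<delta>(1) by (auto intro!: compact_diff simp: Z_def)
      obtain D where D: "\<forall>\<^sub>F n in sequentially. \<forall>z\<in>K'. poly (Q n) z \<noteq> 0 \<and>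
          norm (eval_fps (remainder k n) z / (poly QM z * poly (Q n) z)) \<le> D * (norm z / t) ^ Suc n"
        using remainder_quotient_bound[OF tail RQ _ st(3) K'(1) _ st(2) K'(3)] st K'(2) by (metis less_le_trans not_le order_le_less_trans subsetD)
      have "(\<lambda>n. (\<bar>D\<bar> * (s / t)) * (s / t) ^ n) \<longlonglongrightarrow> 0"
        using st by (intro tendsto_mult_right_zero LIMSEQ_power_zero) auto
      hence "\<forall>\<^sub>F n in sequentially. (\<bar>D\<bar> * (s / t)) * (s / t) ^ n < \<epsilon>" using \<epsilon> by (rule order_tendstoD(2))
      hence "\<forall>\<^sub>F n in sequentially. bad n \<subseteq> (\<Union>z\<in>Z. ball z \<delta>)" using D
      proof eventually_elim
        case (elim n)
        show ?case
        proof
          fix z assume z: "z \<in> bad n"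
          show "z \<in> (\<Union>z\<in>Z. ball z \<delta>)"
          proof (rule ccontr)
            assume "\<not> ?thesis"
            hence zK: "z \<in> K'" using z by (auto simp: K'_def bad_def)
            hence z1: "poly QM z \<noteq> 0" "poly (Q n) z \<noteq> 0" "z \<in> eball 0 \<rho>" "norm z \<le> s"
              using K'(2,3) K(2) st(4) elim(2) by auto
            have "norm (eval_fps (remainder k n) z / (poly QM z * poly (Q n) z)) \<le> D * (norm z / t) ^ Suc n"
              using elim(2) zK by blast
            also have "\<dots> \<le> \<bar>D\<bar> * (s / t) ^ Suc n"
              using z1(4) st by (intro mult_mono power_mono divide_right_mono) auto
            also have "\<dots> < \<epsilon>" using elim(1) by (simp add: mult.assoc)
            finally have "ext_modulus (\<lambda>w. poly (P n k) w / poly (Q n) w - F w) z < ereal \<epsilon>"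
              using approximant_error_modulus(2)[OF F RQ z1(3,1,2)] by simp
            thus False using z by (auto simp: bad_def)
          qed
        qed
      qed
      thus "\<forall>\<^sub>F n in sequentially. content (bad n) < a"
      proof eventually_elim
        case (elim n)
        have "content (bad n) \<le> content (\<Union>z\<in>Z. ball z \<delta>)" by (rule content_mono[OF elim])
        also have "\<dots> \<le> ennreal (real (card Z) * \<delta>)" using \<delta>(1) by (intro content_UN_balls_le finZ) auto
        also have "\<dots> < ennreal b" using \<delta> b by (intro ennreal_lessI) auto
        also have "\<dots> \<le> a" by (rule b(2))
        finally show ?case .
      qed
    qed simp
    thus "(\<lambda>n. content {z\<in>K. ereal \<epsilon> < ext_modulus (\<lambda>w. poly (P n k) w / poly (Q n) w - F w) z}) \<longlonglongrightarrow> 0"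
      by (simp add: bad_def)
  qed
qed

lemma tail_decays_imp_le_conv_radius_content:
  assumes "tail_decays k \<rho>" "0 < fps_conv_radius (f k)"
  shows "\<rho> \<le> conv_radius_content (\<lambda>n z. poly (P n k) z / poly (Q n) z) (f k)"
proof (cases "0 < \<rho>")
  case True
  from tail_decays_imp_content_convergence[OF assms True] show ?thesis
    unfolding conv_radius_content_def by (intro Sup_upper insertI2) blast
next
  case False
  have "0 \<le> conv_radius_content (\<lambda>n z. poly (P n k) z / poly (Q n) z) (f k)"
    unfolding conv_radius_content_def by (intro Sup_upper) simp
  thus ?thesis using False by auto
qed

lemma denominators_eventually_bounded:
  assumes "0 \<le> r"
  shows "\<exists>B>0. \<forall>\<^sub>F n in sequentially. Q n \<noteq> 0 \<and> Q (Suc n) \<noteq> 0 \<and>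
           (\<forall>z. norm z \<le> r \<longrightarrow> norm (poly (Q n) z * poly (Q (Suc n)) z) \<le> B)"
proof -
  have "continuous_on (cball (0::complex) r) (\<lambda>z. norm (poly QM z))" by (intro continuous_intros)
  then obtain z0 where "\<And>z. z \<in> cball 0 r \<Longrightarrow> norm (poly QM z) \<le> norm (poly QM z0)"
    using continuous_attains_sup[OF compact_cball, of "0::complex" r] assms by (metis centre_in_cball empty_iff)
  hence b: "norm (poly QM z) \<le> norm (poly QM z0)" if "norm z \<le> r" for z using that by simp
  define b where "b = norm (poly QM z0) + 1"
  have b0: "0 < b" by (simp add: b_def add_nonneg_pos)
  have lim: "\<forall>\<^sub>F n in sequentially. \<forall>z. norm z \<le> r \<longrightarrow> norm (poly (Q n) z - poly QM z) < 1"
    by (rule poly_Q_uniform_limit) simp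
  have "\<forall>\<^sub>F n in sequentially. \<forall>z. norm z \<le> r \<longrightarrow> norm (poly (Q (Suc n)) z - poly QM z) < 1"
    using lim eventually_sequentially_Suc[of "\<lambda>n. \<forall>z. norm z \<le> r \<longrightarrow> norm (poly (Q n) z - poly QM z) < 1"] by simp
  with lim have "\<forall>\<^sub>F n in sequentially. Q n \<noteq> 0 \<and> Q (Suc n) \<noteq> 0 \<and>
           (\<forall>z. norm z \<le> r \<longrightarrow> norm (poly (Q n) z * poly (Q (Suc n)) z) \<le> b * b)"
    using solution_Suc
  proof eventually_elim
    case (elim n)
    have "norm (poly (Q n) z) \<le> b" "norm (poly (Q (Suc n)) z) \<le> b" if z: "norm z \<le> r" for z
    proof -
      have "norm (poly (Q n) z - poly QM z) < 1" "norm (poly (Q (Suc n)) z - poly QM z) < 1"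
        using elim(1,2) z by blast+
      thus "norm (poly (Q n) z) \<le> b" "norm (poly (Q (Suc n)) z) \<le> b"
        using b[OF z] norm_triangle_ineq2[of "poly (Q n) z" "poly QM z"] norm_triangle_ineq2[of "poly (Q (Suc n)) z" "poly QM z"]
        unfolding b_def by linarith+
    qed
    hence "\<forall>z. norm z \<le> r \<longrightarrow> norm (poly (Q n) z * poly (Q (Suc n)) z) \<le> b * b"
      using b0 by (auto simp: norm_mult intro!: mult_mono)
    thus ?case using elim(3) by (auto simp: hp_solution_def)
  qed
  thus ?thesis using b0 by (intro exI[of _ "b * b"]) auto
qed

lemma cross_le_of_errors:
  assumes F: "F meromorphic_on {z}" and Q: "Q n \<noteq> 0" "Q (Suc n) \<noteq> 0"
    and err: "ext_modulus (\<lambda>w. poly (P n k) w / poly (Q n) w - F w) z \<le> ereal a \<and>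
                ext_modulus (\<lambda>w. poly (P (Suc n) k) w / poly (Q (Suc n)) w - F w) z \<le> ereal b \<or>
              ext_modulus (\<lambda>w. F w - poly (P n k) w / poly (Q n) w) z \<le> ereal a \<and>
                ext_modulus (\<lambda>w. F w - poly (P (Suc n) k) w / poly (Q (Suc n)) w) z \<le> ereal b"
  shows "norm (poly (cross k n) z) \<le> norm (poly (Q n) z * poly (Q (Suc n)) z) * (a + b)"
proof -
  have ev: "\<forall>\<^sub>F w in at z. poly (Q n) w \<noteq> 0 \<and> poly (Q (Suc n)) w \<noteq> 0"
    using eventually_poly_nonzero[OF Q(1)] eventually_poly_nonzero[OF Q(2)] by (rule eventually_conj)
  have cont: "isCont (poly (cross k n)) z" "isCont (\<lambda>w. poly (Q n) w * poly (Q (Suc n)) w) z"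
    by (auto intro!: continuous_intros)
  show ?thesis using err
  proof (elim disjE conjE)
    assume e: "ext_modulus (\<lambda>w. poly (P n k) w / poly (Q n) w - F w) z \<le> ereal a"
      "ext_modulus (\<lambda>w. poly (P (Suc n) k) w / poly (Q (Suc n)) w - F w) z \<le> ereal b"
    have "norm (poly (cross k n) z) \<le> norm (poly (Q n) z * poly (Q (Suc n)) z) * (b + a)"
    proof (rule norm_le_of_ext_modulus[OF _ _ e(2,1) _ cont])
      show "\<forall>\<^sub>F w in at z. poly (cross k n) w = poly (Q n) w * poly (Q (Suc n)) w *
         ((poly (P (Suc n) k) w / poly (Q (Suc n)) w - F w) - (poly (P n k) w / poly (Q n) w - F w))"
        using ev by eventually_elim (simp add: cross_def field_simps)
    qed (intro meromorphic_intros F poly_meromorphic)+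
    thus ?thesis by (simp add: add.commute)
  next
    assume e: "ext_modulus (\<lambda>w. F w - poly (P n k) w / poly (Q n) w) z \<le> ereal a"
      "ext_modulus (\<lambda>w. F w - poly (P (Suc n) k) w / poly (Q (Suc n)) w) z \<le> ereal b"
    show ?thesis
    proof (rule norm_le_of_ext_modulus[OF _ _ e _ cont])
      show "\<forall>\<^sub>F w in at z. poly (cross k n) w = poly (Q n) w * poly (Q (Suc n)) w *
         ((F w - poly (P n k) w / poly (Q n) w) - (F w - poly (P (Suc n) k) w / poly (Q (Suc n)) w))"
        using ev by eventually_elim (simp add: cross_def field_simps)
    qed (intro meromorphic_intros F poly_meromorphic)+
  qed
qed

text \<open>
  On a real segment \<open>[r1, r2]\<close>, two consecutive approximants are both close to the limit outside sets of small content. The segment has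
  positive content, so \<open>cross_small_imp_tail_decays\<close> applies with \<open>\<delta> = 1\<close>.
\<close>

lemma content_convergence_imp_tail_decays:
  assumes ext: "mero_extends (f k) F r" and r: "0 < r"
    and conv: "converges_in_content (\<lambda>n z. poly (P n k) z / poly (Q n) z) F (eball 0 r)"
  shows "tail_decays k r"
proof (rule tail_decaysI)
  fix r1 :: real assume r1: "0 < r1" "ereal r1 < r"
  obtain r2 where r2: "r1 < r2" "ereal r2 < r" using ereal_dense2[OF r1(2)] by auto
  define K where "K = complex_of_real ` {r1..r2}"
  define c where "c = (r2 - r1) / 8"
  have c: "0 < c" using r2 by (simp add: c_def)
  define bad where "bad = (\<lambda>n. {z\<in>K. ereal 1 < ext_modulus (\<lambda>w. poly (P n k) w / poly (Q n) w - F w) z})"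
  have normK: "r1 \<le> norm z \<and> norm z \<le> r2" if "z \<in> K" for z using that r1 by (auto simp: K_def)
  have KE: "K \<subseteq> eball 0 r"
  proof
    fix z assume "z \<in> K"
    hence "ereal (norm z) \<le> ereal r2" using normK by simp
    hence "ereal (norm z) < r" using r2(2) by (rule le_less_trans)
    thus "z \<in> eball 0 r" by simp
  qed
  have "compact K" unfolding K_def by (intro compact_continuous_image continuous_intros) auto
  hence "(\<lambda>n. content (bad n)) \<longlonglongrightarrow> 0"
    using conv[unfolded converges_in_content_def, THEN spec[of _ K], THEN spec[of _ 1]] KE
    unfolding bad_def by simp
  hence small: "\<forall>\<^sub>F n in sequentially. content (bad n) < ennreal c" using c by (intro order_tendstoD(2)) auto
  hence smallS: "\<forall>\<^sub>F n in sequentially. content (bad (Suc n)) < ennreal c"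
    using eventually_sequentially_Suc[of "\<lambda>n. content (bad n) < ennreal c"] by simp
  have r2pos: "0 \<le> r2" using r1 r2 by linarith
  obtain B where B: "0 < B" "\<forall>\<^sub>F n in sequentially. Q n \<noteq> 0 \<and> Q (Suc n) \<noteq> 0 \<and>
           (\<forall>z. norm z \<le> r2 \<longrightarrow> norm (poly (Q n) z * poly (Q (Suc n)) z) \<le> B)"
    using denominators_eventually_bounded[OF r2pos] by blast
  have "tail_decays k (ereal (r1 / 1))"
  proof (rule cross_small_imp_tail_decays[where ?r2.0 = r2 and A = "B * 2"])
    show "\<forall>\<^sub>F n in sequentially. \<exists>E. (\<forall>z\<in>E. r1 \<le> norm z \<and> norm z \<le> r2) \<and> ennreal c \<le> content E \<and>
       (\<forall>z\<in>E. norm (poly (cross k n) z) \<le> B * 2 * 1 ^ n)"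
      using small smallS B(2)
    proof eventually_elim
      case (elim n)
      define E where "E = K - bad n - bad (Suc n)"
      have "ennreal c \<le> content E"
      proof (rule ccontr)
        assume "\<not> ?thesis"
        hence lt: "content E < ennreal c" by simp
        have "K \<subseteq> E \<union> (bad n \<union> bad (Suc n))" by (auto simp: E_def)
        hence "content K \<le> content (E \<union> (bad n \<union> bad (Suc n)))" by (rule content_mono)
        also have "\<dots> \<le> content E + (content (bad n) + content (bad (Suc n)))"
          by (rule order_trans[OF content_Un_le add_left_mono[OF content_Un_le]])
        also have "\<dots> \<le> ennreal c + (ennreal c + ennreal c)"
          using lt elim(1,2) by (intro add_mono) auto
        also have "\<dots> = ennreal (3 * c)" using c by (simp flip: ennreal_plus)
        also have "\<dots> < ennreal ((r2 - r1) / 2)" using r2 by (intro ennreal_lessI) (auto simp: c_def)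
        also have "\<dots> \<le> content K" unfolding K_def using r2 by (intro content_segment_ge) auto
        finally show False by simp
      qed
      moreover have "norm (poly (cross k n) z) \<le> B * 2 * 1 ^ n" if z: "z \<in> E" for z
      proof -
        have zK: "z \<in> K" using z by (simp add: E_def)
        have "F meromorphic_on {z}" using ext KE zK by (auto simp: mero_extends_def intro: meromorphic_on_subset)
        moreover have "ext_modulus (\<lambda>w. poly (P n k) w / poly (Q n) w - F w) z \<le> ereal 1"
          "ext_modulus (\<lambda>w. poly (P (Suc n) k) w / poly (Q (Suc n)) w - F w) z \<le> ereal 1"
          using z by (auto simp: E_def bad_def not_less)
        ultimately have "norm (poly (cross k n) z) \<le> norm (poly (Q n) z * poly (Q (Suc n)) z) * (1 + 1)"
          using elim(3) by (intro cross_le_of_errors) auto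
        also have "\<dots> \<le> B * (1 + 1)" using elim(3) normK[OF zK] by (intro mult_right_mono) auto
        finally show ?thesis by simp
      qed
      ultimately show ?case using normK by (intro exI[of _ E]) (auto simp: E_def)
    qed
  qed (use r1 r2 c in auto)
  thus "tail_decays k (ereal r1)" by simp
qed

text \<open>
  Regularity provides a set of positive content near \<open>z0\<close> on which consecutive approximants differ by \<open>O(\<theta>\<^sup>n)\<close>.
\<close>

lemma small_error_imp_tail_decays:
  assumes F: "\<And>z. z \<in> K \<Longrightarrow> F meromorphic_on {z}" and reg: "content_regular K" and z0: "z0 \<in> K"
    and r1: "0 < r1" "r1 < norm z0" and \<theta>: "0 < \<theta>"
    and err: "\<forall>\<^sub>F n in sequentially. \<forall>z\<in>K. ext_modulus (\<lambda>w. F w - poly (P n k) w / poly (Q n) w) z \<le> ereal (\<theta> ^ n)"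
  shows "tail_decays k (ereal (r1 / \<theta>))"
proof -
  define r2 where "r2 = norm z0 + (norm z0 - r1)"
  define E where "E = {z\<in>K. norm (z - z0) < norm z0 - r1}"
  have normE: "r1 \<le> norm z \<and> norm z \<le> r2" if "z \<in> E" for z
    using that norm_triangle_ineq2[of z0 z] norm_triangle_ineq2[of z z0] by (auto simp: E_def r2_def norm_minus_commute)
  have "0 < content E" using reg z0 r1 unfolding content_regular_def E_def by auto
  then obtain c :: real where c: "0 < c" "ennreal c \<le> content E"
    using ennreal_pos_real_lower_bound by blast
  have r2pos: "0 \<le> r2" using r1 by (simp add: r2_def)
  obtain B where B: "0 < B" "\<forall>\<^sub>F n in sequentially. Q n \<noteq> 0 \<and> Q (Suc n) \<noteq> 0 \<and>
           (\<forall>z. norm z \<le> r2 \<longrightarrow> norm (poly (Q n) z * poly (Q (Suc n)) z) \<le> B)"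
    using denominators_eventually_bounded[OF r2pos] by blast
  have errS: "\<forall>\<^sub>F n in sequentially. \<forall>z\<in>K. ext_modulus (\<lambda>w. F w - poly (P (Suc n) k) w / poly (Q (Suc n)) w) z \<le> ereal (\<theta> ^ Suc n)"
    using err eventually_sequentially_Suc[of "\<lambda>n. \<forall>z\<in>K. ext_modulus (\<lambda>w. F w - poly (P n k) w / poly (Q n) w) z \<le> ereal (\<theta> ^ n)"] by simp
  show ?thesis
  proof (rule cross_small_imp_tail_decays[where ?r2.0 = r2 and A = "B * (1 + \<theta>)"])
    show "\<forall>\<^sub>F n in sequentially. \<exists>E. (\<forall>z\<in>E. r1 \<le> norm z \<and> norm z \<le> r2) \<and> ennreal c \<le> content E \<and>
       (\<forall>z\<in>E. norm (poly (cross k n) z) \<le> B * (1 + \<theta>) * \<theta> ^ n)"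
      using err errS B(2)
    proof eventually_elim
      case (elim n)
      have "norm (poly (cross k n) z) \<le> B * (1 + \<theta>) * \<theta> ^ n" if z: "z \<in> E" for z
      proof -
        have zK: "z \<in> K" using z by (simp add: E_def)
        have "norm (poly (cross k n) z) \<le> norm (poly (Q n) z * poly (Q (Suc n)) z) * (\<theta> ^ n + \<theta> ^ Suc n)"
          using elim zK F[OF zK] by (intro cross_le_of_errors) auto
        also have "\<dots> \<le> B * (\<theta> ^ n + \<theta> ^ Suc n)" using elim(3) normE[OF z] \<theta> by (intro mult_right_mono) auto
        finally show ?thesis by (simp add: algebra_simps)
      qed
      thus ?case using normE c(2) by blast
    qed
  qed (use r1 \<theta> c r2pos in \<open>auto simp: r2_def\<close>)
qed

lemma tail_decays_radius:
  "tail_decays k (fps_conv_radius (f k))"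
proof -
  obtain B where B: "\<And>i. \<forall>\<^sub>F n in sequentially. norm (coeff (Q n) i) \<le> B" using coeff_Q_bounded by blast
  show ?thesis unfolding tail_decays_def
    by (intro allI impI decays_bounded_poly_mult[OF B degree_Q order_refl])
qed

text \<open>
  A series that converges nowhere except at the origin is not the expansion of any function, so all radii are zero.
\<close>

lemma radius_sys_star_of_divergent:
  assumes "\<not> 0 < fps_conv_radius (f k)"
  shows "radius_sys_star f m k = 0" "conv_radius_content (\<lambda>n z. poly (P n k) z / poly (Q n) z) (f k) = 0"
proof -
  have no: "\<not> mero_extends (f k) F r" for F r
    using assms fps_conv_radius_pos_of_expansion[of F "f k"] by (auto simp: mero_extends_def)
  have "radius_sys f m k = 0" unfolding radius_sys_def by (simp add: no)
  moreover from this have "eball (0::complex) (radius_sys f m k) = {}" by simp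
  ultimately show "radius_sys_star f m k = 0" unfolding radius_sys_star_def by (simp add: top_ereal_def)
  show "conv_radius_content (\<lambda>n z. poly (P n k) z / poly (Q n) z) (f k) = 0"
    unfolding conv_radius_content_def by (simp add: no)
qed

lemma tail_decays_conv_radius_content:
  "tail_decays k (conv_radius_content (\<lambda>n z. poly (P n k) z / poly (Q n) z) (f k))"
proof (rule tail_decaysI)
  fix r assume r: "0 < r" "ereal r < conv_radius_content (\<lambda>n z. poly (P n k) z / poly (Q n) z) (f k)"
  then obtain r' F where r': "ereal r < r'" "mero_extends (f k) F r'"
      "converges_in_content (\<lambda>n z. poly (P n k) z / poly (Q n) z) F (eball 0 r')"
    unfolding conv_radius_content_def less_Sup_iff by force
  have "0 < r'" using r(1) r'(1) by (auto intro: less_trans[of _ "ereal r"])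
  from content_convergence_imp_tail_decays[OF r'(2) this r'(3)] show "tail_decays k (ereal r)"
    using tail_decays_mono r'(1) by (meson less_imp_le)
qed

lemma conv_radius_content_eq:
  "conv_radius_content (\<lambda>n z. poly (P n k) z / poly (Q n) z) (f k) = radius_sys_star f m k"
proof (cases "0 < fps_conv_radius (f k)")
  case R: True
  define Rst where "Rst = conv_radius_content (\<lambda>n z. poly (P n k) z / poly (Q n) z) (f k)"
  have "fps_conv_radius (f k) \<le> Rst" unfolding Rst_def
    by (rule tail_decays_imp_le_conv_radius_content[OF tail_decays_radius R])
  hence pos: "0 < Rst" using R by order
  show ?thesis unfolding Rst_def[symmetric]
  proof (rule antisym)
    show "Rst \<le> radius_sys_star f m k"
      using tail_decays_imp_radius(2)[OF tail_decays_conv_radius_content R] pos unfolding Rst_def .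
    show "radius_sys_star f m k \<le> Rst"
    proof (rule ccontr)
      assume "\<not> ?thesis"
      hence "Rst < radius_sys_star f m k" by simp
      then obtain \<rho> where \<rho>: "Rst < ereal \<rho>" "ereal \<rho> < radius_sys_star f m k" using ereal_dense2 by blast
      have "0 < ereal \<rho>" using pos \<rho>(1) by (rule less_trans)
      from tail_decays_imp_le_conv_radius_content[OF radius_sys_star_imp_tail_decays(2)[OF this \<rho>(2)] R]
      show False using \<rho>(1) unfolding Rst_def by simp
    qed
  qed
next
  case False
  thus ?thesis by (simp add: radius_sys_star_of_divergent)
qed

text \<open>
  The upper bound lets \<open>t\<close> increase to the radius in \<open>remainder_quotient_bound\<close>. For the lower bound, an error of order
  \<open>\<theta>\<^sup>n\<close> with \<open>\<theta>\<close> smaller than the claimed rate would, by \<open>small_error_imp_tail_decays\<close> at a point of maximal modulus, make the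
  tails decay beyond the radius of convergence in content.
\<close>

lemma error_rate:
  assumes K: "compact K" "K \<subseteq> eball 0 Rst - system_poles f m"
    and Rst: "Rst = conv_radius_content (\<lambda>n z. poly (P n k) z / poly (Q n) z) (f k)"
  shows "limsup (\<lambda>n. ereal_root n (sup_norm_on K (\<lambda>z. mero_ext (f k) z - poly (P n k) z / poly (Q n) z)))
           \<le> sup_norm_on K (\<lambda>z. z) / Rst"
    and "content_regular K \<Longrightarrow> limsup (\<lambda>n. ereal_root n (sup_norm_on K (\<lambda>z. mero_ext (f k) z - poly (P n k) z / poly (Q n) z)))
           = sup_norm_on K (\<lambda>z. z) / Rst"
proof -
  define h where "h = (\<lambda>n z. mero_ext (f k) z - poly (P n k) z / poly (Q n) z)"
  define L where "L = limsup (\<lambda>n. ereal_root n (sup_norm_on K (h n)))"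
  have L0: "0 \<le> L" unfolding L_def
    by (rule le_Limsup) (simp, intro always_eventually allI ereal_root_nonneg sup_norm_on_nonneg)
  have "L \<le> sup_norm_on K (\<lambda>z. z) / Rst \<and> (content_regular K \<longrightarrow> L = sup_norm_on K (\<lambda>z. z) / Rst)"
  proof (cases "K = {}")
    case True
    have "ereal_root n 0 = 0" for n by (simp add: ereal_root_def)
    hence "L = 0" unfolding L_def True sup_norm_on_def by (simp add: Limsup_const)
    moreover have "sup_norm_on K (\<lambda>z. z) / Rst = 0" unfolding True sup_norm_on_def by simp
    ultimately show ?thesis by simp
  next
    case False
    have "continuous_on K norm" by (intro continuous_intros)
    then obtain z0 where z0: "z0 \<in> K" "\<And>z. z \<in> K \<Longrightarrow> norm z \<le> norm z0"
      using continuous_attains_sup[OF K(1) False] by blast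
    define s where "s = norm z0"
    have sup: "sup_norm_on K (\<lambda>z. z) = ereal s" unfolding s_def by (rule sup_norm_on_id[OF z0])
    have sR: "ereal s < Rst" using z0(1) K(2) by (auto simp: s_def)
    have s0: "0 \<le> s" by (simp add: s_def)
    have R0: "0 < Rst" using sR s0 by (auto intro: le_less_trans[of _ "ereal s"])
    have R: "0 < fps_conv_radius (f k)"
      using R0 radius_sys_star_of_divergent(2)[of k] Rst by force
    have tail: "tail_decays k Rst" unfolding Rst by (rule tail_decays_conv_radius_content)
    note RQ = tail_decays_imp_radius(1)[OF tail R]
    have "Rst \<le> radius_sys f m k"
      using conv_radius_content_eq[of k] Rst by (simp add: radius_sys_star_def)
    hence Rm: "Rst \<le> mero_radius (f k)" using radius_sys_le(2)[OF R] by order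
    note F = mero_ext_facts(1)[OF R] mero_ext_facts(3)[OF R Rm]
    have KQ: "poly QM z \<noteq> 0" if "z \<in> K" for z using that K(2) by (auto simp: system_poles_eq)
    have upper: "L \<le> ereal (s / t)" if t: "s < t" "ereal t < Rst" for t
    proof -
      have t0: "0 < t" using s0 t(1) by linarith
      obtain D where D: "\<forall>\<^sub>F n in sequentially. \<forall>z\<in>K. poly (Q n) z \<noteq> 0 \<and>
          norm (eval_fps (remainder k n) z / (poly QM z * poly (Q n) z)) \<le> D * (norm z / t) ^ Suc n"
        using remainder_quotient_bound[OF tail RQ t0 t(2) K(1) _ t(1) KQ] z0(2) unfolding s_def by blast
      hence "\<forall>\<^sub>F n in sequentially. 0 \<le> sup_norm_on K (h n) \<and> sup_norm_on K (h n) \<le> ereal (\<bar>D\<bar> * (s / t) ^ Suc n)"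
      proof eventually_elim
        case (elim n)
        have "ext_modulus (h n) z \<le> ereal (\<bar>D\<bar> * (s / t) ^ Suc n)" if z: "z \<in> K" for z
        proof -
          have "norm (eval_fps (remainder k n) z / (poly QM z * poly (Q n) z)) \<le> D * (norm z / t) ^ Suc n"
            using elim z by blast
          also have "\<dots> \<le> \<bar>D\<bar> * (s / t) ^ Suc n"
            using z0(2)[OF z] t0 by (intro mult_mono power_mono divide_right_mono) (auto simp: s_def)
          finally show ?thesis
            using approximant_error_modulus(1)[OF F RQ _ KQ[OF z]] elim z K(2) unfolding h_def by auto
        qed
        thus ?case using s0 t0 by (intro conjI sup_norm_on_nonneg sup_norm_on_leI) auto
      qed
      thus ?thesis unfolding L_def using s0 t0 by (intro limsup_ereal_root_le) auto
    qed
    have le: "L \<le> ereal s / Rst"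
    proof (rule ccontr)
      assume "\<not> ?thesis"
      hence "ereal s / Rst < L" by simp
      then obtain y where y: "ereal s / Rst < ereal y" "ereal y < L" using ereal_dense2 by blast
      note sy = ereal_divide_less_scale[OF s0 R0 y(1)]
      have "ereal (max s (s / y)) < Rst" using sR sy(2) by (simp add: max_def)
      then obtain t where "ereal (max s (s / y)) < ereal t" and tR: "ereal t < Rst" using ereal_dense2 by blast
      hence t: "max s (s / y) < t" by simp
      have "L \<le> ereal (s / t)" by (rule upper[OF _ tR]) (use t in auto)
      also have "s / t \<le> y" using t(1) sy(1) s0 by (simp add: field_simps)
      finally show False using y(2) by simp
    qed
    have eq: "L = ereal s / Rst" if reg: "content_regular K"
    proof (rule antisym[OF le], rule ccontr)
      assume "\<not> ereal s / Rst \<le> L"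
      hence lt: "L < ereal s / Rst" by simp
      then obtain \<theta> where \<theta>: "L < ereal \<theta>" "ereal \<theta> < ereal s / Rst" using ereal_dense2 by blast
      have \<theta>0: "0 < \<theta>" using L0 \<theta>(1) by (metis ereal_less(2) le_less_trans)
      obtain R' where R': "Rst = ereal R'" "0 < R'"
        using R0 \<theta>(2) \<theta>0 by (cases Rst) auto
      have lt': "R' * \<theta> < s" using \<theta>(2) R' by (simp add: field_simps)
      obtain r1 where r1: "R' * \<theta> < r1" "r1 < s" using dense[OF lt'] by blast
      have r10: "0 < r1" using r1(1) R'(2) \<theta>0 by (meson less_trans mult_pos_pos)
      have "\<forall>\<^sub>F n in sequentially. ereal_root n (sup_norm_on K (h n)) < ereal \<theta>"
        using Limsup_lessD[OF \<theta>(1)[unfolded L_def]] .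
      hence err: "\<forall>\<^sub>F n in sequentially. \<forall>z\<in>K. ext_modulus (h n) z \<le> ereal (\<theta> ^ n)"
        using eventually_gt_at_top[of 0]
      proof eventually_elim
        case (elim n)
        have "sup_norm_on K (h n) \<noteq> \<infinity>" using elim(1) by (auto simp: ereal_root_def)
        then obtain x where x: "sup_norm_on K (h n) = ereal x" "0 \<le> x"
          using sup_norm_on_nonneg[of K "h n"] by (cases "sup_norm_on K (h n)") auto
        have "root n x < \<theta>" using elim(1) by (simp add: ereal_root_def x)
        hence "root n x ^ n \<le> \<theta> ^ n" using x(2) elim(2) by (intro power_mono) auto
        hence "x \<le> \<theta> ^ n" using elim(2) x(2) by simp
        thus ?case using ext_modulus_le_sup_norm[of _ K "h n"] x(1) by (metis ereal_less_eq(3) order_trans)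
      qed
      have "tail_decays k (ereal (r1 / \<theta>))"
      proof (rule small_error_imp_tail_decays[OF _ reg z0(1) r10 _ \<theta>0 err[unfolded h_def]])
        show "mero_ext (f k) meromorphic_on {z}" if "z \<in> K" for z
          using F(2) that K(2) by (auto intro: meromorphic_on_subset)
        show "r1 < norm z0" using r1(2) by (simp add: s_def)
      qed
      hence "ereal (r1 / \<theta>) \<le> Rst" unfolding Rst using R by (rule tail_decays_imp_le_conv_radius_content)
      hence "r1 / \<theta> \<le> R'" by (simp add: R')
      thus False using r1(1) \<theta>0 by (simp add: field_simps)
    qed
    show ?thesis unfolding sup using le eq by blast
  qed
  thus "limsup (\<lambda>n. ereal_root n (sup_norm_on K (\<lambda>z. mero_ext (f k) z - poly (P n k) z / poly (Q n) z)))
           \<le> sup_norm_on K (\<lambda>z. z) / Rst"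
    and "content_regular K \<Longrightarrow> limsup (\<lambda>n. ereal_root n (sup_norm_on K (\<lambda>z. mero_ext (f k) z - poly (P n k) z / poly (Q n) z)))
           = sup_norm_on K (\<lambda>z. z) / Rst"
    unfolding L_def h_def by blast+
qed

end

theorem theorem3p6:
  fixes f :: "'d::finite \<Rightarrow> complex fps"
    and m :: "'d \<Rightarrow> nat"
    and Q :: "nat \<Rightarrow> complex poly"
    and P :: "nat \<Rightarrow> 'd \<Rightarrow> complex poly"
    and R :: "nat \<Rightarrow> 'd \<Rightarrow> complex \<Rightarrow> complex"
    and Rstar :: "'d \<Rightarrow> ereal"
  assumes m_nonzero: "m \<noteq> (\<lambda>k. 0)"
    and approximants: "\<And>n. n \<ge> Max (range m) \<Longrightarrow> hp_approximant f m n (Q n) (P n)"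
    and R_def: "\<And>n k z. R n k z = poly (P n k) z / poly (Q n) z"
    and Rstar_def: "\<And>k. Rstar k = conv_radius_content (\<lambda>n. R n k) (f k)"
    and a_or_b:
      "(radius_analytic f > 0 \<and> finite (system_poles f m) \<and>
          (\<Sum>\<xi>\<in>system_poles f m. system_pole_order f m \<xi>) = total_index m)
       \<or>
       ((\<forall>\<^sub>F n in sequentially. \<forall>Q' P'. hp_approximant f m n Q' P' \<longrightarrow> Q' = Q n) \<and>
          (\<exists>Qlim \<theta>. degree Qlim = total_index m \<and> poly Qlim 0 \<noteq> 0 \<and>
             limsup (\<lambda>n. ereal (root n (coeff_norm (Qlim - Q n)))) = ereal \<theta> \<and> \<theta> < 1))"
  shows "\<forall>k.
      (\<forall>K. compact K \<and> K \<subseteq> eball 0 (Rstar k) - system_poles f m \<longrightarrow>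
         limsup (\<lambda>n. ereal_root n (sup_norm_on K (\<lambda>z. mero_ext (f k) z - R n k z)))
           \<le> sup_norm_on K (\<lambda>z. z) / Rstar k \<and>
         (content_regular K \<longrightarrow>
           limsup (\<lambda>n. ereal_root n (sup_norm_on K (\<lambda>z. mero_ext (f k) z - R n k z)))
             = sup_norm_on K (\<lambda>z. z) / Rstar k)) \<and>
      Rstar k = radius_sys_star f m k"
proof -
  have "\<exists>QM l C. realized_poles (poly_combinations f m) Q QM l C (total_index m) \<and>
           (\<forall>\<^sub>F n in sequentially. hp_solution f m n (Q n) (P n))"
    using a_or_b
  proof (elim disjE conjE exE)
    assume "finite (system_poles f m)" "(\<Sum>\<xi>\<in>system_poles f m. system_pole_order f m \<xi>) = total_index m"
    thus ?thesis using system_poles_imp_realized_poles[OF approximants] by blast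
  next
    fix Qlim \<theta>
    assume "\<forall>\<^sub>F n in sequentially. \<forall>Q' P'. hp_approximant f m n Q' P' \<longrightarrow> Q' = Q n"
      "degree Qlim = total_index m" "poly Qlim 0 \<noteq> 0"
      "limsup (\<lambda>n. ereal (root n (coeff_norm (Qlim - Q n)))) = ereal \<theta>" "\<theta> < 1"
    thus ?thesis using convergence_imp_realized_poles[OF approximants, of Qlim] by (simp add: one_ereal_def)
  qed
  then obtain QM l C where real: "realized_poles (poly_combinations f m) Q QM l C (total_index m)"
    and sol: "\<forall>\<^sub>F n in sequentially. hp_solution f m n (Q n) (P n)" by blast
  interpret realized_poles "poly_combinations f m" Q QM l C "total_index m" by (rule real)
  interpret hermite_pade_limit f m Q QM l C P by unfold_locales (rule sol)
  have R: "R n k = (\<lambda>z. poly (P n k) z / poly (Q n) z)" for n k by (rule ext) (rule R_def)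
  have Rstar: "Rstar k = conv_radius_content (\<lambda>n z. poly (P n k) z / poly (Q n) z) (f k)" for k
    unfolding Rstar_def R ..
  show ?thesis
    using error_rate[OF _ _ Rstar] conv_radius_content_eq unfolding R_def Rstar by blast
qed

end
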